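(* Let $K$ be an algebraically closed field of characteristic $0$. Let $n\geq 2$ and $d\geq 2$ be integers, and let $\mathcal{P} : [n] \rightarrow [n]$ be a portrait. Then $\mathcal{M}_{\mathcal{P},d}(K) \neq \emptyset$ if and only if (1) every element of $[n]$ has at most $d$ preimages under $\mathcal{P}$, and (2) for every integer $k\geq 1$, $\mathcal{P}$ has at most $\frac{1}{k}\sum_{j\mid k}\mu(k/j)d^{j}$ periodic cycles of length $k$. In this case, $\dim \mathcal{M}_{\mathcal{P},d} = \min\{d - 1, n - 2\}$.
   Context: $[n] := \{1,\ldots,n\}$; a portrait on $[n]$ is an arbitrary function $\mathcal{P}:[n]\to[n]$. $\mu$ is the Möbius function. $\mathrm{Conf}^n := \{(q_1,\ldots,q_n)\in\mathbb{A}^n : q_i\neq q_j \text{ for } i\neq j\}$ is the configuration space of $n$ distinct points on the affine line. $\mathrm{Conf}_{\mathcal{P},d}$ is the locally closed subvariety of $\mathrm{Conf}^n$ consisting of all $q$ for which there exists a polynomial $f$ of degree exactly $d$ with $f(q_i)=q_{\mathcal{P}(i)}$ for all $i\in[n]$. The affine group $\mathrm{Aff}_1$ of polynomials $\ell(x)=ax+b$ with $a\neq 0$ acts on $\mathrm{Conf}^n$ by $\ell(q)=(\ell(q_1),\ldots,\ell(q_n))$ and stabilizes $\mathrm{Conf}_{\mathcal{P},d}$. The degree-$d$ portrait moduli space is $\mathcal{M}_{\mathcal{P},d} := \mathrm{Conf}_{\mathcal{P},d}/\mathrm{Aff}_1$; since $\mathrm{Aff}_1$ acts sharply 2-transitively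 on $\mathbb{A}^1$, for $n\ge 2$ it is identified with $\{q\in \mathrm{Conf}_{\mathcal{P},d} : q_1=0,\ q_2=1\}$. *)

theory Defs
  imports
    "HOL-Analysis.Abstract_Topology"
    "HOL-Computational_Algebra.Polynomial"
    "HOL-Computational_Algebra.Squarefree"
    "HOL-Combinatorics.Orbits"
    "HOL-Library.Extended_Nat"
    "HOL-Library.FuncSet"
begin

section \<open>Affine space and its Zariski topology\<close>

text \<open>
  Varieties over an algebraically closed field are represented by their sets of \<open>K\<close>-points.
  A point \<open>(q\<^sub>1, \<dots>, q\<^sub>n)\<close> is a function on \<open>{1..n}\<close>, extended by \<open>undefined\<close>.
\<close>

definition affine_space :: "nat \<Rightarrow> (nat \<Rightarrow> 'k) set" where
  "affine_space n = {1..n} \<rightarrow>\<^sub>E UNIV"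

inductive_set poly_funs :: "nat \<Rightarrow> ((nat \<Rightarrow> 'k::field) \<Rightarrow> 'k) set" for n :: nat where
  const: "(\<lambda>q. c) \<in> poly_funs n"
| coord: "i \<in> {1..n} \<Longrightarrow> (\<lambda>q. q i) \<in> poly_funs n"
| add: "f \<in> poly_funs n \<Longrightarrow> g \<in> poly_funs n \<Longrightarrow> (\<lambda>q. f q + g q) \<in> poly_funs n"
| mult: "f \<in> poly_funs n \<Longrightarrow> g \<in> poly_funs n \<Longrightarrow> (\<lambda>q. f q * g q) \<in> poly_funs n"

definition zero_locus :: "nat \<Rightarrow> ((nat \<Rightarrow> 'k::field) \<Rightarrow> 'k) set \<Rightarrow> (nat \<Rightarrow> 'k) set" where
  "zero_locus n F = {q \<in> affine_space n. \<forall>f\<in>F. f q = 0}"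

definition zariski :: "nat \<Rightarrow> (nat \<Rightarrow> 'k::field) topology" where
  "zariski n = topology (\<lambda>U. \<exists>F \<subseteq> poly_funs n. U = affine_space n - zero_locus n F)"

lemma istopology_zariski:
  "istopology (\<lambda>U. \<exists>F \<subseteq> poly_funs n. U = affine_space n - zero_locus n (F :: ((nat \<Rightarrow> 'k::field) \<Rightarrow> 'k) set))"
  unfolding istopology_def
proof (intro conjI allI impI)
  fix S T :: "(nat \<Rightarrow> 'k) set"
  assume "\<exists>F \<subseteq> poly_funs n. S = affine_space n - zero_locus n F"
    and "\<exists>F \<subseteq> poly_funs n. T = affine_space n - zero_locus n F"
  then obtain F G where FG: "F \<subseteq> poly_funs n" "G \<subseteq> poly_funs n"
    and S: "S = affine_space n - zero_locus n F" and T: "T = affine_space n - zero_locus n G"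
    by blast
  let ?H = "{\<lambda>q. f q * g q | f g. f \<in> F \<and> g \<in> G}"
  have "?H \<subseteq> poly_funs n"
    using FG by (auto intro!: poly_funs.mult)
  moreover have "S \<inter> T = affine_space n - zero_locus n ?H"
  proof (rule set_eqI)
    fix q
    have "(\<exists>h\<in>?H. h q \<noteq> 0) \<longleftrightarrow> (\<exists>f\<in>F. f q \<noteq> 0) \<and> (\<exists>g\<in>G. g q \<noteq> 0)"
      by (fastforce simp: mult_eq_0_iff)
    moreover have "q \<in> affine_space n - zero_locus n E \<longleftrightarrow>
        q \<in> affine_space n \<and> (\<exists>f\<in>E. f q \<noteq> 0)" for E :: "((nat \<Rightarrow> 'k) \<Rightarrow> 'k) set"
      by (auto simp: zero_locus_def)
    ultimately show "q \<in> S \<inter> T \<longleftrightarrow> q \<in> affine_space n - zero_locus n ?H"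
      unfolding S T by (simp only: Int_iff) argo
  qed
  ultimately show "\<exists>F \<subseteq> poly_funs n. S \<inter> T = affine_space n - zero_locus n F"
    by blast
next
  fix \<U> :: "(nat \<Rightarrow> 'k) set set"
  assume "\<forall>S\<in>\<U>. \<exists>F \<subseteq> poly_funs n. S = affine_space n - zero_locus n F"
  then obtain F where F: "\<And>S. S \<in> \<U> \<Longrightarrow> F S \<subseteq> poly_funs n"
    "\<And>S. S \<in> \<U> \<Longrightarrow> S = affine_space n - zero_locus n (F S)"
    by metis
  have "\<Union>\<U> = (\<Union>S\<in>\<U>. affine_space n - zero_locus n (F S))"
    using F(2) by auto
  also have "\<dots> = affine_space n - zero_locus n (\<Union>S\<in>\<U>. F S)"
    unfolding zero_locus_def by auto
  finally have "\<Union>\<U> = affine_space n - zero_locus n (\<Union>S\<in>\<U>. F S)" .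
  then show "\<exists>F \<subseteq> poly_funs n. \<Union>\<U> = affine_space n - zero_locus n F"
    using F(1) by (intro exI[of _ "\<Union>S\<in>\<U>. F S"]) auto
qed

lemma openin_zariski:
  "openin (zariski n) U \<longleftrightarrow> (\<exists>F \<subseteq> poly_funs n. U = affine_space n - zero_locus n F)"
  by (simp add: zariski_def topology_inverse'[OF istopology_zariski])

lemma topspace_zariski: "topspace (zariski n) = (affine_space n :: (nat \<Rightarrow> 'k::field) set)"
proof -
  have "openin (zariski n) (affine_space n :: (nat \<Rightarrow> 'k) set)"
    unfolding openin_zariski
    by (rule exI[of _ "{\<lambda>q. 1}"]) (auto simp: zero_locus_def intro: poly_funs.const)
  moreover have "U \<subseteq> affine_space n" if "openin (zariski n) U" for U :: "(nat \<Rightarrow> 'k) set"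
    using that unfolding openin_zariski by auto
  ultimately show ?thesis
    by (meson openin_subset openin_topspace subset_antisym)
qed

lemma closedin_zariski:
  "closedin (zariski n) Z \<longleftrightarrow> (\<exists>F \<subseteq> poly_funs n. Z = zero_locus n F)"
proof -
  have "zero_locus n F \<subseteq> affine_space n" for F :: "((nat \<Rightarrow> 'a) \<Rightarrow> 'a) set"
    by (auto simp: zero_locus_def)
  then show ?thesis
    unfolding closedin_def topspace_zariski openin_zariski
    by (metis Diff_Diff_Int double_diff subset_refl inf.absorb_iff2)
qed

definition irreducible_in :: "'a topology \<Rightarrow> 'a set \<Rightarrow> bool" where
  "irreducible_in X S \<longleftrightarrow> S \<subseteq> topspace X \<and> S \<noteq> {} \<and>
     (\<forall>A B. closedin X A \<and> closedin X B \<and> S \<subseteq> A \<union> B \<longrightarrow> S \<subseteq> A \<or> S \<subseteq> B)"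

text \<open>
  The supremum of the lengths \<open>r\<close> of strict chains \<open>Z\<^sub>0 \<subset> \<dots> \<subset> Z\<^sub>r\<close> of irreducible closed subsets.
  The value on the empty space is \<open>0\<close>, by the convention for suprema in \<^typ>\<open>enat\<close>.
\<close>

definition krull_dim :: "'a topology \<Rightarrow> enat" where
  "krull_dim X = (SUP r \<in> {r. \<exists>Z :: nat \<Rightarrow> 'a set.
      (\<forall>i\<le>r. closedin X (Z i) \<and> irreducible_in X (Z i)) \<and> (\<forall>i<r. Z i \<subset> Z (Suc i))}. enat r)"

section \<open>Configurations realizing a portrait\<close>

definition conf :: "nat \<Rightarrow> (nat \<Rightarrow> 'k) set" where
  "conf n = {q \<in> affine_space n. inj_on q {1..n}}"

definition conf_portrait :: "nat \<Rightarrow> (nat \<Rightarrow> nat) \<Rightarrow> nat \<Rightarrow> (nat \<Rightarrow> 'k::field) set" where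
  "conf_portrait n P d =
     {q \<in> conf n. \<exists>f. degree f = d \<and> (\<forall>i\<in>{1..n}. poly f (q i) = q (P i))}"

definition aff_act :: "nat \<Rightarrow> 'k::field \<Rightarrow> 'k \<Rightarrow> (nat \<Rightarrow> 'k) \<Rightarrow> nat \<Rightarrow> 'k" where
  "aff_act n a b q = (\<lambda>i\<in>{1..n}. a * q i + b)"

text \<open>
  For \<open>n \<ge> 2\<close> the quotient of \<^const>\<open>conf_portrait\<close> by the affine group is identified with the
  slice \<open>q\<^sub>1 = 0\<close>, \<open>q\<^sub>2 = 1\<close>, from which it takes its variety structure.  The lemmas below show
  that the affine group preserves \<^const>\<open>conf_portrait\<close> and that every orbit meets the
  slice in exactly one point, by way of exactly one affine map.
\<close>

definition portrait_moduli :: "nat \<Rightarrow> (nat \<Rightarrow> nat) \<Rightarrow> nat \<Rightarrow> (nat \<Rightarrow> 'k::field) set" where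
  "portrait_moduli n P d = {q \<in> conf_portrait n P d. q 1 = 0 \<and> q 2 = 1}"

lemma aff_act_conf_portrait:
  fixes q :: "nat \<Rightarrow> 'k::field"
  assumes P: "P \<in> {1..n} \<rightarrow> {1..n}" and d: "d \<ge> 1" and a: "a \<noteq> 0" and q: "q \<in> conf_portrait n P d"
  shows "aff_act n a b q \<in> conf_portrait n P d"
proof -
  from q obtain f where f: "degree f = d" "\<And>i. i \<in> {1..n} \<Longrightarrow> poly f (q i) = q (P i)"
    and inj: "inj_on q {1..n}"
    unfolding conf_portrait_def conf_def by auto
  define l where "l = [:- (b / a), 1 / a:]"
  define g where "g = smult a (pcompose f l) + [:b:]"
  have "degree (smult a (pcompose f l)) = d"
    using a f(1) by (simp add: l_def degree_pcompose)
  then have deg: "degree g = d"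
    using d unfolding g_def by (subst degree_add_eq_left) auto
  have l: "poly l (a * x + b) = x" for x
    using a by (simp add: l_def field_simps)
  have g: "poly g (aff_act n a b q i) = aff_act n a b q (P i)" if i: "i \<in> {1..n}" for i
  proof -
    have Pi: "P i \<in> {1..n}"
      using P i by blast
    have "poly g (a * q i + b) = a * q (P i) + b"
      using f(2)[OF i] by (simp add: g_def poly_pcompose l)
    then show ?thesis
      using i Pi by (simp only: aff_act_def restrict_apply' if_True)
  qed
  have "aff_act n a b q \<in> affine_space n"
    unfolding affine_space_def aff_act_def by (rule restrict_PiE_iff[THEN iffD2]) simp
  moreover have "inj_on (aff_act n a b q) {1..n}"
  proof (rule inj_onI)
    fix i j assume ij: "i \<in> {1..n}" "j \<in> {1..n}" "aff_act n a b q i = aff_act n a b q j"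
    then have "a * q i + b = a * q j + b"
      by (simp only: aff_act_def restrict_apply')
    then have "q i = q j"
      using a by simp
    with inj ij show "i = j"
      by (simp only: inj_on_def)
  qed
  ultimately have "aff_act n a b q \<in> conf n"
    unfolding conf_def by blast
  with deg g show ?thesis
    unfolding conf_portrait_def by blast
qed

lemma ex1_aff_act_portrait_moduli:
  fixes q :: "nat \<Rightarrow> 'k::field"
  assumes n: "n \<ge> 2" and d: "d \<ge> 1" and P: "P \<in> {1..n} \<rightarrow> {1..n}" and q: "q \<in> conf_portrait n P d"
  shows "\<exists>!(a, b). a \<noteq> 0 \<and> aff_act n a b q \<in> portrait_moduli n P d"
proof -
  from n have 12: "1 \<in> {1..n}" "2 \<in> {1..n}"
    by auto
  have "q 1 \<noteq> q 2"
    using q 12 unfolding conf_portrait_def conf_def inj_on_def by fastforce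
  then have q12: "q 2 - q 1 \<noteq> 0"
    by simp
  have eq: "aff_act n a b q \<in> portrait_moduli n P d \<longleftrightarrow> a * q 1 + b = 0 \<and> a * q 2 + b = 1"
    if "a \<noteq> 0" for a b
    using aff_act_conf_portrait[OF P d that q] 12 by (auto simp: portrait_moduli_def aff_act_def)
  have lin: "a * q 1 + b = 0 \<and> a * q 2 + b = 1 \<longleftrightarrow>
      a = 1 / (q 2 - q 1) \<and> b = - q 1 / (q 2 - q 1)" for a b
  proof
    assume *: "a * q 1 + b = 0 \<and> a * q 2 + b = 1"
    then have "a * (q 2 - q 1) = 1"
      by (metis add_diff_cancel_right diff_zero right_diff_distrib)
    with q12 have a: "a = 1 / (q 2 - q 1)"
      by (simp add: field_simps)
    from * have "b = - (a * q 1)"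
      by (simp add: eq_neg_iff_add_eq_0 add.commute)
    with a show "a = 1 / (q 2 - q 1) \<and> b = - q 1 / (q 2 - q 1)"
      by simp
  next
    assume *: "a = 1 / (q 2 - q 1) \<and> b = - q 1 / (q 2 - q 1)"
    then have "a * q 2 + b = 1"
      using q12 by (simp add: diff_divide_distrib[symmetric])
    moreover have "a * q 1 + b = 0"
      using * by simp
    ultimately show "a * q 1 + b = 0 \<and> a * q 2 + b = 1"
      by blast
  qed
  show ?thesis
  proof (rule ex1I[of _ "(1 / (q 2 - q 1), - q 1 / (q 2 - q 1))"])
    show "case (1 / (q 2 - q 1), - q 1 / (q 2 - q 1)) of
        (a, b) \<Rightarrow> a \<noteq> 0 \<and> aff_act n a b q \<in> portrait_moduli n P d"
      using q12 lin[of "1 / (q 2 - q 1)" "- q 1 / (q 2 - q 1)"]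
        eq[of "1 / (q 2 - q 1)" "- q 1 / (q 2 - q 1)"]
      by (simp only: prod.case) (metis divide_eq_0_iff zero_neq_one)
  next
    fix p :: "'k \<times> 'k"
    assume "case p of (a, b) \<Rightarrow> a \<noteq> 0 \<and> aff_act n a b q \<in> portrait_moduli n P d"
    then show "p = (1 / (q 2 - q 1), - q 1 / (q 2 - q 1))"
    proof (induction p rule: prod.induct)
      case (Pair a b)
      then have a: "a \<noteq> 0" and "aff_act n a b q \<in> portrait_moduli n P d"
        by simp_all
      then have "a * q 1 + b = 0 \<and> a * q 2 + b = 1"
        using eq[OF a] by blast
      then show ?case
        unfolding lin by blast
    qed
  qed
qed

section \<open>Cycles of a portrait and the Moebius function\<close>

definition portrait_cycles :: "nat \<Rightarrow> (nat \<Rightarrow> nat) \<Rightarrow> nat \<Rightarrow> nat set set" where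
  "portrait_cycles n P k = {C. C \<subseteq> {1..n} \<and> cyclic_on P C \<and> card C = k}"

definition moebius_mu :: "nat \<Rightarrow> int" where
  "moebius_mu m = (if squarefree m then (- 1) ^ card (prime_factors m) else 0)"

end

theory Submission
  imports Defs "HOL-Library.Function_Algebras" "Jordan_Normal_Form.Determinant"
begin

text \<open>
  Every point of a portrait is preperiodic, with preperiod at most \<open>n\<close> and a period that divides
  \<open>n!\<close>. So once a polynomial \<open>f\<close> is known, the marked points are among the roots of
  \<open>f\<^sup>n\<^sup>+\<^sup>n\<^sup>! - f\<^sup>n\<close>, where exponents denote iteration; the moduli space has finite fibres over the
  \<open>(d - 1)\<close>-dimensional space of conjugacy classes of polynomials for \<open>n > d\<close>, and the question
  becomes which portraits live on which \<open>f\<close>.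

  \<^bold>\<open>Necessity.\<close> A fibre of the portrait embeds into a fibre of \<open>f\<close>, so it has at most \<open>d\<close> elements.
  The points of exact period \<open>k\<close> embed into those of \<open>f\<close>, and there are at most
  \<open>\<Sum>\<^sub>j\<^sub>|\<^sub>k \<mu>(k/j) d\<^sup>j\<close> of these: replacing \<open>d\<^sup>j\<close> by the sum over all \<open>x\<close> of the multiplicity of \<open>x\<close> as a
  root of \<open>f\<^sup>j - X\<close> splits this number into local contributions, and in characteristic \<open>0\<close> each of
  them is nonnegative, and at least \<open>1\<close> if \<open>x\<close> has exact period \<open>k\<close> (\<open>card_exact_period_le\<close>).

  \<^bold>\<open>Sufficiency.\<close> If the roots of \<open>f\<^sup>n\<^sup>! - X\<close> are simple and no critical point \<open>c\<close> satisfies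
  \<open>f\<^sup>n\<^sup>+\<^sup>1\<^sup>+\<^sup>n\<^sup>! c = f\<^sup>n\<^sup>+\<^sup>1 c\<close>, then \<open>f\<close> has the maximal number of cycles of each length up to \<open>n\<close> and
  full fibres over all relevant points, so that a portrait satisfying both conditions can be embedded
  step by step (\<open>realize_portrait\<close>). Among the monic centered polynomials these \<open>f\<close> form a Zariski
  open set. It is nonempty because \<open>X\<^sup>d\<close> has the first property, \<open>X\<^sup>d + 1\<close> has the second one, and
  each of them is the nonvanishing of a resultant (\<open>generic_centered_poly\<close>).

  \<^bold>\<open>Dimension, upper bound.\<close> A chain of \<open>r + 1\<close> irreducible closed sets yields \<open>r\<close> algebraically
  independent functions (\<open>chain_alg_indep\<close>). All coordinates of the marked points are integral over
  the \<open>d - 1\<close> coefficients of the monic centered conjugate of \<open>f\<close>, and a count of monomials shows that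
  there are no more independent functions than parameters (\<open>alg_indep_le_parameters\<close>). The bound
  \<open>n - 2\<close> is the same count with the points \<open>q\<^sub>3, \<dots>, q\<^sub>n\<close> as parameters.

  \<^bold>\<open>Dimension, lower bound.\<close> Conversely, \<open>r\<close> regular functions with Zariski dense image on a locally
  closed set force its dimension to be at least \<open>r\<close> (\<open>krull_dim_ge\<close>). One starts from a prime ideal
  on whose zero locus the functions are independent, and cuts with hyperplanes; the tool is that
  points extend over generic parameter values (\<open>extension\<close>), which also contains the
  Nullstellensatz for prime ideals. For \<open>n \<le> d\<close> the points themselves are such functions. For
  \<open>n > d\<close> suitable invariants of \<open>f\<close> are, because the generic \<open>f\<close> realizes the portrait.
\<close>

text \<open>The name \<open>smult\<close> is reserved for the scalar multiplication of polynomials.\<close>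
hide_const (open) module.smult

section \<open>Polynomial functions and families of polynomials\<close>

lemma poly_funs_cong:
  assumes "F \<in> poly_funs n" "\<And>i. i \<in> {1..n} \<Longrightarrow> p i = q i"
  shows "F p = F q"
  using assms by induction auto

lemma poly_funs_mono: "m \<le> n \<Longrightarrow> F \<in> poly_funs m \<Longrightarrow> F \<in> poly_funs n"
  by (rotate_tac, induction rule: poly_funs.induct) (auto intro: poly_funs.intros)

lemma poly_funs_uminus: "F \<in> poly_funs n \<Longrightarrow> (\<lambda>q. - F q) \<in> poly_funs n"
  using poly_funs.mult[OF poly_funs.const[of "-1"]] by fastforce

lemma poly_funs_diff:
  "F \<in> poly_funs n \<Longrightarrow> G \<in> poly_funs n \<Longrightarrow> (\<lambda>q. F q - G q) \<in> poly_funs n"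
  using poly_funs.add[OF _ poly_funs_uminus] by fastforce

lemma poly_funs_sum:
  "(\<And>i. i \<in> A \<Longrightarrow> F i \<in> poly_funs n) \<Longrightarrow> (\<lambda>q. \<Sum>i\<in>A. F i q) \<in> poly_funs n"
  by (induction A rule: infinite_finite_induct) (auto intro: poly_funs.intros)

lemma poly_funs_prod:
  "(\<And>i. i \<in> A \<Longrightarrow> F i \<in> poly_funs n) \<Longrightarrow> (\<lambda>q. \<Prod>i\<in>A. F i q) \<in> poly_funs n"
  by (induction A rule: infinite_finite_induct) (auto intro: poly_funs.intros)

lemma poly_funs_power: "F \<in> poly_funs n \<Longrightarrow> (\<lambda>q. F q ^ k) \<in> poly_funs n"
  by (induction k) (auto intro: poly_funs.intros)

lemma poly_funs_subst:
  assumes "F \<in> poly_funs m" "\<And>i. i \<in> {1..m} \<Longrightarrow> \<phi> i \<in> poly_funs n"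
  shows "(\<lambda>q. F (\<lambda>i. \<phi> i q)) \<in> poly_funs n"
  using assms by induction (auto intro: poly_funs.intros)

lemma poly_funs_line:
  assumes "F \<in> poly_funs n"
  shows "\<exists>p. \<forall>t. F (\<lambda>i. y i + t * (z i - y i)) = poly p t"
  using assms
proof induction
  case (const c)
  show ?case by (rule exI[of _ "[:c:]"]) simp
next
  case (coord i)
  show ?case by (rule exI[of _ "[:y i, z i - y i:]"]) simp
next
  case (add f g)
  then obtain p q where "\<forall>t. f (\<lambda>i. y i + t * (z i - y i)) = poly p t"
    "\<forall>t. g (\<lambda>i. y i + t * (z i - y i)) = poly q t" by blast
  then show ?case by (intro exI[of _ "p + q"]) simp
next
  case (mult f g)
  then obtain p q where "\<forall>t. f (\<lambda>i. y i + t * (z i - y i)) = poly p t"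
    "\<forall>t. g (\<lambda>i. y i + t * (z i - y i)) = poly q t" by blast
  then show ?case by (intro exI[of _ "p * q"]) simp
qed

text \<open>
  Over an infinite field the ring of polynomial functions is a domain: on the line through a point
  where one factor is nonzero and a point where the other one is, both factors become nonzero
  univariate polynomials.
\<close>
lemma poly_funs_nonzero_mult:
  fixes F G :: "(nat \<Rightarrow> 'k::field_char_0) \<Rightarrow> 'k"
  assumes "F \<in> poly_funs n" "G \<in> poly_funs n" "F y \<noteq> 0" "G z \<noteq> 0"
  shows "\<exists>w. F w \<noteq> 0 \<and> G w \<noteq> 0"
proof -
  obtain p where p: "\<And>t. F (\<lambda>i. y i + t * (z i - y i)) = poly p t"
    using poly_funs_line[OF assms(1)] by blast
  obtain q where q: "\<And>t. G (\<lambda>i. y i + t * (z i - y i)) = poly q t"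
    using poly_funs_line[OF assms(2)] by blast
  have "p \<noteq> 0" using p[of 0] assms(3) by auto
  moreover have "q \<noteq> 0" using q[of 1] assms(4) by auto
  ultimately have "finite {t. poly (p * q) t = 0}"
    by (intro poly_roots_finite) simp
  then obtain t where "poly (p * q) t \<noteq> 0"
    using infinite_UNIV_char_0 by (metis (mono_tags, lifting) UNIV_I ex_new_if_finite mem_Collect_eq)
  then show ?thesis using p q by (metis mult_eq_0_iff poly_mult)
qed

text \<open>
  Families of univariate polynomials of bounded degree whose coefficients are polynomial functions
  of the parameter. They serve both as polynomials in one further variable and as families of
  dynamical systems.
\<close>
inductive_set poly_fams :: "nat \<Rightarrow> ((nat \<Rightarrow> 'k::field) \<Rightarrow> 'k poly) set" for n :: nat where
  zero: "(\<lambda>a. 0) \<in> poly_fams n"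
| pCons: "c \<in> poly_funs n \<Longrightarrow> p \<in> poly_fams n \<Longrightarrow> (\<lambda>a. pCons (c a) (p a)) \<in> poly_fams n"

lemma poly_fams_coeff: "p \<in> poly_fams n \<Longrightarrow> (\<lambda>a. coeff (p a) j) \<in> poly_funs n"
proof (induction arbitrary: j rule: poly_fams.induct)
  case zero
  then show ?case by (auto intro: poly_funs.intros)
next
  case (pCons c p)
  then show ?case by (cases j) (auto simp: coeff_pCons)
qed

lemma poly_fams_bound:
  assumes "p \<in> poly_fams n"
  shows "\<exists>e. \<forall>a. degree (p a) < e"
  using assms
proof induction
  case zero
  then show ?case by (intro exI[of _ 1]) simp
next
  case (pCons c p)
  then obtain e where "\<forall>a. degree (p a) < e" by blast
  then show ?case
    by (intro exI[of _ "Suc e"]) (metis degree_pCons_le le_less_trans not_less_eq)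
qed

lemma poly_famsI:
  assumes "\<And>j. (\<lambda>a. coeff (p a) j) \<in> poly_funs n" "\<And>a j. j \<ge> e \<Longrightarrow> coeff (p a) j = 0"
  shows "p \<in> poly_fams n"
  using assms
proof (induction e arbitrary: p)
  case 0
  then have "p = (\<lambda>a. 0)" by (auto simp: poly_eq_iff fun_eq_iff)
  then show ?case using poly_fams.zero by metis
next
  case (Suc e)
  let ?q = "\<lambda>a. poly_shift 1 (p a)"
  have "?q \<in> poly_fams n"
    by (rule Suc.IH) (use Suc.prems in \<open>auto simp: coeff_poly_shift\<close>)
  then have "(\<lambda>a. pCons (coeff (p a) 0) (?q a)) \<in> poly_fams n"
    by (intro poly_fams.pCons Suc.prems)
  moreover have "(\<lambda>a. pCons (coeff (p a) 0) (?q a)) = p"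
    by (rule ext, rule poly_eqI) (auto simp: coeff_pCons coeff_poly_shift split: nat.splits)
  ultimately show ?case by simp
qed

lemma poly_fams_mono: "m \<le> n \<Longrightarrow> p \<in> poly_fams m \<Longrightarrow> p \<in> poly_fams n"
  by (rotate_tac, induction rule: poly_fams.induct)
    (auto intro: poly_fams.intros poly_funs_mono)

lemma poly_fams_const: "c \<in> poly_funs n \<Longrightarrow> (\<lambda>a. [:c a:]) \<in> poly_fams n"
  by (intro poly_fams.intros)

lemma poly_fams_monom: "c \<in> poly_funs n \<Longrightarrow> (\<lambda>a. monom (c a) m) \<in> poly_fams n"
  by (induction m) (simp_all add: monom_0 monom_Suc poly_fams_const poly_fams.pCons poly_funs.const)

lemma poly_fams_add:
  assumes p: "p \<in> poly_fams n" and q: "q \<in> poly_fams n"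
  shows "(\<lambda>a. p a + q a) \<in> poly_fams n"
proof -
  obtain d e where "\<And>a. degree (p a) < d" "\<And>a. degree (q a) < e"
    using poly_fams_bound[OF p] poly_fams_bound[OF q] by blast
  then show ?thesis
    by (intro poly_famsI[of _ _ "max d e"])
      (simp_all add: poly_funs.add poly_fams_coeff p q, metis add_0 coeff_eq_0 order_less_le_trans)
qed

lemma poly_fams_smult:
  assumes c: "c \<in> poly_funs n" and p: "p \<in> poly_fams n"
  shows "(\<lambda>a. smult (c a) (p a)) \<in> poly_fams n"
  using p
proof induction
  case (pCons b p)
  then show ?case using poly_fams.pCons[OF poly_funs.mult[OF c pCons(1)]] by simp
qed (simp add: poly_fams.zero)

lemma poly_fams_uminus: "p \<in> poly_fams n \<Longrightarrow> (\<lambda>a. - p a) \<in> poly_fams n"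
  using poly_fams_smult[OF poly_funs.const[of "-1"]] by fastforce

lemma poly_fams_diff:
  "p \<in> poly_fams n \<Longrightarrow> q \<in> poly_fams n \<Longrightarrow> (\<lambda>a. p a - q a) \<in> poly_fams n"
  using poly_fams_add[OF _ poly_fams_uminus] by fastforce

lemma poly_fams_mult:
  assumes p: "p \<in> poly_fams n" and q: "q \<in> poly_fams n"
  shows "(\<lambda>a. p a * q a) \<in> poly_fams n"
  using p by induction
    (auto intro!: poly_fams.intros poly_fams_add poly_fams_smult poly_funs.const q)

lemma poly_fams_sum:
  "(\<And>i. i \<in> A \<Longrightarrow> p i \<in> poly_fams n) \<Longrightarrow> (\<lambda>a. \<Sum>i\<in>A. p i a) \<in> poly_fams n"
  by (induction A rule: infinite_finite_induct) (auto intro: poly_fams.zero poly_fams_add)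

lemma poly_fams_one: "(\<lambda>a. 1) \<in> poly_fams n"
  using poly_fams_const[OF poly_funs.const[of 1]] by (simp add: one_pCons)

lemma poly_fams_prod:
  "(\<And>i. i \<in> A \<Longrightarrow> p i \<in> poly_fams n) \<Longrightarrow> (\<lambda>a. \<Prod>i\<in>A. p i a) \<in> poly_fams n"
  by (induction A rule: infinite_finite_induct) (auto intro: poly_fams_one poly_fams_mult)

lemma poly_fams_power: "p \<in> poly_fams n \<Longrightarrow> (\<lambda>a. p a ^ k) \<in> poly_fams n"
  by (induction k) (auto intro: poly_fams_one poly_fams_mult)

lemma poly_fams_pcompose:
  assumes p: "p \<in> poly_fams n" and q: "q \<in> poly_fams n"
  shows "(\<lambda>a. pcompose (p a) (q a)) \<in> poly_fams n"
  using p by induction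
    (auto simp: pcompose_pCons intro!: poly_fams.zero poly_fams_add poly_fams_const poly_fams_mult q)

lemma poly_fams_pderiv:
  assumes p: "p \<in> poly_fams n"
  shows "(\<lambda>a. pderiv (p a)) \<in> poly_fams n"
  using p by induction
    (auto simp: pderiv_pCons intro!: poly_fams.intros poly_fams_add poly_funs.const)

lemma poly_fams_eval:
  assumes p: "p \<in> poly_fams n" and x: "x \<in> poly_funs n"
  shows "(\<lambda>a. poly (p a) (x a)) \<in> poly_funs n"
  using p
proof induction
  case (pCons b p)
  then show ?case using poly_funs.add[OF pCons(1) poly_funs.mult[OF x]] by simp
qed (simp add: poly_funs.const)

lemma poly_fams_eval_Suc:
  "p \<in> poly_fams n \<Longrightarrow> (\<lambda>y. poly (p y) (y (Suc n))) \<in> poly_funs (Suc n)"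
  by (rule poly_fams_eval[OF poly_fams_mono]) (auto intro: poly_funs.coord)

lemma poly_funs_Suc_fam:
  assumes "F \<in> poly_funs (Suc n)"
  shows "\<exists>p\<in>poly_fams n. \<forall>y. F y = poly (p y) (y (Suc n))"
  using assms
proof induction
  case (const c)
  show ?case
    by (rule bexI[of _ "\<lambda>a. [:c:]"], simp, intro poly_fams.intros poly_funs.const)
next
  case (coord i)
  show ?case
  proof (cases "i = Suc n")
    case True
    then show ?thesis
      by (intro bexI[of _ "\<lambda>a. [:0, 1:]"] poly_fams.intros poly_funs.const) simp
  next
    case False
    then show ?thesis using coord
      by (intro bexI[of _ "\<lambda>a. [:a i:]"]) (auto intro!: poly_fams_const poly_funs.coord)
  qed
next
  case (add f g)
  then obtain p q where "p \<in> poly_fams n" "\<forall>y. f y = poly (p y) (y (Suc n))"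
    "q \<in> poly_fams n" "\<forall>y. g y = poly (q y) (y (Suc n))" by blast
  then show ?case by (intro bexI[of _ "\<lambda>a. p a + q a"]) (auto intro: poly_fams_add)
next
  case (mult f g)
  then obtain p q where "p \<in> poly_fams n" "\<forall>y. f y = poly (p y) (y (Suc n))"
    "q \<in> poly_fams n" "\<forall>y. g y = poly (q y) (y (Suc n))" by blast
  then show ?case by (intro bexI[of _ "\<lambda>a. p a * q a"]) (auto intro: poly_fams_mult)
qed

lemma poly_fams_cong:
  assumes "p \<in> poly_fams n" "\<And>i. i \<in> {1..n} \<Longrightarrow> a i = b i"
  shows "p a = p b"
  by (rule poly_eqI, rule poly_funs_cong[OF poly_fams_coeff[OF assms(1)]]) (rule assms(2))

text \<open>
  Pseudo-division, uniformly in the parameter: the leading coefficient need not be invertible, so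
  a power of it is multiplied onto the dividend.
\<close>
lemma poly_fams_pseudo_division:
  assumes F: "F \<in> poly_fams n" and degF: "\<And>a j. j > e \<Longrightarrow> coeff (F a) j = 0"
    and G: "G \<in> poly_fams n"
  shows "\<exists>N S R. S \<in> poly_fams n \<and> R \<in> poly_fams n \<and> (\<forall>a. \<forall>j\<ge>e. coeff (R a) j = 0) \<and>
    (\<forall>a. smult (coeff (F a) e ^ N) (G a) = F a * S a + R a)"
proof -
  have "\<exists>N S R. S \<in> poly_fams n \<and> R \<in> poly_fams n \<and> (\<forall>a. \<forall>j\<ge>e. coeff (R a) j = 0) \<and>
    (\<forall>a. smult (coeff (F a) e ^ N) (G a) = F a * S a + R a)"
    if "G \<in> poly_fams n" "\<And>a j. j \<ge> e + m \<Longrightarrow> coeff (G a) j = 0" for m G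
    using that
  proof (induction m arbitrary: G)
    case 0
    then show ?case
      by (intro exI[of _ 0] exI[of _ "\<lambda>a. 0"] exI[of _ G]) (auto intro: poly_fams.zero)
  next
    case (Suc m)
    let ?T = "\<lambda>a. monom (coeff (G a) (e + m)) m"
    let ?G = "\<lambda>a. smult (coeff (F a) e) (G a) - F a * ?T a"
    have T: "?T \<in> poly_fams n"
      by (intro poly_fams_monom poly_fams_coeff Suc.prems)
    have G': "?G \<in> poly_fams n"
      by (intro poly_fams_diff poly_fams_smult poly_fams_mult T F Suc.prems poly_fams_coeff)
    have "coeff (?G a) j = 0" if "j \<ge> e + m" for a j
    proof (cases "j = e + m")
      case True
      then show ?thesis
        by (simp add: mult.commute[of "F a"] coeff_monom_mult)
    next
      case False
      with that show ?thesis
        by (simp add: mult.commute[of "F a"] coeff_monom_mult Suc.prems(2) degF)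
    qed
    from Suc.IH[OF G' this] obtain N S R where IH: "S \<in> poly_fams n" "R \<in> poly_fams n"
      "\<forall>a. \<forall>j\<ge>e. coeff (R a) j = 0" "\<And>a. smult (coeff (F a) e ^ N) (?G a) = F a * S a + R a"
      by blast
    let ?S = "\<lambda>a. S a + smult (coeff (F a) e ^ N) (?T a)"
    have "?S \<in> poly_fams n"
      by (intro poly_fams_add poly_fams_smult poly_funs_power poly_fams_coeff T F IH)
    moreover have "smult (coeff (F a) e ^ Suc N) (G a) = F a * ?S a + R a" for a
      using IH(4)[of a] by (simp add: smult_diff_right algebra_simps)
    ultimately show ?case using IH(2,3) by blast
  qed
  moreover obtain b where "\<And>a. degree (G a) < b"
    using poly_fams_bound[OF G] by blast
  then have "coeff (G a) j = 0" if "j \<ge> e + b" for a j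
    using that by (intro coeff_eq_0) (metis le_add2 order_less_le_trans)
  ultimately show ?thesis using G by blast
qed

section \<open>Prime ideals of polynomial functions and extension of points\<close>

text \<open>The Nullstellensatz in one variable, with an explicit exponent.\<close>
lemma dvd_power_if_roots_subset:
  fixes p q :: "'k::alg_closed_field poly"
  assumes "p \<noteq> 0" "\<And>c. poly p c = 0 \<Longrightarrow> poly q c = 0"
  shows "p dvd q ^ degree p"
  using assms
proof (induction "degree p" arbitrary: p)
  case 0
  then have "is_unit p" by (simp add: is_unit_iff_degree)
  then show ?case by (simp add: unit_imp_dvd)
next
  case (Suc d)
  from Suc.hyps(2) have "degree p > 0" by simp
  then obtain c where c: "poly p c = 0" using alg_closed_imp_poly_has_root by blast
  then obtain p' where p': "p = [:-c, 1:] * p'" using poly_eq_0_iff_dvd by (metis dvdE)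
  obtain r where r: "q = [:-c, 1:] * r" using Suc.prems(2)[OF c] poly_eq_0_iff_dvd by (metis dvdE)
  have "p' \<noteq> 0" using p' Suc.prems(1) by auto
  then have "degree p = Suc (degree p')" unfolding p' by (subst degree_mult_eq) auto
  then have d: "d = degree p'" using Suc.hyps(2) by simp
  have "p' dvd q ^ degree p'"
    by (rule Suc.hyps(1)[OF d \<open>p' \<noteq> 0\<close>]) (use Suc.prems(2) p' in simp)
  then have "p dvd q * q ^ degree p'"
    unfolding p' by (intro mult_dvd_mono) (metis dvd_triv_left r)
  then show ?case using \<open>degree p = Suc (degree p')\<close> by simp
qed

locale poly_prime =
  fixes N :: nat and p :: "((nat \<Rightarrow> 'k::{alg_closed_field, field_char_0}) \<Rightarrow> 'k) set"
  assumes sub: "p \<subseteq> poly_funs N"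
    and zero: "(\<lambda>q. 0) \<in> p"
    and add: "f \<in> p \<Longrightarrow> g \<in> p \<Longrightarrow> (\<lambda>q. f q + g q) \<in> p"
    and ideal: "f \<in> poly_funs N \<Longrightarrow> g \<in> p \<Longrightarrow> (\<lambda>q. f q * g q) \<in> p"
    and one: "(\<lambda>q. 1) \<notin> p"
    and prime: "f \<in> poly_funs N \<Longrightarrow> g \<in> poly_funs N \<Longrightarrow> (\<lambda>q. f q * g q) \<in> p \<Longrightarrow> f \<in> p \<or> g \<in> p"
begin

lemma uminus: "f \<in> p \<Longrightarrow> (\<lambda>q. - f q) \<in> p"
  using ideal[OF poly_funs.const[of "-1"]] by fastforce

lemma diff: "f \<in> p \<Longrightarrow> g \<in> p \<Longrightarrow> (\<lambda>q. f q - g q) \<in> p"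
  using add[OF _ uminus] by fastforce

lemma mult_notin:
  "f \<in> poly_funs N \<Longrightarrow> g \<in> poly_funs N \<Longrightarrow> f \<notin> p \<Longrightarrow> g \<notin> p \<Longrightarrow> (\<lambda>q. f q * g q) \<notin> p"
  using prime by blast

lemma power_notin: "f \<in> poly_funs N \<Longrightarrow> f \<notin> p \<Longrightarrow> (\<lambda>q. f q ^ k) \<notin> p"
  by (induction k) (simp_all add: one mult_notin poly_funs_power)

lemma constants: "F \<in> p \<Longrightarrow> F \<in> poly_funs 0 \<Longrightarrow> F = (\<lambda>q. 0)"
proof (rule ccontr)
  assume F: "F \<in> p" "F \<in> poly_funs 0" and "F \<noteq> (\<lambda>q. 0)"
  then obtain q0 where q0: "F q0 \<noteq> 0" by auto
  have "F q = F q0" for q by (rule poly_funs_cong[OF F(2)]) simp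
  then have "(\<lambda>q. inverse (F q0) * F q) = (\<lambda>q. 1)" using q0 by (metis left_inverse)
  then show False using ideal[OF poly_funs.const F(1), of "inverse (F q0)"] one by simp
qed

lemma eval_mem:
  assumes "P \<in> poly_fams j" "Suc j \<le> N" "\<And>i. (\<lambda>a. coeff (P a) i) \<in> p"
  shows "(\<lambda>y. poly (P y) (y (Suc j))) \<in> p"
  using assms
proof induction
  case zero
  then show ?case using poly_prime.zero[OF poly_prime_axioms] by simp
next
  case (pCons c P)
  have "c \<in> p" using pCons.prems(2)[of 0] by simp
  moreover have "(\<lambda>y. poly (P y) (y (Suc j))) \<in> p"
    using pCons.prems(1) pCons.prems(2)[of "Suc _"] by (intro pCons.IH) auto
  moreover have "(\<lambda>y. y (Suc j)) \<in> poly_funs N"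
    using pCons.prems(1) by (intro poly_funs.coord) auto
  ultimately show ?case using add[OF _ ideal] by simp
qed

text \<open>Coefficients in the ideal can be dropped from the top.\<close>
lemma truncate:
  assumes P: "P \<in> poly_fams j" and j: "Suc j \<le> N" and mem: "(\<lambda>y. poly (P y) (y (Suc j))) \<in> p"
    and i: "(\<lambda>a. coeff (P a) i) \<notin> p" and b: "\<And>a i. i \<ge> b \<Longrightarrow> coeff (P a) i = 0"
  shows "\<exists>e Q. e < b \<and> Q \<in> poly_fams j \<and> (\<lambda>y. poly (Q y) (y (Suc j))) \<in> p \<and>
    (\<lambda>a. coeff (Q a) e) \<notin> p \<and> (\<forall>a. \<forall>i>e. coeff (Q a) i = 0)"
proof -
  let ?A = "{i. (\<lambda>a. coeff (P a) i) \<notin> p}"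
  have lt: "i < b" if "i \<in> ?A" for i
  proof (rule ccontr)
    assume "\<not> i < b"
    then have "(\<lambda>a. coeff (P a) i) = (\<lambda>a. 0)" using b by auto
    then show False using that zero by auto
  qed
  then have fin: "finite ?A" by (meson finite_nat_iff_bounded lessThan_iff subsetI)
  define e where "e = Max ?A"
  have e: "e \<in> ?A" unfolding e_def using fin i by (intro Max_in) auto
  have gt: "(\<lambda>a. coeff (P a) i) \<in> p" if "i > e" for i
    using that Max_ge[OF fin, of i] unfolding e_def by fastforce
  let ?Q = "\<lambda>a. poly_cutoff (Suc e) (P a)"
  have Q: "?Q \<in> poly_fams j"
  proof (rule poly_famsI[of _ _ b])
    fix i
    show "(\<lambda>a. coeff (?Q a) i) \<in> poly_funs j"
      by (cases "i < Suc e") (simp_all add: coeff_poly_cutoff poly_fams_coeff[OF P] poly_funs.const)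
  qed (simp add: coeff_poly_cutoff b)
  have "(\<lambda>a. coeff (P a - ?Q a) i) \<in> p" for i
    using gt[of i] zero by (cases "i < Suc e") (simp_all add: coeff_poly_cutoff)
  then have "(\<lambda>y. poly (P y - ?Q y) (y (Suc j))) \<in> p"
    by (intro eval_mem[OF poly_fams_diff[OF P Q] j])
  from diff[OF mem this] have "(\<lambda>y. poly (?Q y) (y (Suc j))) \<in> p" by simp
  moreover have "(\<lambda>a. coeff (?Q a) e) \<notin> p" using e by (simp add: coeff_poly_cutoff)
  ultimately show ?thesis using Q lt[OF e]
    by (intro exI[of _ e] exI[of _ ?Q]) (auto simp: coeff_poly_cutoff)
qed

text \<open>
  One further coordinate. If the ideal imposes no condition on the new coordinate, almost every
  value will do. Otherwise let \<open>Q\<close> be a polynomial in the new coordinate that lies in the ideal and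
  has minimal degree \<open>e\<close> among those whose leading coefficient does not. Over a point where that
  coefficient does not vanish, pseudo-division shows that every root of \<open>Q\<close> is an admissible value.
  If all these roots were roots of \<open>u\<close>, then \<open>Q\<close> would divide \<open>u ^ e\<close>; but the pseudo-remainder of
  \<open>u ^ e\<close> has a coefficient that is not in the ideal, and \<open>h\<close> contains it as a factor.
\<close>
lemma extension_step:
  assumes j: "Suc j \<le> N" and u: "u \<in> poly_funs (Suc j)" "u \<notin> p"
  shows "\<exists>h\<in>poly_funs j. h \<notin> p \<and> (\<forall>q. (\<forall>F\<in>p \<inter> poly_funs j. F q = 0) \<longrightarrow> h q \<noteq> 0 \<longrightarrow>
    (\<exists>c. (\<forall>F\<in>p \<inter> poly_funs (Suc j). F (q(Suc j := c)) = 0) \<and> u (q(Suc j := c)) \<noteq> 0))"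
proof -
  define ev where "ev = (\<lambda>P (y :: nat \<Rightarrow> 'k). poly (P y) (y (Suc j)) :: 'k)"
  have ev_funs: "ev P \<in> poly_funs N" if "P \<in> poly_fams j" for P
    using poly_fams_eval_Suc[OF that] j poly_funs_mono unfolding ev_def by blast
  have ev_upd: "ev P (q(Suc j := c)) = poly (P q) c" if "P \<in> poly_fams j" for P q c
  proof -
    have "P (q(Suc j := c)) = P q" by (rule poly_fams_cong[OF that]) auto
    then show ?thesis by (simp add: ev_def)
  qed
  have fam: "\<exists>P\<in>poly_fams j. F = ev P" if "F \<in> poly_funs (Suc j)" for F
    using poly_funs_Suc_fam[OF that] unfolding ev_def by blast
  have coN: "(\<lambda>a. coeff (P a) i) \<in> poly_funs N" if "P \<in> poly_fams j" for P i
    using poly_fams_coeff[OF that] j by (meson Suc_leD poly_funs_mono)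
  have bound: "\<exists>b. \<forall>a. \<forall>i\<ge>b. coeff (P a) i = 0" if "P \<in> poly_fams j" for P :: "_ \<Rightarrow> 'k poly"
    using poly_fams_bound[OF that] by (metis coeff_eq_0 order_less_le_trans)
  have van: "P q = 0" if "P \<in> poly_fams j" "\<And>i. (\<lambda>a. coeff (P a) i) \<in> p"
    "\<forall>F\<in>p \<inter> poly_funs j. F q = 0" for P q
    using that poly_fams_coeff[OF that(1)] by (intro poly_eqI) fastforce
  obtain U where U: "U \<in> poly_fams j" "u = ev U" using fam[OF u(1)] by blast
  define L where "L = (\<lambda>e Q. Q \<in> poly_fams j \<and> ev Q \<in> p \<and> (\<lambda>a. coeff (Q a) e) \<notin> p \<and>
    (\<forall>a. \<forall>i>e. coeff (Q a) i = 0))"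
  have trunc: "\<exists>e Q. e < b \<and> L e Q"
    if "P \<in> poly_fams j" "ev P \<in> p" "(\<lambda>a. coeff (P a) i) \<notin> p" "\<And>a i. i \<ge> b \<Longrightarrow> coeff (P a) i = 0"
    for P i b
    using truncate[OF that(1) j that(2)[unfolded ev_def] that(3,4)] unfolding L_def ev_def by blast
  show ?thesis
  proof (cases "\<exists>e Q. L e Q")
    case False
    obtain i where i: "(\<lambda>a. coeff (U a) i) \<notin> p"
      using eval_mem[OF U(1) j] u(2) U(2) unfolding ev_def by blast
    show ?thesis
    proof (intro bexI[of _ "\<lambda>a. coeff (U a) i"] conjI allI impI i poly_fams_coeff U(1))
      fix q assume q: "\<forall>F\<in>p \<inter> poly_funs j. F q = 0" "coeff (U q) i \<noteq> 0"
      then have "finite {c. poly (U q) c = 0}" by (intro poly_roots_finite) auto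
      then obtain c where c: "poly (U q) c \<noteq> 0"
        using infinite_UNIV_char_0 by (metis (mono_tags, lifting) UNIV_I ex_new_if_finite mem_Collect_eq)
      have "F (q(Suc j := c)) = 0" if F: "F \<in> p \<inter> poly_funs (Suc j)" for F
      proof -
        obtain P where P: "P \<in> poly_fams j" "F = ev P" using fam F by blast
        obtain b where "\<forall>a. \<forall>i\<ge>b. coeff (P a) i = 0" using bound[OF P(1)] by blast
        then have "(\<lambda>a. coeff (P a) i) \<in> p" for i
          using trunc[OF P(1)] F P(2) False by blast
        then show ?thesis using van[OF P(1) _ q(1)] ev_upd P by simp
      qed
      then show "\<exists>c. (\<forall>F\<in>p \<inter> poly_funs (Suc j). F (q(Suc j := c)) = 0) \<and> u (q(Suc j := c)) \<noteq> 0"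
        using c ev_upd[OF U(1)] U(2) by metis
    qed
  next
    case True
    define e where "e = (LEAST e. \<exists>Q. L e Q)"
    obtain Q where LQ: "L e Q" unfolding e_def using LeastI_ex[OF True] by blast
    have Q: "Q \<in> poly_fams j" "ev Q \<in> p" "(\<lambda>a. coeff (Q a) e) \<notin> p" "\<And>a i. i > e \<Longrightarrow> coeff (Q a) i = 0"
      using LQ unfolding L_def by blast+
    have min: "(\<lambda>a. coeff (R a) i) \<in> p"
      if R: "R \<in> poly_fams j" "ev R \<in> p" "\<forall>a. \<forall>i\<ge>e. coeff (R a) i = 0" for R i
    proof (rule ccontr)
      assume "(\<lambda>a. coeff (R a) i) \<notin> p"
      then obtain e' Q' where "e' < e" "L e' Q'" using trunc[OF R(1,2), of i e] R(3) by blast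
      then show False using not_less_Least[of e'] unfolding e_def by blast
    qed
    define a where "a = (\<lambda>y. coeff (Q y) e)"
    have a: "a \<in> poly_funs N" "a \<notin> p" using coN[OF Q(1)] Q(3) unfolding a_def by auto
    obtain M S R where SR: "S \<in> poly_fams j" "R \<in> poly_fams j" "\<forall>y. \<forall>i\<ge>e. coeff (R y) i = 0"
      "\<And>y. smult (a y ^ M) (U y ^ e) = Q y * S y + R y"
      using poly_fams_pseudo_division[OF Q(1) Q(4) poly_fams_power[OF U(1), of e]] unfolding a_def
          by blast
    have "\<exists>i. (\<lambda>y. coeff (R y) i) \<notin> p"
    proof (rule ccontr)
      assume "\<nexists>i. (\<lambda>y. coeff (R y) i) \<notin> p"
      then have "ev R \<in> p" using eval_mem[OF SR(2) j] unfolding ev_def by blast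
      moreover have "(\<lambda>y. a y ^ M * u y ^ e) = (\<lambda>y. ev S y * ev Q y + ev R y)"
      proof
        fix y
        show "a y ^ M * u y ^ e = ev S y * ev Q y + ev R y"
          using arg_cong[OF SR(4)[of y], of "\<lambda>r. poly r (y (Suc j))"]
          by (simp add: U(2) ev_def mult.commute)
      qed
      ultimately have "(\<lambda>y. a y ^ M * u y ^ e) \<in> p"
        using add[OF ideal[OF ev_funs[OF SR(1)] Q(2)]] by simp
      moreover have "u \<in> poly_funs N" using ev_funs U by simp
      ultimately show False
        using mult_notin[OF poly_funs_power[OF a(1)] poly_funs_power power_notin[OF a] power_notin] u(2)
        by blast
    qed
    then obtain i where i: "(\<lambda>y. coeff (R y) i) \<notin> p" by blast
    show ?thesis
    proof (intro bexI[of _ "\<lambda>y. a y * coeff (R y) i"] conjI allI impI)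
      show "(\<lambda>y. a y * coeff (R y) i) \<in> poly_funs j"
        unfolding a_def by (intro poly_funs.mult poly_fams_coeff Q SR)
      show "(\<lambda>y. a y * coeff (R y) i) \<notin> p"
        by (intro mult_notin a i coN SR)
      fix q assume q: "\<forall>F\<in>p \<inter> poly_funs j. F q = 0" "a q * coeff (R q) i \<noteq> 0"
      have aq: "a q \<noteq> 0" and Rq: "R q \<noteq> 0" using q(2) by auto
      have Qq: "Q q \<noteq> 0" using aq unfolding a_def by auto
      have deg: "degree (Q q) = e"
        using aq Q(4) unfolding a_def by (metis le_antisym le_degree leading_coeff_0_iff not_le Qq)
      have "degree (R q) < e" using SR(3) Rq by (metis leading_coeff_0_iff not_less)
      have "\<exists>c. poly (Q q) c = 0 \<and> poly (U q) c \<noteq> 0"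
      proof (rule ccontr)
        assume "\<nexists>c. poly (Q q) c = 0 \<and> poly (U q) c \<noteq> 0"
        then have "Q q dvd U q ^ e" using dvd_power_if_roots_subset[OF Qq] deg by auto
        then have "Q q dvd smult (a q ^ M) (U q ^ e)" by (rule dvd_smult)
        then have "Q q dvd R q" unfolding SR(4) by (simp add: dvd_add_right_iff)
        then show False using dvd_imp_degree_le[OF _ Rq] deg \<open>degree (R q) < e\<close> by fastforce
      qed
      then obtain c where c: "poly (Q q) c = 0" "poly (U q) c \<noteq> 0" by blast
      have "F (q(Suc j := c)) = 0" if F: "F \<in> p \<inter> poly_funs (Suc j)" for F
      proof -
        obtain P where P: "P \<in> poly_fams j" "F = ev P" using fam F by blast
        obtain M S R where SR: "S \<in> poly_fams j" "R \<in> poly_fams j" "\<forall>y. \<forall>i\<ge>e. coeff (R y) i = 0"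
          "\<And>y. smult (a y ^ M) (P y) = Q y * S y + R y"
          using poly_fams_pseudo_division[OF Q(1) Q(4) P(1)] unfolding a_def by blast
        have "ev R y = a y ^ M * ev P y - ev S y * ev Q y" for y
          using arg_cong[OF SR(4)[of y], of "\<lambda>r. poly r (y (Suc j))"]
          by (simp add: ev_def mult.commute)
        then have "ev R = (\<lambda>y. a y ^ M * ev P y - ev S y * ev Q y)" by blast
        then have "ev R \<in> p"
          using diff[OF ideal[OF poly_funs_power[OF a(1)]] ideal[OF ev_funs[OF SR(1)] Q(2)]] F P(2)
          by simp
        then have "R q = 0" using van[OF SR(2) min[OF SR(2) _ SR(3)] q(1)] by blast
        then have "a q ^ M * poly (P q) c = 0"
          using arg_cong[OF SR(4)[of q], of "\<lambda>r. poly r c"] c(1) by simp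
        then show ?thesis using aq ev_upd[OF P(1)] P(2) by simp
      qed
      then show "\<exists>c. (\<forall>F\<in>p \<inter> poly_funs (Suc j). F (q(Suc j := c)) = 0) \<and> u (q(Suc j := c)) \<noteq> 0"
        using c ev_upd[OF U(1)] U(2) by metis
    qed
  qed
qed

text \<open>
  Dominance of a projection, with an open set in its image: all conditions met when the coordinates
  \<open>r + 1, \<dots>, j\<close> are added one at a time are collected in one function \<open>h\<close> of the first \<open>r\<close>.
\<close>
lemma extension:
  assumes "r \<le> j" "j \<le> N" "u \<in> poly_funs j" "u \<notin> p"
  shows "\<exists>h\<in>poly_funs r. h \<notin> p \<and> (\<forall>q. (\<forall>F\<in>p \<inter> poly_funs r. F q = 0) \<longrightarrow> h q \<noteq> 0 \<longrightarrow>
    (\<exists>q'. (\<forall>i\<le>r. q' i = q i) \<and> (\<forall>F\<in>p \<inter> poly_funs j. F q' = 0) \<and> u q' \<noteq> 0))"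
  using assms
proof (induction j arbitrary: u rule: dec_induct)
  case base
  then show ?case by blast
next
  case (step j)
  obtain v where v: "v \<in> poly_funs j" "v \<notin> p" and ext: "\<And>q. \<forall>F\<in>p \<inter> poly_funs j. F q = 0 \<Longrightarrow> v q \<noteq> 0 \<Longrightarrow>
    (\<exists>c. (\<forall>F\<in>p \<inter> poly_funs (Suc j). F (q(Suc j := c)) = 0) \<and> u (q(Suc j := c)) \<noteq> 0)"
    using extension_step[OF step.prems] by blast
  obtain h where h: "h \<in> poly_funs r" "h \<notin> p" and exth: "\<And>q. \<forall>F\<in>p \<inter> poly_funs r. F q = 0 \<Longrightarrow> h q \<noteq> 0 \<Longrightarrow>
    (\<exists>q'. (\<forall>i\<le>r. q' i = q i) \<and> (\<forall>F\<in>p \<inter> poly_funs j. F q' = 0) \<and> v q' \<noteq> 0)"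
    using step.IH[OF _ v] step.prems by (metis Suc_leD)
  show ?case
  proof (intro bexI[of _ h] conjI allI impI h)
    fix q assume "\<forall>F\<in>p \<inter> poly_funs r. F q = 0" "h q \<noteq> 0"
    then obtain q' where q': "\<forall>i\<le>r. q' i = q i" "\<forall>F\<in>p \<inter> poly_funs j. F q' = 0" "v q' \<noteq> 0"
      using exth by blast
    then obtain c where "\<forall>F\<in>p \<inter> poly_funs (Suc j). F (q'(Suc j := c)) = 0" "u (q'(Suc j := c)) \<noteq> 0"
      using ext by blast
    then show "\<exists>q'. (\<forall>i\<le>r. q' i = q i) \<and> (\<forall>F\<in>p \<inter> poly_funs (Suc j). F q' = 0) \<and> u q' \<noteq> 0"
      using q'(1) \<open>r \<le> j\<close> by (intro exI[of _ "q'(Suc j := c)"]) auto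
  qed
qed

text \<open>
  The extension from no coordinates at all: a polynomial that vanishes on the zero locus of a prime
  ideal belongs to it.
\<close>
lemma nullstellensatz:
  assumes u: "u \<in> poly_funs N" "u \<notin> p"
  shows "\<exists>q. (\<forall>F\<in>p. F q = 0) \<and> u q \<noteq> 0"
proof -
  obtain h where h: "h \<in> poly_funs 0" "h \<notin> p" and ext: "\<And>q. \<forall>F\<in>p \<inter> poly_funs 0. F q = 0 \<Longrightarrow> h q \<noteq> 0 \<Longrightarrow>
    (\<exists>q'. (\<forall>i\<le>0. q' i = q i) \<and> (\<forall>F\<in>p \<inter> poly_funs N. F q' = 0) \<and> u q' \<noteq> 0)"
    using extension[of 0 N u] u by auto
  have "h \<noteq> (\<lambda>q. 0)" using h zero by blast
  then obtain q where hq: "h q \<noteq> 0" by auto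
  have "\<forall>F\<in>p \<inter> poly_funs 0. F q = 0"
  proof
    fix F assume "F \<in> p \<inter> poly_funs 0"
    then show "F q = 0" using fun_cong[OF constants[of F], of q] by blast
  qed
  from ext[OF this hq] obtain q' where "\<forall>F\<in>p \<inter> poly_funs N. F q' = 0" "u q' \<noteq> 0"
    by (elim exE conjE)
  moreover have "p \<inter> poly_funs N = p" using sub by (rule Int_absorb2)
  ultimately show ?thesis by (intro exI[of _ q']) simp
qed

end

text \<open>By Zorn's lemma: an ideal that is maximal among those disjoint from \<open>S\<close> is prime.\<close>
lemma ex_poly_prime_avoiding:
  fixes I S :: "((nat \<Rightarrow> 'k::{alg_closed_field, field_char_0}) \<Rightarrow> 'k) set"
  assumes I: "I \<subseteq> poly_funs N" "(\<lambda>q. 0) \<in> I" "\<And>f g. f \<in> I \<Longrightarrow> g \<in> I \<Longrightarrow> (\<lambda>q. f q + g q) \<in> I"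
    "\<And>f g. f \<in> poly_funs N \<Longrightarrow> g \<in> I \<Longrightarrow> (\<lambda>q. f q * g q) \<in> I"
    and S: "(\<lambda>q. 1) \<in> S" "\<And>f g. f \<in> S \<Longrightarrow> g \<in> S \<Longrightarrow> (\<lambda>q. f q * g q) \<in> S"
    and disj: "I \<inter> S = {}"
  shows "\<exists>p. poly_prime N p \<and> I \<subseteq> p \<and> p \<inter> S = {}"
proof -
  define \<A> where "\<A> = {J. I \<subseteq> J \<and> J \<subseteq> poly_funs N \<and> (\<forall>f\<in>J. \<forall>g\<in>J. (\<lambda>q. f q + g q) \<in> J) \<and>
    (\<forall>f\<in>poly_funs N. \<forall>g\<in>J. (\<lambda>q. f q * g q) \<in> J) \<and> J \<inter> S = {}}"
  have "I \<in> \<A>" unfolding \<A>_def using I disj by auto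
  then have ne: "\<A> \<noteq> {}" by blast
  have "\<Union>C \<in> \<A>" if C: "C \<noteq> {}" "subset.chain \<A> C" for C
  proof -
    have sub: "C \<subseteq> \<A>" and tot: "\<And>J K. J \<in> C \<Longrightarrow> K \<in> C \<Longrightarrow> J \<subseteq> K \<or> K \<subseteq> J"
      using C(2) unfolding subset.chain_def by auto
    have "(\<lambda>q. f q + g q) \<in> \<Union>C" if fg: "f \<in> \<Union>C" "g \<in> \<Union>C" for f g
    proof -
      obtain J K where "J \<in> C" "K \<in> C" "f \<in> J" "g \<in> K" using fg by blast
      then obtain L where "L \<in> C" "f \<in> L" "g \<in> L" using tot by blast
      then show ?thesis using sub unfolding \<A>_def by blast
    qed
    moreover have "I \<subseteq> \<Union>C" "\<Union>C \<subseteq> poly_funs N" "\<Union>C \<inter> S = {}"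
      using C(1) sub unfolding \<A>_def by blast+
    moreover have "\<forall>f\<in>poly_funs N. \<forall>g\<in>\<Union>C. (\<lambda>q. f q * g q) \<in> \<Union>C"
      using sub unfolding \<A>_def by blast
    ultimately show ?thesis unfolding \<A>_def by blast
  qed
  from subset_Zorn_nonempty[OF ne this] obtain p where p: "p \<in> \<A>"
    and max: "\<And>J. J \<in> \<A> \<Longrightarrow> p \<subseteq> J \<Longrightarrow> J = p" by blast
  have pI: "I \<subseteq> p" "p \<subseteq> poly_funs N" "p \<inter> S = {}"
    and padd: "\<And>f g. f \<in> p \<Longrightarrow> g \<in> p \<Longrightarrow> (\<lambda>q. f q + g q) \<in> p"
    and pmult: "\<And>f g. f \<in> poly_funs N \<Longrightarrow> g \<in> p \<Longrightarrow> (\<lambda>q. f q * g q) \<in> p"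
    using p unfolding \<A>_def by auto
  \<comment> \<open>adding an element to the maximal ideal makes it meet \<open>S\<close>\<close>
  have meet: "\<exists>j\<in>p. \<exists>a\<in>poly_funs N. (\<lambda>q. j q + a q * f q) \<in> S"
    if f: "f \<in> poly_funs N" "f \<notin> p" for f
  proof (rule ccontr)
    assume no: "\<not> ?thesis"
    define J where "J = {\<lambda>q. j q + a q * f q | j a. j \<in> p \<and> a \<in> poly_funs N}"
    have "J \<in> \<A>"
      unfolding \<A>_def
    proof (intro CollectI conjI ballI)
      have pJ: "p \<subseteq> J"
      proof
        fix j assume "j \<in> p"
        then show "j \<in> J" unfolding J_def
          by (intro CollectI exI[of _ j] exI[of _ "\<lambda>q. 0"]) (auto intro: poly_funs.const)
      qed
      then show "I \<subseteq> J" using pI by blast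
      show "J \<subseteq> poly_funs N" unfolding J_def using f(1) pI(2)
          by (auto intro!: poly_funs.add poly_funs.mult)
      show "J \<inter> S = {}" using no unfolding J_def by blast
      fix g assume g: "g \<in> J"
      then obtain j a where ja: "g = (\<lambda>q. j q + a q * f q)" "j \<in> p" "a \<in> poly_funs N"
        unfolding J_def by blast
      {
        fix h assume "h \<in> J"
        then obtain j' a' where "h = (\<lambda>q. j' q + a' q * f q)" "j' \<in> p" "a' \<in> poly_funs N"
          unfolding J_def by blast
        then show "(\<lambda>q. g q + h q) \<in> J" unfolding J_def using ja
          by (intro CollectI exI[of _ "\<lambda>q. j q + j' q"] exI[of _ "\<lambda>q. a q + a' q"])
            (simp add: algebra_simps padd poly_funs.add)
      }
      {
        fix h :: "(nat \<Rightarrow> 'k) \<Rightarrow> 'k" assume "h \<in> poly_funs N"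
        then show "(\<lambda>q. h q * g q) \<in> J" unfolding J_def using ja
          by (intro CollectI exI[of _ "\<lambda>q. h q * j q"] exI[of _ "\<lambda>q. h q * a q"])
            (simp add: algebra_simps pmult poly_funs.mult)
      }
    qed
    moreover have "p \<subseteq> J"
    proof
      fix j assume "j \<in> p"
      then show "j \<in> J" unfolding J_def
        by (intro CollectI exI[of _ j] exI[of _ "\<lambda>q. 0"]) (auto intro: poly_funs.const)
    qed
    ultimately have "J = p" by (rule max)
    moreover have "f \<in> J" unfolding J_def using pI(1) I(2)
      by (intro CollectI exI[of _ "\<lambda>q. 0"] exI[of _ "\<lambda>q. 1"]) (auto intro: poly_funs.const)
    ultimately show False using f(2) by blast
  qed
  have "poly_prime N p"
  proof
    show "(\<lambda>q. 0) \<in> p" using pI(1) I(2) by blast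
    show "(\<lambda>q. 1) \<notin> p" using pI(3) S(1) by blast
    fix f g assume f: "f \<in> poly_funs N" and g: "g \<in> poly_funs N" and fg: "(\<lambda>q. f q * g q) \<in> p"
    show "f \<in> p \<or> g \<in> p"
    proof (rule ccontr)
      assume "\<not> (f \<in> p \<or> g \<in> p)"
      then obtain j a k b where ja: "j \<in> p" "a \<in> poly_funs N" "(\<lambda>q. j q + a q * f q) \<in> S"
        and kb: "k \<in> p" "b \<in> poly_funs N" "(\<lambda>q. k q + b q * g q) \<in> S"
        using meet[OF f] meet[OF g] by blast
      have "(\<lambda>q. (k q + b q * g q) * j q + (a q * f q) * k q + (a q * b q) * (f q * g q)) \<in> p"
        by (intro padd pmult[OF poly_funs.add[OF _ poly_funs.mult]] pmult[OF poly_funs.mult]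
            ja kb f g fg) (use kb(1) pI(2) in blast)
      also have "(\<lambda>q. (k q + b q * g q) * j q + (a q * f q) * k q + (a q * b q) * (f q * g q)) =
          (\<lambda>q. (j q + a q * f q) * (k q + b q * g q))"
        by (auto simp: algebra_simps)
      finally show False using S(2)[OF ja(3) kb(3)] pI(3) by blast
    qed
  qed (use pI padd pmult in blast)+
  then show ?thesis using pI by blast
qed

text \<open>
  The prime ideals needed below avoid \<open>u\<close> and all nonzero polynomials in the first \<open>r\<close>
  coordinates: on their zero locus the latter satisfy no relation, even after \<open>u\<close> is inverted.
\<close>
lemma ex_poly_prime_dominant:
  fixes I :: "((nat \<Rightarrow> 'k::{alg_closed_field, field_char_0}) \<Rightarrow> 'k) set"
  assumes I: "I \<subseteq> poly_funs N" "(\<lambda>q. 0) \<in> I" "\<And>f g. f \<in> I \<Longrightarrow> g \<in> I \<Longrightarrow> (\<lambda>q. f q + g q) \<in> I"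
    "\<And>f g. f \<in> poly_funs N \<Longrightarrow> g \<in> I \<Longrightarrow> (\<lambda>q. f q * g q) \<in> I"
    and avoid: "\<And>s k y. s \<in> poly_funs r \<Longrightarrow> s y \<noteq> 0 \<Longrightarrow> (\<lambda>q. s q * u q ^ k) \<notin> I"
  shows "\<exists>p. poly_prime N p \<and> I \<subseteq> p \<and> u \<notin> p \<and> p \<inter> poly_funs r \<subseteq> {\<lambda>q. 0}"
proof -
  define S where "S = {\<lambda>q. s q * u q ^ k | s k. s \<in> poly_funs r \<and> (\<exists>y. s y \<noteq> 0)}"
  have SI: "(\<lambda>q. s q * u q ^ k) \<in> S" if "s \<in> poly_funs r" "s y \<noteq> 0" for s k y
    unfolding S_def using that by blast
  have "\<exists>p. poly_prime N p \<and> I \<subseteq> p \<and> p \<inter> S = {}"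
  proof (rule ex_poly_prime_avoiding[OF I])
    show "(\<lambda>q. 1) \<in> S" using SI[OF poly_funs.const[of "1::'k"] one_neq_zero, of 0] by simp
    show "(\<lambda>q. f q * g q) \<in> S" if fg: "f \<in> S" "g \<in> S" for f g
    proof -
      obtain s k y where f: "f = (\<lambda>q. s q * u q ^ k)" "s \<in> poly_funs r" "s y \<noteq> 0"
        using fg(1) unfolding S_def by blast
      obtain s' k' y' where g: "g = (\<lambda>q. s' q * u q ^ k')" "s' \<in> poly_funs r" "s' y' \<noteq> 0"
        using fg(2) unfolding S_def by blast
      obtain w where "s w * s' w \<noteq> 0"
        using poly_funs_nonzero_mult[OF f(2) g(2) f(3) g(3)] by auto
      from SI[OF poly_funs.mult[OF f(2) g(2)] this, of "k + k'"]
      show ?thesis unfolding f(1) g(1) by (simp add: power_add algebra_simps)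
    qed
    show "I \<inter> S = {}" using avoid unfolding S_def by blast
  qed
  then obtain p where p: "poly_prime N p" "I \<subseteq> p" "p \<inter> S = {}" by blast
  have "u \<notin> p" using SI[OF poly_funs.const[of "1::'k"] one_neq_zero, of 1] p(3) by auto
  moreover have "p \<inter> poly_funs r \<subseteq> {\<lambda>q. 0}"
  proof
    fix s assume s: "s \<in> p \<inter> poly_funs r"
    have "s y = 0" for y
    proof (rule ccontr)
      assume "s y \<noteq> 0"
      from SI[of s y 0, OF _ this] s have "s \<in> S" by simp
      then show False using s p(3) by blast
    qed
    then show "s \<in> {\<lambda>q. 0}" by auto
  qed
  ultimately show ?thesis using p by blast
qed

text \<open>
  Slicing by a hyperplane \<open>x\<^sub>r\<^sub>+\<^sub>1 = c\<close>. The extension theorem provides a nonzero \<open>h\<close> such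
  that every parameter with \<open>h \<noteq> 0\<close> lifts to a point of the variety; for a value \<open>c\<close> with
  \<open>h(\<dots>, c) \<noteq> 0\<close> the slice still dominates the remaining parameters, so the ideal of the slice
  avoids the multiplicative set of their nonzero polynomials.
\<close>
lemma (in poly_prime) slice:
  assumes r: "Suc r \<le> N" and indep: "p \<inter> poly_funs (Suc r) \<subseteq> {\<lambda>q. 0}"
    and u: "u \<in> poly_funs N" "u \<notin> p"
  shows "\<exists>p'. poly_prime N p' \<and> p \<subset> p' \<and> u \<notin> p' \<and> p' \<inter> poly_funs r \<subseteq> {\<lambda>q. 0}"
proof -
  obtain h where h: "h \<in> poly_funs (Suc r)" "h \<notin> p"
    and ext: "\<And>q. \<forall>F\<in>p \<inter> poly_funs (Suc r). F q = 0 \<Longrightarrow> h q \<noteq> 0 \<Longrightarrow>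
    (\<exists>q'. (\<forall>i\<le>Suc r. q' i = q i) \<and> (\<forall>F\<in>p \<inter> poly_funs N. F q' = 0) \<and> u q' \<noteq> 0)"
    using extension[OF r order_refl u] by blast
  have "h \<noteq> (\<lambda>q. 0)" using h zero by blast
  then obtain y where y: "h y \<noteq> 0" by auto
  \<comment> \<open>the slice has to pass through a point with \<open>h \<noteq> 0\<close>\<close>
  define c where "c = y (Suc r)"
  define hc where "hc = (\<lambda>z. h (\<lambda>i. if i = Suc r then c else z i))"
  have hc: "hc \<in> poly_funs r"
  proof -
    have "(\<lambda>z. h (\<lambda>i. (if i = Suc r then (\<lambda>z. c) else (\<lambda>z. z i)) z)) \<in> poly_funs r"
      by (rule poly_funs_subst[OF h(1)]) (auto intro: poly_funs.const poly_funs.coord)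
    then show ?thesis unfolding hc_def by (simp add: if_distribR)
  qed
  have hcy: "hc y \<noteq> 0"
  proof -
    have "(\<lambda>i. if i = Suc r then c else y i) = y" unfolding c_def by auto
    then show ?thesis using y unfolding hc_def by simp
  qed
  define l where "l = (\<lambda>q::nat \<Rightarrow> 'k. q (Suc r) - c)"
  have l: "l \<in> poly_funs (Suc r)" unfolding l_def
    by (intro poly_funs_diff poly_funs.coord poly_funs.const) auto
  have lN: "l \<in> poly_funs N" using poly_funs_mono[OF r l] .
  define I where "I = {\<lambda>q. f q + l q * b q | f b. f \<in> p \<and> b \<in> poly_funs N}"
  have II: "(\<lambda>q. f q + l q * b q) \<in> I" if "f \<in> p" "b \<in> poly_funs N" for f b
    unfolding I_def using that by blast
  have "\<exists>p'. poly_prime N p' \<and> I \<subseteq> p' \<and> u \<notin> p' \<and> p' \<inter> poly_funs r \<subseteq> {\<lambda>q. 0}"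
  proof (rule ex_poly_prime_dominant)
    show "I \<subseteq> poly_funs N"
    proof
      fix F assume "F \<in> I"
      then obtain f b where "F = (\<lambda>q. f q + l q * b q)" "f \<in> p" "b \<in> poly_funs N"
        unfolding I_def by blast
      then show "F \<in> poly_funs N" using sub lN by (simp add: poly_funs.add poly_funs.mult subset_iff)
    qed
    show "(\<lambda>q. 0) \<in> I" using II[OF zero poly_funs.const[of 0]] by simp
    show "(\<lambda>q. f q + g q) \<in> I" if fg: "f \<in> I" "g \<in> I" for f g
    proof -
      obtain f1 b1 where f: "f = (\<lambda>q. f1 q + l q * b1 q)" "f1 \<in> p" "b1 \<in> poly_funs N"
        using fg(1) unfolding I_def by blast
      obtain f2 b2 where g: "g = (\<lambda>q. f2 q + l q * b2 q)" "f2 \<in> p" "b2 \<in> poly_funs N"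
        using fg(2) unfolding I_def by blast
      show ?thesis
        using II[OF add[OF f(2) g(2)] poly_funs.add[OF f(3) g(3)]] unfolding f(1) g(1)
        by (simp add: algebra_simps)
    qed
    show "(\<lambda>q. f q * g q) \<in> I" if fg: "f \<in> poly_funs N" "g \<in> I" for f g
    proof -
      obtain f2 b2 where g: "g = (\<lambda>q. f2 q + l q * b2 q)" "f2 \<in> p" "b2 \<in> poly_funs N"
        using fg(2) unfolding I_def by blast
      show ?thesis
        using II[OF ideal[OF fg(1) g(2)] poly_funs.mult[OF fg(1) g(3)]] unfolding g(1)
        by (simp add: algebra_simps)
    qed
    show "(\<lambda>q. s q * u q ^ k) \<notin> I" if s: "s \<in> poly_funs r" "s y \<noteq> 0" for s k y
    proof
      assume "(\<lambda>q. s q * u q ^ k) \<in> I"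
      then obtain f b where fb: "f \<in> p" "b \<in> poly_funs N"
        and eq: "(\<lambda>q. f q + l q * b q) = (\<lambda>q. s q * u q ^ k)"
        unfolding I_def by auto
      obtain w where w: "s w \<noteq> 0" "hc w \<noteq> 0"
        using poly_funs_nonzero_mult[OF s(1) hc s(2) hcy] by blast
      let ?w = "\<lambda>i. if i = Suc r then c else w i"
      have "h ?w \<noteq> 0" using w(2) unfolding hc_def .
      moreover have "\<forall>F\<in>p \<inter> poly_funs (Suc r). F ?w = 0" using indep by auto
      ultimately have "\<exists>q'. (\<forall>i\<le>Suc r. q' i = ?w i) \<and> (\<forall>F\<in>p \<inter> poly_funs N. F q' = 0) \<and> u q' \<noteq> 0"
        by (intro ext)
      then obtain q' where q': "\<forall>i\<le>Suc r. q' i = ?w i" "\<forall>F\<in>p \<inter> poly_funs N. F q' = 0" "u q' \<noteq> 0"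
        by (elim exE conjE)
      have "l q' = 0" unfolding l_def using q'(1) by simp
      moreover have "f q' = 0" using q'(2) fb(1) sub by blast
      moreover have "s q' = s w" by (rule poly_funs_cong[OF s(1)]) (use q'(1) in auto)
      ultimately show False using fun_cong[OF eq, of q'] w(1) q'(3) by simp
    qed
  qed
  then obtain p' where p': "poly_prime N p'" "I \<subseteq> p'" "u \<notin> p'" "p' \<inter> poly_funs r \<subseteq> {\<lambda>q. 0}" by blast
  have pp': "p \<subseteq> p'"
  proof
    fix f assume "f \<in> p"
    then show "f \<in> p'" using II[OF _ poly_funs.const[of 0]] p'(2) by auto
  qed
  have "l \<in> p'" using II[OF zero poly_funs.const[of 1]] p'(2) by auto
  moreover have "l \<notin> p"
  proof
    assume "l \<in> p"
    then have "l = (\<lambda>q. 0)" using indep l by blast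
    then have "l (\<lambda>i. c + 1) = 0" by simp
    then show False unfolding l_def by simp
  qed
  ultimately have "p \<subset> p'" using pp' by blast
  then show ?thesis using p' by blast
qed

lemma (in poly_prime) prime_chain:
  assumes "r \<le> N" "p \<inter> poly_funs r \<subseteq> {\<lambda>q. 0}" "u \<in> poly_funs N" "u \<notin> p"
  shows "\<exists>Q. (\<forall>i\<le>r. poly_prime N (Q i) \<and> p \<subseteq> Q i \<and> u \<notin> Q i) \<and> (\<forall>i<r. Q (Suc i) \<subset> Q i)"
  using poly_prime_axioms assms
proof (induction r arbitrary: p)
  case 0
  then show ?case by (intro exI[of _ "\<lambda>i. p"]) auto
next
  case (Suc r)
  interpret q: poly_prime N p by fact
  obtain p' where p': "poly_prime N p'" "p \<subset> p'" "u \<notin> p'" "p' \<inter> poly_funs r \<subseteq> {\<lambda>q. 0}"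
    using q.slice[OF Suc.prems(2-5)] by blast
  obtain Q where Q: "\<forall>i\<le>r. poly_prime N (Q i) \<and> p' \<subseteq> Q i \<and> u \<notin> Q i" "\<forall>i<r. Q (Suc i) \<subset> Q i"
    using Suc.IH[OF p'(1) _ p'(4) Suc.prems(4) p'(3)] Suc.prems(2) by auto
  let ?Q = "\<lambda>i. if i = Suc r then p else Q i"
  have 1: "poly_prime N (?Q i) \<and> p \<subseteq> ?Q i \<and> u \<notin> ?Q i" if "i \<le> Suc r" for i
    using that Q(1)[rule_format, of i] p'(2) q.poly_prime_axioms Suc.prems(5)
    by (cases "i = Suc r") auto
  have 2: "?Q (Suc i) \<subset> ?Q i" if "i < Suc r" for i
  proof (cases "i = r")
    case True
    then show ?thesis using Q(1)[rule_format, of r] p'(2) by auto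
  next
    case False
    then show ?thesis using Q(2) that by simp
  qed
  show ?case
    by (rule exI[of _ ?Q], intro conjI allI impI 2) (use 1 in simp_all)
qed

section \<open>Regular functions and a lower bound for the dimension\<close>

text \<open>
  The ring of polynomial functions with \<open>u\<close> inverted; only the values where \<open>u\<close> does not vanish
  matter.
\<close>
definition regular_funs :: "nat \<Rightarrow> ((nat \<Rightarrow> 'k::field) \<Rightarrow> 'k) \<Rightarrow> ((nat \<Rightarrow> 'k) \<Rightarrow> 'k) set" where
  "regular_funs n u = {\<phi>. \<exists>k. \<exists>g\<in>poly_funs n. \<forall>q. u q \<noteq> 0 \<longrightarrow> \<phi> q * u q ^ k = g q}"

lemma regular_funs_poly: "f \<in> poly_funs n \<Longrightarrow> f \<in> regular_funs n u"
  unfolding regular_funs_def by (intro CollectI exI[of _ 0] bexI[of _ f]) auto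

lemma regular_funs_add:
  assumes u: "u \<in> poly_funs n" and "\<phi> \<in> regular_funs n u" "\<psi> \<in> regular_funs n u"
  shows "(\<lambda>q. \<phi> q + \<psi> q) \<in> regular_funs n u"
proof -
  obtain k g l h where g: "g \<in> poly_funs n" "\<And>q. u q \<noteq> 0 \<Longrightarrow> \<phi> q * u q ^ k = g q"
    and h: "h \<in> poly_funs n" "\<And>q. u q \<noteq> 0 \<Longrightarrow> \<psi> q * u q ^ l = h q"
    using assms(2,3) unfolding regular_funs_def by blast
  have "(\<phi> q + \<psi> q) * u q ^ (k + l) = g q * u q ^ l + h q * u q ^ k" if "u q \<noteq> 0" for q
    using g(2)[OF that] h(2)[OF that]
    by (simp add: power_add algebra_simps flip: mult.assoc)
  moreover have "(\<lambda>q. g q * u q ^ l + h q * u q ^ k) \<in> poly_funs n"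
    by (intro poly_funs.add poly_funs.mult poly_funs_power u g h)
  ultimately show ?thesis
    unfolding regular_funs_def by (intro CollectI exI[of _ "k + l"] bexI allI impI)
qed

lemma regular_funs_mult:
  assumes "\<phi> \<in> regular_funs n u" "\<psi> \<in> regular_funs n u"
  shows "(\<lambda>q. \<phi> q * \<psi> q) \<in> regular_funs n u"
proof -
  obtain k g l h where g: "g \<in> poly_funs n" "\<And>q. u q \<noteq> 0 \<Longrightarrow> \<phi> q * u q ^ k = g q"
    and h: "h \<in> poly_funs n" "\<And>q. u q \<noteq> 0 \<Longrightarrow> \<psi> q * u q ^ l = h q"
    using assms unfolding regular_funs_def by blast
  have "(\<phi> q * \<psi> q) * u q ^ (k + l) = g q * h q" if "u q \<noteq> 0" for q
    unfolding g(2)[OF that, symmetric] h(2)[OF that, symmetric] by (simp add: power_add)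
  moreover have "(\<lambda>q. g q * h q) \<in> poly_funs n" by (intro poly_funs.mult g h)
  ultimately show ?thesis
    unfolding regular_funs_def by (intro CollectI exI[of _ "k + l"] bexI allI impI)
qed

lemma regular_funs_power:
  "\<phi> \<in> regular_funs n u \<Longrightarrow> (\<lambda>q. \<phi> q ^ k) \<in> regular_funs n u"
  by (induction k) (simp_all add: regular_funs_mult regular_funs_poly[OF poly_funs.const])

lemma regular_funs_sum:
  assumes "u \<in> poly_funs n" "\<And>i. i \<in> A \<Longrightarrow> \<phi> i \<in> regular_funs n u"
  shows "(\<lambda>q. \<Sum>i\<in>A. \<phi> i q) \<in> regular_funs n u"
  using assms(2) by (induction A rule: infinite_finite_induct)
    (simp_all add: regular_funs_add[OF assms(1)] regular_funs_poly[OF poly_funs.const])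

text \<open>Divisors of \<open>u\<close> are units.\<close>
lemma regular_funs_inverse:
  assumes "f \<in> poly_funs n" "\<And>q. u q \<noteq> 0 \<Longrightarrow> g q * f q = u q"
  shows "(\<lambda>q. inverse (g q)) \<in> regular_funs n u"
proof -
  have "inverse (g q) * u q ^ 1 = f q" if "u q \<noteq> 0" for q
  proof -
    have "g q \<noteq> 0" using assms(2)[OF that] that by auto
    then show ?thesis using assms(2)[OF that, symmetric] by simp
  qed
  then show ?thesis unfolding regular_funs_def using assms(1) by blast
qed

lemma regular_funs_subst:
  assumes "F \<in> poly_funs m" and u: "u \<in> poly_funs n"
    and "\<And>i. i \<in> {1..m} \<Longrightarrow> \<phi> i \<in> regular_funs n u"
  shows "(\<lambda>q. F (\<lambda>i. \<phi> i q)) \<in> regular_funs n u"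
  using assms(1)
proof induction
  case (const c)
  show ?case by (intro regular_funs_poly poly_funs.const)
qed (simp_all add: assms regular_funs_add[OF u] regular_funs_mult)

text \<open>
  Regular functions \<open>\<phi> 1, \<dots>, \<phi> r\<close> on a locally closed set that satisfy no algebraic relation
  bound its dimension from below. The set is replaced by the graph of \<open>\<phi>\<close>, on which the
  functions are the first \<open>r\<close> coordinates; a prime ideal that contains all equations of the graph
  and no relation between these coordinates is sliced \<open>r\<close> times.
\<close>
theorem krull_dim_ge:
  fixes X :: "(nat \<Rightarrow> 'k::{alg_closed_field, field_char_0}) set"
  assumes X: "X = {q \<in> affine_space n. (\<forall>f\<in>J. f q = 0) \<and> u q \<noteq> 0}"
    and J: "J \<subseteq> poly_funs n" and u: "u \<in> poly_funs n"
    and \<phi>: "\<And>i. i \<in> {1..r} \<Longrightarrow> \<phi> i \<in> regular_funs n u"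
    and dense: "\<And>F y. F \<in> poly_funs r \<Longrightarrow> (\<And>q. q \<in> X \<Longrightarrow> F (\<lambda>i. \<phi> i q) = 0) \<Longrightarrow> F y = 0"
  shows "enat r \<le> krull_dim (subtopology (zariski n) X)"
proof -
  define N where "N = r + n"
  \<comment> \<open>\<open>glue\<close> maps to the graph; \<open>unshift\<close> and \<open>lift\<close> forget the first \<open>r\<close> coordinates\<close>
  define glue where "glue = (\<lambda>q i. if i \<le> r then \<phi> i q else q (i - r))"
  define unshift where "unshift = (\<lambda>w. restrict (\<lambda>i. w (i + r)) {1..n} :: nat \<Rightarrow> 'k)"
  define lift where "lift = (\<lambda>f (w :: nat \<Rightarrow> 'k). f (\<lambda>i. w (i + r)) :: 'k)"
  have lift: "lift f \<in> poly_funs N" if "f \<in> poly_funs n" for f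
    unfolding lift_def by (rule poly_funs_subst[OF that]) (auto intro!: poly_funs.coord simp: N_def)
  have lift_glue: "lift f (glue q) = f q" if "f \<in> poly_funs n" for f q
    unfolding lift_def by (rule poly_funs_cong[OF that]) (auto simp: glue_def)
  have lift_unshift: "lift f w = f (unshift w)" if "f \<in> poly_funs n" for f w
    unfolding lift_def by (rule poly_funs_cong[OF that]) (auto simp: unshift_def)
  have coN: "(\<lambda>w. w i) \<in> poly_funs N" if "i \<in> {1..r}" for i
    using that by (intro poly_funs.coord) (auto simp: N_def)
  define I where "I = {F \<in> poly_funs N. \<forall>q\<in>X. F (glue q) = 0}"
  have s_glue: "s (glue q) = s (\<lambda>i. \<phi> i q)" if "s \<in> poly_funs r" for s q
    by (rule poly_funs_cong[OF that]) (auto simp: glue_def)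
  have "\<exists>p. poly_prime N p \<and> I \<subseteq> p \<and> lift u \<notin> p \<and> p \<inter> poly_funs r \<subseteq> {\<lambda>q. 0}"
  proof (rule ex_poly_prime_dominant)
    show "(\<lambda>q. f q + g q) \<in> I" if "f \<in> I" "g \<in> I" for f g
      using that unfolding I_def by (auto intro: poly_funs.add)
    show "(\<lambda>q. f q * g q) \<in> I" if "f \<in> poly_funs N" "g \<in> I" for f g
      using that unfolding I_def by (auto intro: poly_funs.mult)
    show "(\<lambda>q. s q * lift u q ^ k) \<notin> I" if s: "s \<in> poly_funs r" "s y \<noteq> 0" for s k y
    proof
      assume mem: "(\<lambda>q. s q * lift u q ^ k) \<in> I"
      have "s (\<lambda>i. \<phi> i q) = 0" if "q \<in> X" for q
      proof -
        have "s (glue q) * lift u (glue q) ^ k = 0" using mem that unfolding I_def by blast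
        then show ?thesis using that lift_glue[OF u] s_glue[OF s(1)] by (simp add: X)
      qed
      then show False using dense[OF s(1)] s(2) by blast
    qed
  qed (auto simp: I_def intro: poly_funs.const)
  then obtain p where p: "poly_prime N p" "I \<subseteq> p" "lift u \<notin> p" "p \<inter> poly_funs r \<subseteq> {\<lambda>q. 0}" by blast
  interpret p: poly_prime N p by (fact p)
  have "r \<le> N" by (simp add: N_def)
  then have "\<exists>Q. (\<forall>i\<le>r. poly_prime N (Q i) \<and> p \<subseteq> Q i \<and> lift u \<notin> Q i) \<and>
      (\<forall>i<r. Q (Suc i) \<subset> Q i)"
    by (intro p.prime_chain lift[OF u] p)
  then obtain Q where Q': "\<forall>i\<le>r. poly_prime N (Q i) \<and> p \<subseteq> Q i \<and> lift u \<notin> Q i"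
    "\<forall>i<r. Q (Suc i) \<subset> Q i"
    by (elim exE conjE)
  have Q: "i \<le> r \<Longrightarrow> poly_prime N (Q i)" "i \<le> r \<Longrightarrow> p \<subseteq> Q i" "i \<le> r \<Longrightarrow> lift u \<notin> Q i"
    "i < r \<Longrightarrow> Q (Suc i) \<subset> Q i" for i
    using Q' by simp_all
  define Z where "Z = (\<lambda>i. {q \<in> X. \<forall>F\<in>Q i. F (glue q) = 0})"
  \<comment> \<open>the ideal of \<open>Z i\<close> is \<open>Q i\<close>: points of the zero locus with \<open>u \<noteq> 0\<close> lie on the graph\<close>
  have point: "\<exists>q\<in>Z i. G (glue q) \<noteq> 0" if i: "i \<le> r" and G: "G \<in> poly_funs N" "G \<notin> Q i" for i G
  proof -
    interpret q: poly_prime N "Q i" using Q(1)[OF i] .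
    obtain w where w: "\<And>F. F \<in> Q i \<Longrightarrow> F w = 0" "lift u w * G w \<noteq> 0"
      using q.nullstellensatz[OF poly_funs.mult[OF lift[OF u] G(1)] q.mult_notin[OF lift[OF u] G(1)
          Q(3)[OF i] G(2)]]
      by (elim exE conjE) blast
    define q where "q = unshift w"
    have IQ: "F w = 0" if "F \<in> I" for F using that p(2) Q(2)[OF i] w(1) by blast
    have uq: "u q \<noteq> 0" using w(2) lift_unshift[OF u] unfolding q_def by auto
    have q: "q \<in> X"
      unfolding X
    proof (intro CollectI conjI ballI uq)
      show "q \<in> affine_space n" unfolding q_def unshift_def affine_space_def by auto
      fix f assume f: "f \<in> J"
      then have fn: "f \<in> poly_funs n" using J by blast
      have "lift f \<in> I" unfolding I_def using f by (auto simp: lift[OF fn] lift_glue[OF fn] X)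
      then show "f q = 0" using IQ lift_unshift[OF fn] unfolding q_def by metis
    qed
    have \<phi>w: "w j = \<phi> j q" if j: "j \<in> {1..r}" for j
    proof -
      obtain k g where g: "g \<in> poly_funs n" "\<And>q. u q \<noteq> 0 \<Longrightarrow> \<phi> j q * u q ^ k = g q"
        using \<phi>[OF j] unfolding regular_funs_def by blast
      have "(\<lambda>w. w j * lift u w ^ k - lift g w) \<in> I"
        unfolding I_def
      proof (intro CollectI conjI ballI)
        show "(\<lambda>w. w j * lift u w ^ k - lift g w) \<in> poly_funs N"
          by (intro poly_funs_diff poly_funs.mult poly_funs_power lift u g coN j)
        fix q assume "q \<in> X"
        then have "\<phi> j q * u q ^ k = g q" by (intro g(2)) (simp add: X)
        moreover have "glue q j = \<phi> j q" using j by (simp add: glue_def)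
        ultimately show "glue q j * lift u (glue q) ^ k - lift g (glue q) = 0"
          by (simp add: lift_glue u g)
      qed
      then have "w j * u q ^ k = g q"
        using IQ[of "\<lambda>w. w j * lift u w ^ k - lift g w"] lift_unshift[OF u] lift_unshift[OF g(1)]
        unfolding q_def by simp
      then have "w j * u q ^ k = \<phi> j q * u q ^ k" by (rule trans) (rule g(2)[OF uq, symmetric])
      then show ?thesis using uq by simp
    qed
    have glue_w: "F (glue q) = F w" if "F \<in> poly_funs N" for F
    proof (rule poly_funs_cong[OF that])
      fix j assume "j \<in> {1..N}"
      then show "glue q j = w j"
        using \<phi>w[of j] by (auto simp: glue_def q_def unshift_def N_def)
    qed
    have "F (glue q) = 0" if "F \<in> Q i" for F
      using glue_w[of F] w(1)[OF that] q.sub that by auto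
    then have "q \<in> Z i" unfolding Z_def using q by blast
    moreover have "G (glue q) \<noteq> 0" using glue_w[OF G(1)] w(2) by simp
    ultimately show ?thesis by blast
  qed
  have topX: "topspace (subtopology (zariski n) X) = X"
    unfolding topspace_subtopology topspace_zariski by (auto simp: X)
  have closedZ: "closedin (subtopology (zariski n) X) (Z i)" if i: "i \<le> r" for i
  proof -
    interpret q: poly_prime N "Q i" using Q(1)[OF i] .
    define T where "T = {g \<in> poly_funs n. \<exists>F\<in>Q i. \<exists>k. \<forall>q. u q \<noteq> 0 \<longrightarrow> F (glue q) * u q ^ k = g q}"
    have "Z i = zero_locus n T \<inter> X"
    proof (intro equalityI subsetI)
      fix q assume q: "q \<in> Z i"
      have "g q = 0" if g: "g \<in> T" for g
      proof -
        obtain F k where "F \<in> Q i" "\<forall>q. u q \<noteq> 0 \<longrightarrow> F (glue q) * u q ^ k = g q"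
          using g unfolding T_def by (elim CollectE conjE bexE exE)
        then show ?thesis using q unfolding Z_def X by fastforce
      qed
      then show "q \<in> zero_locus n T \<inter> X" using q unfolding zero_locus_def Z_def X by blast
    next
      fix q assume q: "q \<in> zero_locus n T \<inter> X"
      have "F (glue q) = 0" if F: "F \<in> Q i" for F
      proof -
        have "F \<in> poly_funs N" using F q.sub by blast
        then have "(\<lambda>q. F (\<lambda>i. glue q i)) \<in> regular_funs n u"
        proof (rule regular_funs_subst[OF _ u])
          fix j assume "j \<in> {1..N}"
          then show "(\<lambda>q. glue q j) \<in> regular_funs n u"
            using \<phi>[of j]
            by (cases "j \<le> r") (auto simp: glue_def N_def intro!: regular_funs_poly poly_funs.coord)
        qed
        then obtain k g where g: "g \<in> poly_funs n" "\<forall>q. u q \<noteq> 0 \<longrightarrow> F (glue q) * u q ^ k = g q"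
          unfolding regular_funs_def by blast
        then have "g \<in> T" unfolding T_def by (intro CollectI conjI bexI[OF _ F] exI[of _ k])
        then have "g q = 0" using q unfolding zero_locus_def by blast
        then show ?thesis using g(2) q unfolding X by auto
      qed
      then show "q \<in> Z i" unfolding Z_def using q by blast
    qed
    moreover have "T \<subseteq> poly_funs n" unfolding T_def by (rule Collect_restrict)
    then have "closedin (zariski n) (zero_locus n T)"
      unfolding closedin_zariski by (intro exI[of _ T] conjI refl)
    ultimately show ?thesis unfolding closedin_subtopology by (intro exI[of _ "zero_locus n T"] conjI)
  qed
  have irredZ: "irreducible_in (subtopology (zariski n) X) (Z i)" if i: "i \<le> r" for i
    unfolding irreducible_in_def topX
  proof (intro conjI allI impI)
    interpret q: poly_prime N "Q i" using Q(1)[OF i] .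
    show "Z i \<subseteq> X" unfolding Z_def by blast
    show "Z i \<noteq> {}" using point[OF i poly_funs.const[of 1] q.one] by blast
    fix A B
    assume AB: "closedin (subtopology (zariski n) X) A \<and> closedin (subtopology (zariski n) X) B \<and>
        Z i \<subseteq> A \<union> B"
    have sep: "\<exists>\<alpha>\<in>poly_funs n. (\<forall>q\<in>C. \<alpha> q = 0) \<and> lift \<alpha> \<notin> Q i"
      if C: "closedin (subtopology (zariski n) X) C" "\<not> Z i \<subseteq> C" for C
    proof -
      obtain F where F: "F \<subseteq> poly_funs n" "C = zero_locus n F \<inter> X"
        using C(1) unfolding closedin_subtopology closedin_zariski by blast
      obtain q where q: "q \<in> Z i" "q \<notin> C" using C(2) by blast
      then obtain \<alpha> where \<alpha>: "\<alpha> \<in> F" "\<alpha> q \<noteq> 0"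
        unfolding F(2) zero_locus_def Z_def X by blast
      then have "lift \<alpha> (glue q) \<noteq> 0" using lift_glue F(1) by (metis subsetD)
      then have "lift \<alpha> \<notin> Q i" using q(1) unfolding Z_def by blast
      then show ?thesis using \<alpha>(1) F unfolding zero_locus_def by blast
    qed
    show "Z i \<subseteq> A \<or> Z i \<subseteq> B"
    proof (rule ccontr)
      assume no: "\<not> (Z i \<subseteq> A \<or> Z i \<subseteq> B)"
      obtain \<alpha> where \<alpha>: "\<alpha> \<in> poly_funs n" "\<forall>q\<in>A. \<alpha> q = 0" "lift \<alpha> \<notin> Q i"
        using sep[of A] no AB by blast
      obtain \<beta> where \<beta>: "\<beta> \<in> poly_funs n" "\<forall>q\<in>B. \<beta> q = 0" "lift \<beta> \<notin> Q i"
        using sep[of B] no AB by blast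
      obtain q where q: "q \<in> Z i" "lift \<alpha> (glue q) * lift \<beta> (glue q) \<noteq> 0"
        using point[OF i poly_funs.mult[OF lift[OF \<alpha>(1)] lift[OF \<beta>(1)]]
            q.mult_notin[OF lift[OF \<alpha>(1)] lift[OF \<beta>(1)] \<alpha>(3) \<beta>(3)]] by blast
      then have "\<alpha> q \<noteq> 0" "\<beta> q \<noteq> 0" using lift_glue \<alpha>(1) \<beta>(1) by auto
      then show False using AB q(1) \<alpha>(2) \<beta>(2) by blast
    qed
  qed
  have strict: "Z i \<subset> Z (Suc i)" if i: "i < r" for i
  proof -
    interpret q: poly_prime N "Q i" using Q(1) i by simp
    have "Z i \<subseteq> Z (Suc i)" unfolding Z_def using Q(4)[OF i] by blast
    moreover obtain G where G: "G \<in> Q i" "G \<notin> Q (Suc i)" using Q(4)[OF i] by blast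
    then obtain q where "q \<in> Z (Suc i)" "G (glue q) \<noteq> 0"
      using point[of "Suc i" G] i q.sub by (metis Suc_leI subsetD)
    then have "q \<in> Z (Suc i)" "q \<notin> Z i" using G(1) unfolding Z_def by blast+
    ultimately show ?thesis by blast
  qed
  show ?thesis
    unfolding krull_dim_def
    by (rule SUP_upper) (use closedZ irredZ strict in blast)
qed

section \<open>An upper bound for the dimension\<close>

definition alg_indep :: "'p set \<Rightarrow> nat \<Rightarrow> (nat \<Rightarrow> 'p \<Rightarrow> 'k::field) \<Rightarrow> bool" where
  "alg_indep X r g \<longleftrightarrow> (\<forall>F\<in>poly_funs r. (\<forall>q\<in>X. F (\<lambda>i. g i q) = 0) \<longrightarrow> (\<forall>y. F y = 0))"

lemma poly_fams_subst:
  assumes "P \<in> poly_fams m" "\<And>i. i \<in> {1..m} \<Longrightarrow> \<phi> i \<in> poly_funs n"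
  shows "(\<lambda>q. P (\<lambda>i. \<phi> i q)) \<in> poly_fams n"
  using assms(1)
proof induction
  case zero
  show ?case by (rule poly_fams.zero)
next
  case (pCons c P)
  show ?case by (rule poly_fams.pCons[OF poly_funs_subst[OF pCons(1) assms(2)] pCons(3)])
qed

lemma irreducible_in_mult:
  assumes irr: "irreducible_in (subtopology (zariski n) X) Z"
    and f: "f \<in> poly_funs n" and g: "g \<in> poly_funs n" and fg: "\<And>q. q \<in> Z \<Longrightarrow> f q * g q = 0"
  shows "(\<forall>q\<in>Z. f q = 0) \<or> (\<forall>q\<in>Z. g q = 0)"
proof -
  have ZX: "Z \<subseteq> affine_space n \<inter> X"
    using irr unfolding irreducible_in_def topspace_subtopology topspace_zariski by blast
  have closed: "closedin (subtopology (zariski n) X) (zero_locus n {h} \<inter> X)"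
    if "h \<in> poly_funs n" for h
    unfolding closedin_subtopology closedin_zariski
    using that by (intro exI[of _ "zero_locus n {h}"] conjI refl exI[of _ "{h}"]) auto
  have "Z \<subseteq> (zero_locus n {f} \<inter> X) \<union> (zero_locus n {g} \<inter> X)"
    using ZX fg unfolding zero_locus_def by fastforce
  then have "Z \<subseteq> zero_locus n {f} \<inter> X \<or> Z \<subseteq> zero_locus n {g} \<inter> X"
    using irr closed[OF f] closed[OF g] unfolding irreducible_in_def by blast
  then show ?thesis unfolding zero_locus_def by blast
qed

text \<open>
  Let \<open>h\<close> vanish on the smaller set but not on the larger one. In a relation between \<open>g\<close> and \<open>h\<close>
  on the larger set the part free of \<open>h\<close> is a relation between the \<open>g\<close> on the smaller set,
  hence trivial, and by irreducibility \<open>h\<close> can be cancelled.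
\<close>
lemma alg_indep_extend:
  fixes Z Z' :: "(nat \<Rightarrow> 'k::field) set"
  assumes irr: "irreducible_in (subtopology (zariski n) X) Z'" and sub: "Z \<subseteq> Z'"
    and g: "\<And>i. i \<in> {1..r} \<Longrightarrow> g i \<in> poly_funs n" and indep: "alg_indep Z r g"
    and h: "h \<in> poly_funs n" "\<And>q. q \<in> Z \<Longrightarrow> h q = 0" "q0 \<in> Z'" "h q0 \<noteq> 0"
  shows "alg_indep Z' (Suc r) (g(Suc r := h))"
  unfolding alg_indep_def
proof (intro ballI impI allI)
  have strip: "\<forall>y. P y = 0"
    if "P \<in> poly_fams r" "\<And>q. q \<in> Z' \<Longrightarrow> poly (P (\<lambda>i. g i q)) (h q) = 0" for P
    using that
  proof induction
    case (pCons c P)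
    have "c (\<lambda>i. g i q) = 0" if "q \<in> Z" for q
      using pCons.prems[of q] that sub h(2)[OF that] by auto
    then have c: "c y = 0" for y using indep pCons.hyps unfolding alg_indep_def by blast
    have "(\<lambda>q. poly (P (\<lambda>i. g i q)) (h q)) \<in> poly_funs n"
      by (rule poly_fams_eval[OF poly_fams_subst[OF pCons.hyps(2) g] h(1)])
    moreover have "h q * poly (P (\<lambda>i. g i q)) (h q) = 0" if "q \<in> Z'" for q
      using pCons.prems[OF that] c by simp
    ultimately have "\<forall>q\<in>Z'. poly (P (\<lambda>i. g i q)) (h q) = 0"
      using irreducible_in_mult[OF irr h(1)] h(3,4) by blast
    then show ?case using pCons.IH c by simp
  qed simp
  fix F y assume F: "F \<in> poly_funs (Suc r)" "\<forall>q\<in>Z'. F (\<lambda>i. (g(Suc r := h)) i q) = 0"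
  obtain P where P: "P \<in> poly_fams r" "\<And>y. F y = poly (P y) (y (Suc r))"
    using poly_funs_Suc_fam[OF F(1)] by blast
  have "P (\<lambda>i. (g(Suc r := h)) i q) = P (\<lambda>i. g i q)" for q
    by (rule poly_fams_cong[OF P(1)]) auto
  then have "poly (P (\<lambda>i. g i q)) (h q) = 0" if "q \<in> Z'" for q
    using F(2)[unfolded P(2)] that by fastforce
  then show "F y = 0" using strip[OF P(1)] P(2) by simp
qed

text \<open>Each step of a chain contributes one more independent function.\<close>
lemma chain_alg_indep:
  fixes Z :: "nat \<Rightarrow> (nat \<Rightarrow> 'k::field) set"
  assumes "\<And>i. i \<le> r \<Longrightarrow> closedin (subtopology (zariski n) X) (Z i)"
    and "\<And>i. i \<le> r \<Longrightarrow> irreducible_in (subtopology (zariski n) X) (Z i)"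
    and "\<And>i. i < r \<Longrightarrow> Z i \<subset> Z (Suc i)"
  shows "\<exists>g. (\<forall>i\<in>{1..r}. g i \<in> poly_funs n) \<and> alg_indep (Z r) r g"
  using assms
proof (induction r)
  case 0
  obtain q where q: "q \<in> Z 0" using 0(2)[of 0] unfolding irreducible_in_def by auto
  have "F y = 0" if "F \<in> poly_funs 0" "\<forall>q\<in>Z 0. F (\<lambda>i. g i q) = 0" for F y and g ::
      "nat \<Rightarrow> (nat \<Rightarrow> 'k) \<Rightarrow> 'k"
    using poly_funs_cong[OF that(1), of y "\<lambda>i. g i q"] that(2) q by auto
  then show ?case unfolding alg_indep_def by auto
next
  case (Suc r)
  obtain g where g: "\<forall>i\<in>{1..r}. g i \<in> poly_funs n" "alg_indep (Z r) r g"
    using Suc.IH Suc.prems by (metis le_SucI less_SucI)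
  have ss: "Z r \<subset> Z (Suc r)" using Suc.prems(3) by simp
  obtain F where F: "F \<subseteq> poly_funs n" "Z r = zero_locus n F \<inter> X"
    using Suc.prems(1)[of r] unfolding closedin_subtopology closedin_zariski by auto
  obtain q where q: "q \<in> Z (Suc r)" "q \<notin> Z r" using ss by blast
  have "q \<in> affine_space n \<inter> X"
    using Suc.prems(2)[of "Suc r"] q(1)
    unfolding irreducible_in_def topspace_subtopology topspace_zariski by blast
  then obtain h where h: "h \<in> F" "h q \<noteq> 0" using q(2) unfolding F(2) zero_locus_def by blast
  have "alg_indep (Z (Suc r)) (Suc r) (g(Suc r := h))"
  proof (rule alg_indep_extend[where Z = "Z r" and ?q0.0 = q and n = n and X = X])
    show "h x = 0" if "x \<in> Z r" for x using that h(1) unfolding F(2) zero_locus_def by blast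
  qed (use ss g F h q Suc.prems(2)[OF order_refl] in auto)
  moreover have "\<forall>i\<in>{1..Suc r}. (g(Suc r := h)) i \<in> poly_funs n"
    using g(1) F(1) h(1) by (auto simp: le_Suc_eq)
  ultimately show ?case by blast
qed

interpretation fun_vs: vector_space "\<lambda>(c::'k::field) (f :: 'p \<Rightarrow> 'k) x. c * f x"
  by standard (auto simp: fun_eq_iff algebra_simps)

lemma sum_fun_apply: "(\<Sum>x\<in>A. F x) t = (\<Sum>x\<in>A. F x t :: 'k::comm_monoid_add)"
  by (induction A rule: infinite_finite_induct) simp_all

lemma card_le_span:
  fixes \<psi> :: "nat \<Rightarrow> 'p \<Rightarrow> 'k::field"
  assumes S: "finite S" and span: "\<And>m. m < M \<Longrightarrow> \<psi> m \<in> fun_vs.span S"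
    and indep: "\<And>c. (\<And>t. (\<Sum>m<M. c m * \<psi> m t) = 0) \<Longrightarrow> (\<And>m. m < M \<Longrightarrow> c m = 0)"
  shows "M \<le> card S"
proof -
  have inj: "inj_on \<psi> {..<M}"
  proof (rule inj_onI, rule ccontr)
    fix a b assume ab: "a \<in> {..<M}" "b \<in> {..<M}" "\<psi> a = \<psi> b" "a \<noteq> b"
    define c where "c = (\<lambda>m. if m = a then 1 else if m = b then - 1 else 0 :: 'k)"
    have "(\<Sum>m<M. c m * \<psi> m t) = 0" for t
    proof -
      have "(\<Sum>m<M. c m * \<psi> m t) = (\<Sum>m\<in>{a, b}. c m * \<psi> m t)"
        by (rule sum.mono_neutral_right) (use ab in \<open>auto simp: c_def\<close>)
      also have "\<dots> = 0" using ab by (simp add: c_def)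
      finally show ?thesis .
    qed
    then have "c a = 0" using indep[of c a] ab(1) by simp
    then show False by (simp add: c_def)
  qed
  have "fun_vs.independent (\<psi> ` {..<M})"
  proof (rule fun_vs.independent_if_scalars_zero)
    fix f x assume sum: "(\<Sum>x\<in>\<psi> ` {..<M}. (\<lambda>t. f x * x t)) = 0" and x: "x \<in> \<psi> ` {..<M}"
    have "(\<Sum>m<M. f (\<psi> m) * \<psi> m t) = 0" for t
    proof -
      have "(\<Sum>m<M. f (\<psi> m) * \<psi> m t) = (\<Sum>x\<in>\<psi> ` {..<M}. f x * x t)"
        by (simp add: sum.reindex[OF inj])
      also have "\<dots> = (\<Sum>x\<in>\<psi> ` {..<M}. (\<lambda>t. f x * x t)) t"
        by (simp add: sum_fun_apply)
      finally show ?thesis using sum by simp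
    qed
    then show "f x = 0" using indep[of "\<lambda>m. f (\<psi> m)"] x by auto
  qed simp
  then have "card (\<psi> ` {..<M}) \<le> card S"
    using fun_vs.independent_span_bound[OF S] span by blast
  then show ?thesis using card_image[OF inj] by simp
qed

lemma poly_eq_sum_atMost:
  "degree p \<le> e \<Longrightarrow> poly p x = (\<Sum>i\<le>e. coeff p i * x ^ i :: 'k::comm_semiring_1)"
  unfolding poly_altdef by (intro sum.mono_neutral_left) (auto simp: coeff_eq_0)

lemma digit_sum:
  fixes m B :: nat
  shows "(\<Sum>i = 1..r. (m div B ^ (i - 1) mod B) * B ^ (i - 1)) = m mod B ^ r"
proof (induction r)
  case (Suc r)
  have "m mod (B ^ r * B) = B ^ r * (m div B ^ r mod B) + m mod B ^ r" by (rule mod_mult2_eq)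
  then show ?case using Suc by (simp add: mult.commute)
qed simp

text \<open>
  Kronecker substitution \<open>y\<^sub>i = z ^ B ^ (i - 1)\<close>: the monomials with exponents below \<open>B\<close> become the
  powers of \<open>z\<close> below \<open>B ^ r\<close>, the exponents being the digits in base \<open>B\<close>.
\<close>
lemma kronecker_monomials_independent:
  fixes c :: "nat \<Rightarrow> 'k::field_char_0"
  assumes "\<And>y. (\<Sum>m<B ^ r. c m * (\<Prod>i = 1..r. y i ^ (m div B ^ (i - 1) mod B))) = 0" and m: "m < B ^ r"
  shows "c m = 0"
proof -
  let ?p = "\<Sum>m<B ^ r. monom (c m) m"
  have "poly ?p z = 0" for z
  proof -
    have "(\<Prod>i = 1..r. (z ^ B ^ (i - 1)) ^ (m div B ^ (i - 1) mod B)) = z ^ m" if "m < B ^ r" for m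
    proof -
      have "(\<Prod>i = 1..r. (z ^ B ^ (i - 1)) ^ (m div B ^ (i - 1) mod B)) =
          z ^ (\<Sum>i = 1..r. (m div B ^ (i - 1) mod B) * B ^ (i - 1))"
        by (simp add: power_sum mult.commute flip: power_mult)
      then show ?thesis using that digit_sum[of m B r] by simp
    qed
    then show ?thesis using assms(1)[of "\<lambda>i. z ^ B ^ (i - 1)"]
      by (simp add: poly_sum poly_monom)
  qed
  then have "?p = 0" using poly_all_0_iff_0 by blast
  then have "coeff ?p m = 0" by simp
  then show ?thesis using m by (simp add: coeff_sum)
qed


lemma span_image_mult:
  fixes \<phi> :: "'p \<Rightarrow> 'k::field"
  assumes "\<And>s. s \<in> S \<Longrightarrow> (\<lambda>t. \<phi> t * s t) \<in> fun_vs.span S'" "f \<in> fun_vs.span S"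
  shows "(\<lambda>t. \<phi> t * f t) \<in> fun_vs.span S'"
  using assms(2)
proof (induction rule: fun_vs.span_induct_alt)
  case base
  then show ?case using fun_vs.span_zero by (simp add: zero_fun_def)
next
  case (step c x y)
  have "(\<lambda>t. c * (\<phi> t * x t)) + (\<lambda>t. \<phi> t * y t) \<in> fun_vs.span S'"
    by (intro fun_vs.span_add fun_vs.span_scale assms(1) step)
  moreover have "(\<lambda>t. c * (\<phi> t * x t)) + (\<lambda>t. \<phi> t * y t) = (\<lambda>t. \<phi> t * ((\<lambda>t. c * x t) + y) t)"
    by (auto simp: algebra_simps)
  ultimately show ?case by simp
qed

text \<open>
  Let all coordinates \<open>x j\<close> be integral over the \<open>s\<close> parameters \<open>a i\<close>. Polynomial functions of \<open>x\<close>
  of degree at most \<open>D\<close> then lie in the span of the monomials \<open>x^\<epsilon> * a^b\<close> with bounded \<open>\<epsilon>\<close> and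
  \<open>b = O(D)\<close>, a space of dimension \<open>O(D ^ s)\<close>, whereas \<open>r\<close> independent functions produce about
  \<open>D ^ r\<close> independent monomials; hence \<open>r \<le> s\<close>. Denominators are harmless, since one power of
  the unit \<open>\<delta>\<close> clears those of all monomials of bounded degree.
\<close>
theorem alg_indep_le_parameters:
  fixes T :: "((nat \<Rightarrow> 'k::field_char_0) \<times> (nat \<Rightarrow> 'k)) set"
  assumes e: "e > 0"
    and G: "\<And>j. j \<in> {1..n} \<Longrightarrow> G j \<in> poly_fams s"
    and monic: "\<And>j a. j \<in> {1..n} \<Longrightarrow> coeff (G j a) e = 1"
    and deg: "\<And>j a i. j \<in> {1..n} \<Longrightarrow> i > e \<Longrightarrow> coeff (G j a) i = 0"
    and root: "\<And>a x j. (a, x) \<in> T \<Longrightarrow> j \<in> {1..n} \<Longrightarrow> poly (G j a) (x j) = 0"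
    and \<delta>: "\<delta> \<in> poly_funs n" and \<delta>T: "\<And>a x. (a, x) \<in> T \<Longrightarrow> \<delta> x \<noteq> 0"
    and \<phi>: "\<And>i. i \<in> {1..r} \<Longrightarrow> \<phi> i \<in> regular_funs n \<delta>"
    and indep: "alg_indep T r (\<lambda>i t. \<phi> i (snd t))"
  shows "r \<le> s"
proof -
  \<comment> \<open>functions on \<open>T\<close> are extended by \<open>0\<close>, so that relations on \<open>T\<close> become equations\<close>
  define mon where "mon = (\<lambda>(\<epsilon> :: nat \<Rightarrow> nat, b :: nat \<Rightarrow> nat) t. if t \<in> T
    then (\<Prod>j = 1..n. snd t j ^ \<epsilon> j) * (\<Prod>i = 1..s. fst t i ^ b i) else 0)"
  define Exp where "Exp = (\<lambda>k. ({1..n} \<rightarrow>\<^sub>E {..<e}) \<times> ({1..s} \<rightarrow>\<^sub>E {..k::nat}))"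
  define V where "V = (\<lambda>k. fun_vs.span (mon ` Exp k))"
  have Vmono: "V k \<subseteq> V l" if "k \<le> l" for k l
  proof -
    have "Exp k \<subseteq> Exp l" unfolding Exp_def using that by (intro Sigma_mono PiE_mono) auto
    then show ?thesis unfolding V_def by (intro fun_vs.span_mono image_mono)
  qed
  have VT: "f t = 0" if f: "f \<in> V k" and t: "t \<notin> T" for f t k
    using f unfolding V_def
    by (induction rule: fun_vs.span_induct_alt) (use t in \<open>auto simp: mon_def\<close>)
  \<comment> \<open>multiplication by \<open>\<phi>\<close> raises the exponents of the parameters by at most \<open>C\<close>\<close>
  define tame where "tame = (\<lambda>C \<phi>. \<forall>k. \<forall>f\<in>V k. (\<lambda>t. \<phi> t * f t) \<in> V (k + C))"
  have tameD: "(\<lambda>t. \<phi> t * f t) \<in> V (k + C)" if "tame C \<phi>" "f \<in> V k" for C \<phi> f k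
    using that unfolding tame_def by blast
  have tame_mono: "tame D \<phi>" if "tame C \<phi>" "C \<le> D" for C D \<phi>
    unfolding tame_def using tameD[OF that(1)] Vmono that(2) by (meson add_le_cancel_left subsetD)
  have tame_cong: "tame C \<psi>" if "tame C \<phi>" "\<And>t. t \<in> T \<Longrightarrow> \<phi> t = \<psi> t" for C \<phi> \<psi>
    unfolding tame_def
  proof (intro allI ballI)
    fix k f assume f: "f \<in> V k"
    have "(\<lambda>t. \<psi> t * f t) = (\<lambda>t. \<phi> t * f t)" using that(2) VT[OF f] by fastforce
    then show "(\<lambda>t. \<psi> t * f t) \<in> V (k + C)" using tameD[OF that(1) f] by simp
  qed
  have tame_basis: "tame C \<phi>"
    if B: "\<And>k \<epsilon> b. \<epsilon> \<in> {1..n} \<rightarrow>\<^sub>E {..<e} \<Longrightarrow> b \<in> {1..s} \<rightarrow>\<^sub>E {..k} \<Longrightarrow> (\<lambda>t. \<phi> t * mon (\<epsilon>, b) t) \<in> V (k + C)"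
    for C \<phi>
    unfolding tame_def V_def
  proof (intro allI ballI)
    fix k f assume f: "f \<in> fun_vs.span (mon ` Exp k)"
    show "(\<lambda>t. \<phi> t * f t) \<in> fun_vs.span (mon ` Exp (k + C))"
      by (rule span_image_mult[OF _ f]) (use B in \<open>auto simp: Exp_def V_def\<close>)
  qed
  have tame_const: "tame 0 (\<lambda>t. c)" for c
    unfolding tame_def V_def using fun_vs.span_scale by auto
  have tame_add: "tame (C + D) (\<lambda>t. \<phi> t + \<psi> t)" if "tame C \<phi>" "tame D \<psi>" for C D \<phi> \<psi>
    unfolding tame_def
  proof (intro allI ballI)
    fix k f assume f: "f \<in> V k"
    have "(\<lambda>t. \<phi> t * f t) + (\<lambda>t. \<psi> t * f t) \<in> V (k + (C + D))"
      using tameD[OF tame_mono[OF that(1), of "C + D"] f] tameD[OF tame_mono[OF that(2), of "C + D"] f]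
      unfolding V_def by (intro fun_vs.span_add) auto
    moreover have "(\<lambda>t. \<phi> t * f t) + (\<lambda>t. \<psi> t * f t) = (\<lambda>t. (\<phi> t + \<psi> t) * f t)"
      by (auto simp: algebra_simps)
    ultimately show "(\<lambda>t. (\<phi> t + \<psi> t) * f t) \<in> V (k + (C + D))" by simp
  qed
  have tame_mult: "tame (C + D) (\<lambda>t. \<phi> t * \<psi> t)" if "tame C \<phi>" "tame D \<psi>" for C D \<phi> \<psi>
    unfolding tame_def
  proof (intro allI ballI)
    fix k f assume "f \<in> V k"
    from tameD[OF that(1) tameD[OF that(2) this]]
    show "(\<lambda>t. \<phi> t * \<psi> t * f t) \<in> V (k + (C + D))" by (simp add: ac_simps)
  qed
  have tame_power: "tame (m * C) (\<lambda>t. \<phi> t ^ m)" if "tame C \<phi>" for C \<phi> m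
  proof (induction m)
    case 0
    show ?case using tame_const[of 1] by simp
  next
    case (Suc m)
    show ?case using tame_mult[OF that Suc] by simp
  qed
  have tame_prod: "tame (card A * C) (\<lambda>t. \<Prod>i\<in>A. \<psi> i t)"
    if "finite A" "\<And>i. i \<in> A \<Longrightarrow> tame C (\<psi> i)" for A :: "nat set" and C \<psi>
    using that
  proof (induction A rule: finite_induct)
    case empty
    show ?case using tame_const[of 1] by simp
  next
    case (insert i A)
    show ?case using tame_mult[of C "\<psi> i" "card A * C"] insert by simp
  qed
  have tame_poly: "\<exists>C. tame C (\<lambda>t. F (z t))"
    if F: "F \<in> poly_funs m" and z: "\<And>i. i \<in> {1..m} \<Longrightarrow> \<exists>C. tame C (\<lambda>t. z t i)" for F m z
    using F
  proof induction
    case (const c)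
    show ?case using tame_const by blast
  next
    case (coord i)
    then show ?case by (rule z)
  next
    case (add f g)
    then show ?case using tame_add by blast
  next
    case (mult f g)
    then show ?case using tame_mult by blast
  qed
  have tame_param: "tame 1 (\<lambda>t. fst t i)" if i: "i \<in> {1..s}" for i
  proof (rule tame_basis)
    fix k :: nat and \<epsilon> b :: "nat \<Rightarrow> nat" assume \<epsilon>: "\<epsilon> \<in> {1..n} \<rightarrow>\<^sub>E {..<e}" and b: "b \<in> {1..s} \<rightarrow>\<^sub>E {..k}"
    let ?b = "b(i := Suc (b i))"
    have "(\<epsilon>, ?b) \<in> Exp (k + 1)"
      unfolding Exp_def using \<epsilon> b i by (auto simp: PiE_iff extensional_def intro: le_SucI)
    moreover have "(\<lambda>t. fst t i * mon (\<epsilon>, b) t) = mon (\<epsilon>, ?b)"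
    proof
      fix t :: "(nat \<Rightarrow> 'k) \<times> (nat \<Rightarrow> 'k)"
      have "(\<Prod>j = 1..s. fst t j ^ ?b j) = fst t i * (\<Prod>j = 1..s. fst t j ^ b j)"
      proof -
        have "(\<Prod>j = 1..s. fst t j ^ ?b j) = fst t i ^ ?b i * (\<Prod>j\<in>{1..s} - {i}. fst t j ^ ?b j)"
          using i by (intro prod.remove) auto
        also have "(\<Prod>j\<in>{1..s} - {i}. fst t j ^ ?b j) = (\<Prod>j\<in>{1..s} - {i}. fst t j ^ b j)"
          by (intro prod.cong) auto
        also have "fst t i ^ ?b i * \<dots> = fst t i * (fst t i ^ b i * \<dots>)" by (simp add: mult.assoc)
        also have "fst t i ^ b i * (\<Prod>j\<in>{1..s} - {i}. fst t j ^ b j) = (\<Prod>j = 1..s. fst t j ^ b j)"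
          using i by (intro prod.remove[symmetric]) auto
        finally show ?thesis .
      qed
      then show "fst t i * mon (\<epsilon>, b) t = mon (\<epsilon>, ?b) t" unfolding mon_def by (simp add: ac_simps)
    qed
    ultimately show "(\<lambda>t. fst t i * mon (\<epsilon>, b) t) \<in> V (k + 1)"
      unfolding V_def by (simp add: fun_vs.span_base)
  qed
  have tame_x: "\<exists>C. tame C (\<lambda>t. snd t j)" if j: "j \<in> {1..n}" for j
  proof -
    have "\<exists>C. tame C (\<lambda>t. - coeff (G j (fst t)) i)" for i
      by (rule tame_poly[OF poly_funs_uminus[OF poly_fams_coeff[OF G[OF j]]]])
        (rule exI, rule tame_param)
    then obtain c where c: "\<And>i. tame (c i) (\<lambda>t. - coeff (G j (fst t)) i)" by metis
    define C where "C = (\<Sum>i<e. c i)"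
    have cC: "tame C (\<lambda>t. - coeff (G j (fst t)) i)" if "i < e" for i
      by (rule tame_mono[OF c]) (use that in \<open>auto simp: C_def intro: member_le_sum\<close>)
    have "tame C (\<lambda>t. snd t j)"
    proof (rule tame_basis)
      fix k :: nat and \<epsilon> b :: "nat \<Rightarrow> nat" assume \<epsilon>: "\<epsilon> \<in> {1..n} \<rightarrow>\<^sub>E {..<e}" and b: "b \<in> {1..s} \<rightarrow>\<^sub>E {..k}"
      have upd: "mon (\<epsilon>(j := i), b) \<in> V k" if "i < e" for i
        unfolding V_def Exp_def using \<epsilon> b j that
        by (intro fun_vs.span_base imageI SigmaI PiE_fun_upd[of j, unfolded insert_absorb[OF j]]) auto
      have split: "(\<Prod>l = 1..n. snd t l ^ (\<epsilon>(j := i)) l) = snd t j ^ i * (\<Prod>l\<in>{1..n} - {j}. snd t l ^ \<epsilon> l)"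
        for t :: "(nat \<Rightarrow> 'k) \<times> (nat \<Rightarrow> 'k)" and i
      proof -
        have "(\<Prod>l = 1..n. snd t l ^ (\<epsilon>(j := i)) l) =
            snd t j ^ (\<epsilon>(j := i)) j * (\<Prod>l\<in>{1..n} - {j}. snd t l ^ (\<epsilon>(j := i)) l)"
          using j by (intro prod.remove) auto
        also have "(\<Prod>l\<in>{1..n} - {j}. snd t l ^ (\<epsilon>(j := i)) l) = (\<Prod>l\<in>{1..n} - {j}. snd t l ^ \<epsilon> l)"
          by (intro prod.cong) auto
        finally show ?thesis by simp
      qed
      have \<epsilon>j: "\<epsilon>(j := \<epsilon> j) = \<epsilon>" by simp
      have shift: "snd t j * mon (\<epsilon>, b) t = (if t \<in> T then snd t j ^ Suc (\<epsilon> j) *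
          (\<Prod>l\<in>{1..n} - {j}. snd t l ^ \<epsilon> l) * (\<Prod>i = 1..s. fst t i ^ b i) else 0)" for t
        using split[of t "\<epsilon> j"] unfolding mon_def \<epsilon>j by simp
      have mon_upd: "mon (\<epsilon>(j := i), b) t = (if t \<in> T then snd t j ^ i *
          (\<Prod>l\<in>{1..n} - {j}. snd t l ^ \<epsilon> l) * (\<Prod>i = 1..s. fst t i ^ b i) else 0)" for t i
        using split[of t i] unfolding mon_def by simp
      have "\<epsilon> j < e" using \<epsilon> j by (auto simp: PiE_iff)
      then consider "Suc (\<epsilon> j) < e" | "Suc (\<epsilon> j) = e" by linarith
      then show "(\<lambda>t. snd t j * mon (\<epsilon>, b) t) \<in> V (k + C)"
      proof cases
        case 1
        have "(\<lambda>t. snd t j * mon (\<epsilon>, b) t) = mon (\<epsilon>(j := Suc (\<epsilon> j)), b)"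
          unfolding fun_eq_iff shift mon_upd by simp
        then show ?thesis using upd[OF 1] Vmono[of k "k + C"] by auto
      next
        case 2
        have "(\<lambda>t. snd t j * mon (\<epsilon>, b) t) =
            (\<Sum>i<e. (\<lambda>t. - coeff (G j (fst t)) i * mon (\<epsilon>(j := i), b) t))"
        proof
          fix t :: "(nat \<Rightarrow> 'k) \<times> (nat \<Rightarrow> 'k)"
          show "snd t j * mon (\<epsilon>, b) t = (\<Sum>i<e. (\<lambda>t. - coeff (G j (fst t)) i * mon (\<epsilon>(j := i), b) t)) t"
          proof (cases "t \<in> T")
            case True
            have "degree (G j (fst t)) \<le> e" using deg[OF j] by (intro degree_le) auto
            then have "poly (G j (fst t)) (snd t j) = (\<Sum>i\<le>e. coeff (G j (fst t)) i * snd t j ^ i)"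
              by (rule poly_eq_sum_atMost)
            also have "\<dots> = snd t j ^ e + (\<Sum>i<e. coeff (G j (fst t)) i * snd t j ^ i)"
              using monic[OF j] by (simp add: lessThan_Suc_atMost[symmetric])
            finally have "snd t j ^ e = (\<Sum>i<e. - coeff (G j (fst t)) i * snd t j ^ i)"
              using root[of "fst t" "snd t" j] True j by (simp add: sum_negf eq_neg_iff_add_eq_0)
            then have "snd t j ^ e * p * q = (\<Sum>i<e. - coeff (G j (fst t)) i * (snd t j ^ i * p *
                q))" for p q
              by (simp only: sum_distrib_right mult.assoc)
            then show ?thesis
              unfolding sum_fun_apply shift mon_upd 2 if_P[OF True] .
          qed (simp add: sum_fun_apply mon_def)
        qed
        also have "\<dots> \<in> V (k + C)"
          unfolding V_def using tameD[OF cC upd] by (intro fun_vs.span_sum) (auto simp: V_def)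
        finally show ?thesis .
      qed
    qed
    then show ?thesis by blast
  qed
  have "\<exists>k g. g \<in> poly_funs n \<and> (\<forall>q. \<delta> q \<noteq> 0 \<longrightarrow> \<phi> i q * \<delta> q ^ k = g q)" if "i \<in> {1..r}" for i
    using \<phi>[OF that] unfolding regular_funs_def by blast
  then obtain K g where g: "\<And>i. i \<in> {1..r} \<Longrightarrow> g i \<in> poly_funs n"
    "\<And>i q. i \<in> {1..r} \<Longrightarrow> \<delta> q \<noteq> 0 \<Longrightarrow> \<phi> i q * \<delta> q ^ K i = g i q"
    by metis
  have "\<exists>C. tame C (\<lambda>t. g i (snd t)) \<and> tame C (\<lambda>t. \<delta> (snd t) ^ K i)" if i: "i \<in> {1..r}" for i
  proof -
    have "\<exists>C. tame C (\<lambda>t. g i (snd t))" by (rule tame_poly[OF g(1)[OF i] tame_x])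
    then obtain C where C: "tame C (\<lambda>t. g i (snd t))" by (elim exE)
    have "\<exists>D. tame D (\<lambda>t. \<delta> (snd t) ^ K i)" by (rule tame_poly[OF poly_funs_power[OF \<delta>] tame_x])
    then obtain D where D: "tame D (\<lambda>t. \<delta> (snd t) ^ K i)" by (elim exE)
    have "tame (C + D) (\<lambda>t. g i (snd t))" "tame (C + D) (\<lambda>t. \<delta> (snd t) ^ K i)"
      by (rule tame_mono[OF C] tame_mono[OF D], simp)+
    then show ?thesis by blast
  qed
  then obtain c where c: "\<And>i. i \<in> {1..r} \<Longrightarrow> tame (c i) (\<lambda>t. g i (snd t))"
    "\<And>i. i \<in> {1..r} \<Longrightarrow> tame (c i) (\<lambda>t. \<delta> (snd t) ^ K i)"
    by metis
  define C where "C = (\<Sum>i = 1..r. c i)"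
  have C: "tame C (\<lambda>t. g i (snd t))" "tame C (\<lambda>t. \<delta> (snd t) ^ K i)" if "i \<in> {1..r}" for i
    by (rule tame_mono[OF c(1)[OF that]] tame_mono[OF c(2)[OF that]],
        use that in \<open>auto simp: C_def intro: member_le_sum\<close>)+
  have count: "B ^ r \<le> e ^ n * Suc (r * ((B - 1) * C)) ^ s" if B: "B > 0" for B :: nat
  proof -
    define \<beta> where "\<beta> = (\<lambda>m i. m div B ^ (i - 1) mod B :: nat)"
    have \<beta>: "\<beta> m i \<le> B - 1" for m i 
      using mod_less_divisor[OF B, of "m div B ^ (i - 1)"] unfolding \<beta>_def by linarith
    define one where "one = (\<lambda>t. if t \<in> T then 1 else 0 :: 'k)"
    have one: "one \<in> V 0"
    proof -
      have "one = mon (restrict (\<lambda>j. 0) {1..n}, restrict (\<lambda>j. 0) {1..s})"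
        unfolding one_def mon_def by (auto intro!: prod.neutral[symmetric] simp: fun_eq_iff)
      moreover have "(restrict (\<lambda>j. 0) {1..n}, restrict (\<lambda>j. 0) {1..s}) \<in> Exp 0"
        unfolding Exp_def using e by auto
      ultimately show ?thesis unfolding V_def by (auto intro: fun_vs.span_base)
    qed
    \<comment> \<open>the \<open>m\<close>-th monomial in the \<open>\<phi> i\<close>, times a power of \<open>\<delta>\<close> that does not depend on \<open>m\<close>\<close>
    define \<psi> where "\<psi> = (\<lambda>m t. (\<Prod>i = 1..r. g i (snd t) ^ \<beta> m i * (\<delta> (snd t) ^ K i) ^ (B - 1 - \<beta> m
        i)) * one t)"
    have \<psi>V: "\<psi> m \<in> V (r * ((B - 1) * C))" for m
    proof -
      have "tame ((B - 1) * C) (\<lambda>t. g i (snd t) ^ \<beta> m i * (\<delta> (snd t) ^ K i) ^ (B - 1 - \<beta> m i))"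
        if i: "i \<in> {1..r}" for i
      proof -
        have "\<beta> m i * C + (B - 1 - \<beta> m i) * C = (B - 1) * C"
          using le_add_diff_inverse[OF \<beta>[of m i]] by (metis add_mult_distrib)
        then show ?thesis
          using tame_mult[OF tame_power[OF C(1)[OF i]] tame_power[OF C(2)[OF i]], of "\<beta> m i"
              "B - 1 - \<beta> m i"]
          by (simp only:)
      qed
      then have "tame (card {1..r} * ((B - 1) * C))
          (\<lambda>t. \<Prod>i = 1..r. g i (snd t) ^ \<beta> m i * (\<delta> (snd t) ^ K i) ^ (B - 1 - \<beta> m i))"
        by (intro tame_prod) auto
      from tameD[OF this one] show ?thesis unfolding \<psi>_def by simp
    qed
    have "B ^ r \<le> card (mon ` Exp (r * ((B - 1) * C)))"
    proof (rule card_le_span)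
      show "finite (mon ` Exp (r * ((B - 1) * C)))"
        unfolding Exp_def by (intro finite_imageI finite_cartesian_product finite_PiE) auto
      show "\<psi> m \<in> fun_vs.span (mon ` Exp (r * ((B - 1) * C)))" for m using \<psi>V[of m] unfolding V_def .
      fix a m assume a: "\<And>t. (\<Sum>m<B ^ r. a m * \<psi> m t) = 0" and m: "m < B ^ r"
      define F where "F = (\<lambda>y. \<Sum>m<B ^ r. a m * (\<Prod>i = 1..r. y i ^ \<beta> m i))"
      have F: "F \<in> poly_funs r" unfolding F_def
        by (intro poly_funs_sum poly_funs.mult poly_funs.const poly_funs_prod poly_funs_power
            poly_funs.coord)
      have "F (\<lambda>i. \<phi> i (snd t)) = 0" if t: "t \<in> T" for t
      proof -
        have \<delta>t: "\<delta> (snd t) \<noteq> 0" using \<delta>T[of "fst t" "snd t"] t by simp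
        let ?\<Delta> = "\<Prod>i = 1..r. (\<delta> (snd t) ^ K i) ^ (B - 1)"
        have "\<psi> m t = ?\<Delta> * (\<Prod>i = 1..r. \<phi> i (snd t) ^ \<beta> m i)" for m
        proof -
          have "g i (snd t) ^ \<beta> m i * (\<delta> (snd t) ^ K i) ^ (B - 1 - \<beta> m i) =
              (\<delta> (snd t) ^ K i) ^ (B - 1) * \<phi> i (snd t) ^ \<beta> m i" if i: "i \<in> {1..r}" for i
          proof -
            have "(\<delta> (snd t) ^ K i) ^ (B - 1) = (\<delta> (snd t) ^ K i) ^ \<beta> m i * (\<delta> (snd t) ^ K i) ^ (B -
                1 - \<beta> m i)"
              by (simp only: power_add[symmetric] le_add_diff_inverse[OF \<beta>[of m i]])
            then show ?thesis
              unfolding g(2)[OF i \<delta>t, symmetric] power_mult_distrib by (simp only: ac_simps)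
          qed
          then show ?thesis using t unfolding \<psi>_def one_def by (simp flip: prod.distrib)
        qed
        then have "?\<Delta> * F (\<lambda>i. \<phi> i (snd t)) = 0"
          using a[of t] unfolding F_def by (simp add: sum_distrib_left ac_simps)
        moreover have "?\<Delta> \<noteq> 0" using \<delta>t by simp
        ultimately show ?thesis by (simp only: mult_eq_0_iff) blast
      qed
      then have "F y = 0" for y using indep F unfolding alg_indep_def by blast
      then show "a m = 0"
        by (intro kronecker_monomials_independent[where c = a and B = B and r = r] m)
          (simp add: F_def \<beta>_def)
    qed
    also have "\<dots> \<le> card (Exp (r * ((B - 1) * C)))"
      by (intro card_image_le) (auto simp: Exp_def intro!: finite_cartesian_product finite_PiE)
    also have "\<dots> = e ^ n * Suc (r * ((B - 1) * C)) ^ s"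
      unfolding Exp_def by (simp add: card_cartesian_product card_PiE)
    finally show ?thesis .
  qed
  show "r \<le> s"
  proof (rule ccontr)
    assume "\<not> r \<le> s"
    \<comment> \<open>larger than the constant in the estimate \<open>B ^ r \<le> const * B ^ s\<close>\<close>
    define B where "B = Suc (e ^ n * Suc (r * C) ^ s)"
    have "Suc (r * ((B - 1) * C)) \<le> Suc (r * C) * B"
    proof -
      have "r * ((B - 1) * C) \<le> r * C * B" by (simp add: mult.assoc mult.commute[of C])
      moreover have "1 \<le> B" unfolding B_def by simp
      ultimately show ?thesis unfolding mult_Suc by linarith
    qed
    then have "Suc (r * ((B - 1) * C)) ^ s \<le> (Suc (r * C) * B) ^ s" by (rule power_mono) simp
    then have "e ^ n * Suc (r * ((B - 1) * C)) ^ s \<le> e ^ n * Suc (r * C) ^ s * B ^ s"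
      by (simp add: power_mult_distrib mult.assoc del: mult_Suc)
    also have "\<dots> < B * B ^ s" unfolding B_def by (intro mult_strict_right_mono) auto
    also have "\<dots> \<le> B ^ r"
      using \<open>\<not> r \<le> s\<close> power_increasing[of "Suc s" r B] by (simp add: B_def)
    finally show False using count[of B] by (simp add: B_def)
  qed
qed

section \<open>Counting periodic points of a polynomial\<close>

text \<open>
  For a prime \<open>p\<close> dividing \<open>n\<close>, multiplication by \<open>p\<close> pairs the squarefree divisors prime to \<open>p\<close> with
  the other squarefree divisors, and it changes the sign of the Moebius function.
\<close>
lemma sum_moebius_divisors:
  assumes n: "n > 0"
  shows "(\<Sum>d | d dvd n. moebius_mu d) = (if n = 1 then 1 else 0)"
proof (cases "n = 1")
  case True
  then have "{d. d dvd n} = {1}" by auto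
  then show ?thesis using True by (simp add: moebius_mu_def)
next
  case False
  then obtain p where p: "prime p" "p dvd n" using prime_factor_nat by blast
  let ?A = "{d. d dvd n \<and> squarefree d \<and> \<not> p dvd d}"
  let ?B = "{d. d dvd n \<and> squarefree d \<and> p dvd d}"
  have fin: "finite {d. d dvd n}" using n by simp
  have cop: "coprime p d" if "d \<in> ?A" for d using that p(1) by (auto intro: prime_imp_coprime)
  have d0: "d \<noteq> 0" if "d \<in> ?A" for d using that n by auto
  have B: "?B = (*) p ` ?A"
  proof (intro equalityI subsetI)
    fix d assume d: "d \<in> ?B"
    then obtain e where e: "d = p * e" by blast
    have "\<not> p dvd e"
    proof
      assume "p dvd e"
      then have "p\<^sup>2 dvd d" unfolding e power2_eq_square by auto
      then have "p dvd 1" using d unfolding squarefree_def by blast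
      then show False using p(1) by simp
    qed
    moreover have "e dvd n" using d e by (auto intro: dvd_mult_right)
    moreover have "squarefree e" using d unfolding e by (blast intro: squarefree_mono dvd_triv_right)
    ultimately show "d \<in> (*) p ` ?A" using e by blast
  next
    fix d assume "d \<in> (*) p ` ?A"
    then obtain e where e: "e \<in> ?A" "d = p * e" by blast
    have "p * e dvd n" using e cop[OF e(1)] p(2) by (auto intro: divides_mult)
    moreover have "squarefree (p * e)"
      using cop[OF e(1)] e(1) squarefree_prime[OF p(1)] by (simp add: squarefree_mult_coprime)
    ultimately show "d \<in> ?B" using e by auto
  qed
  have neg: "moebius_mu (p * d) = - moebius_mu d" if d: "d \<in> ?A" for d
  proof -
    have "squarefree (p * d)"
      using cop[OF d] d squarefree_prime[OF p(1)] by (simp add: squarefree_mult_coprime)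
    moreover have "prime_factors (p * d) = insert p (prime_factors d)"
      using d0[OF d] p(1) by (simp add: prime_factors_product prime_factorization_prime)
    moreover have "p \<notin> prime_factors d" using d by auto
    ultimately show ?thesis using d by (simp add: moebius_mu_def)
  qed
  have "(\<Sum>d | d dvd n. moebius_mu d) = (\<Sum>d\<in>?A \<union> ?B. moebius_mu d)"
    by (rule sum.mono_neutral_right[OF fin]) (auto simp: moebius_mu_def)
  also have "\<dots> = (\<Sum>d\<in>?A. moebius_mu d) + (\<Sum>d\<in>?B. moebius_mu d)"
    by (rule sum.union_disjoint) (auto intro: finite_subset[OF _ fin])
  also have "(\<Sum>d\<in>?B. moebius_mu d) = (\<Sum>d\<in>?A. moebius_mu (p * d))"
    unfolding B using p(1) by (subst sum.reindex) (auto simp: inj_on_def)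
  also have "\<dots> = - (\<Sum>d\<in>?A. moebius_mu d)"
    by (simp add: neg sum_negf)
  finally show ?thesis using False by simp
qed

lemma dvd_div_pos: "m dvd k \<Longrightarrow> 0 < k \<Longrightarrow> 0 < k div (m :: nat)"
  by (auto elim!: dvdE)

lemma sum_divisors_flip:
  fixes h :: "nat \<Rightarrow> nat \<Rightarrow> 'a::comm_monoid_add"
  assumes "n > 0"
  shows "(\<Sum>d | d dvd n. h d (n div d)) = (\<Sum>d | d dvd n. h (n div d) d)"
  by (rule sum.reindex_bij_witness[of _ "\<lambda>d. n div d" "\<lambda>d. n div d"]) (use assms in auto)

lemma sum_moebius_codivisors:
  assumes "n > 0"
  shows "(\<Sum>d | d dvd n. moebius_mu (n div d)) = (if n = 1 then 1 else 0)"
  using sum_divisors_flip[OF assms, of "\<lambda>a b. moebius_mu b"] sum_moebius_divisors[OF assms] by simp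

lemma sum_divisors_multiples:
  fixes h :: "nat \<Rightarrow> 'a::comm_monoid_add"
  assumes n: "n > 0" and s: "s dvd n"
  shows "(\<Sum>d | d dvd n \<and> s dvd d. h d) = (\<Sum>i | i dvd n div s. h (s * i))"
proof -
  have s0: "s > 0" using n s by (auto intro: Nat.gr0I)
  show ?thesis
  proof (rule sum.reindex_bij_witness[of _ "\<lambda>i. s * i" "\<lambda>d. d div s"])
    fix d assume d: "d \<in> {d. d dvd n \<and> s dvd d}"
    then show "d div s \<in> {i. i dvd n div s}" using s s0 by (auto intro: div_dvd_div[THEN iffD2])
  next
    fix i assume i: "i \<in> {i. i dvd n div s}"
    then show "s * i \<in> {d. d dvd n \<and> s dvd d}" using s s0
      by (metis dvd_mult_div_cancel dvd_triv_left mem_Collect_eq mult_dvd_mono dvd_refl)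
  qed (use s0 in auto)
qed

definition exact_period :: "('a \<Rightarrow> 'a) \<Rightarrow> nat \<Rightarrow> 'a \<Rightarrow> bool" where
  "exact_period f k x \<longleftrightarrow> k > 0 \<and> (f ^^ k) x = x \<and> (\<forall>m. 0 < m \<and> m < k \<longrightarrow> (f ^^ m) x \<noteq> x)"

lemma funpow_mult_fixed: "(f ^^ m) x = x \<Longrightarrow> (f ^^ (m * i)) x = x"
  by (induction i) (simp_all add: funpow_add)

lemma exact_period_iff_dvd:
  assumes "exact_period f m x"
  shows "(f ^^ j) x = x \<longleftrightarrow> m dvd j"
proof
  assume j: "(f ^^ j) x = x"
  have "(f ^^ (j mod m + m * (j div m))) x = (f ^^ (j mod m)) x"
    unfolding funpow_add comp_apply using assms
    by (simp add: funpow_mult_fixed exact_period_def)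
  then have "(f ^^ (j mod m)) x = x" using j by simp
  moreover have "j mod m < m" using assms by (simp add: exact_period_def)
  ultimately show "m dvd j" using assms unfolding exact_period_def
      by (metis bot_nat_0.not_eq_extremum dvd_eq_mod_eq_0)
next
  assume "m dvd j"
  then show "(f ^^ j) x = x" using assms by (auto simp: funpow_mult_fixed exact_period_def)
qed

lemma ex_exact_period:
  assumes "(f ^^ j) x = x" "j > 0"
  shows "\<exists>m. exact_period f m x \<and> m dvd j"
proof -
  let ?P = "\<lambda>m. m > 0 \<and> (f ^^ m) x = x"
  define m where "m = (LEAST m. ?P m)"
  have "?P m" unfolding m_def by (rule LeastI[of ?P j]) (use assms in auto)
  moreover have "(f ^^ i) x \<noteq> x" if "0 < i" "i < m" for i
    using not_less_Least[of i ?P] that unfolding m_def by simp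
  ultimately have m: "exact_period f m x" unfolding exact_period_def by simp
  then show ?thesis using exact_period_iff_dvd[OF m, of j] assms(1) by (intro exI[of _ m]) simp
qed

definition poly_iter :: "'a::comm_semiring_1 poly \<Rightarrow> nat \<Rightarrow> 'a poly" where
  "poly_iter f k = (pcompose f ^^ k) [:0, 1:]"

lemma poly_iter_0 [simp]: "poly_iter f 0 = [:0, 1:]"
  and poly_iter_Suc [simp]: "poly_iter f (Suc k) = pcompose f (poly_iter f k)"
  by (simp_all add: poly_iter_def)

lemma poly_poly_iter: "poly (poly_iter f k) x = (poly f ^^ k) x"
  by (induction k) (simp_all add: poly_pcompose)

lemma degree_poly_iter: "degree (poly_iter f k) = degree (f :: 'a::idom poly) ^ k"
  by (induction k) (simp_all add: degree_pcompose)

lemma poly_iter_add: "poly_iter f (a + b) = pcompose (poly_iter f a) (poly_iter (f ::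
    'a::comm_ring_1 poly) b)"
  by (induction a) (simp_all add: pcompose_assoc pcompose_pCons)

lemma poly_iter_mult: "poly_iter f (m * i) = poly_iter (poly_iter (f :: 'a::comm_ring_1 poly) m) i"
  by (induction i) (simp_all add: poly_iter_add)

lemma poly_pderiv_iter_fixed:
  fixes f :: "'a::field_char_0 poly"
  assumes "poly f x = x"
  shows "poly (pderiv (poly_iter f i)) x = poly (pderiv f) x ^ i"
proof (induction i)
  case (Suc i)
  have "(poly f ^^ i) x = x" using funpow_mult_fixed[of 1 "poly f" x i] assms by simp
  then show ?case using Suc by (simp add: pderiv_pcompose poly_pcompose poly_poly_iter)
qed (simp add: pderiv_pCons)

lemma poly_iter_diff_nonzero:
  fixes f :: "'a::idom poly"
  assumes "degree f \<ge> 2" "j > 0"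
  shows "degree (poly_iter f j - [:0, 1:]) = degree f ^ j" "poly_iter f j - [:0, 1:] \<noteq> 0"
proof -
  have "degree f ^ 1 \<le> degree f ^ j" using assms by (intro power_increasing) auto
  then have "degree f ^ j \<ge> 2" using assms by simp
  then have "degree (poly_iter f j + - [:0, 1:]) = degree f ^ j"
    by (subst degree_add_eq_left) (auto simp: degree_poly_iter)
  then show "degree (poly_iter f j - [:0, 1:]) = degree f ^ j" by (simp only: diff_conv_add_uminus)
  then show "poly_iter f j - [:0, 1:] \<noteq> 0"
    using \<open>degree f ^ j \<ge> 2\<close> by (metis degree_0 not_numeral_le_zero)
qed

lemma order_simple_root:
  fixes p :: "'a::field_char_0 poly"
  assumes "poly p x = 0" "poly (pderiv p) x \<noteq> 0"
  shows "Polynomial.order x p = 1"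
proof -
  have "pderiv p \<noteq> 0" "p \<noteq> 0" using assms(2) by auto
  moreover have "Polynomial.order x p \<noteq> 0" using assms(1) \<open>p \<noteq> 0\<close> by (simp add: order_root)
  ultimately have "Polynomial.order x p = Suc (Polynomial.order x (pderiv p))"
    using assms(1) by (intro order_pderiv)
  then show ?thesis using assms(2) by (simp add: order_0I)
qed

lemma pcompose_pow: "pcompose (p ^ n) q = pcompose p q ^ n" for p :: "'a::comm_ring_1 poly"
  by (induction n) (simp_all add: pcompose_mult pcompose_1)

text \<open>
  Near a fixed point \<open>x\<close> with multiplier \<open>1\<close> a map \<open>X + c (X - x) ^ E + \<dots>\<close> has \<open>t\<close>-th iterate
  \<open>X + t c (X - x) ^ E + \<dots>\<close>, and \<open>t c\<close> does not vanish in characteristic \<open>0\<close>.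
\<close>
lemma order_iter_multiplier_one:
  fixes h :: "'a::field_char_0 poly"
  assumes deg: "degree h \<ge> 2" and fixed: "poly h x = x" and one: "poly (pderiv h) x = 1" and t: "t > 0"
  shows "Polynomial.order x (poly_iter h t - [:0, 1:]) = Polynomial.order x (h - [:0, 1:])"
proof -
  let ?L = "[:- x, 1:]"
  define E where "E = Polynomial.order x (h - [:0, 1:])"
  have hX: "h - [:0, 1:] \<noteq> 0" using deg by auto
  obtain u where u: "h - [:0, 1:] = ?L ^ E * u" "\<not> ?L dvd u"
    using order_decomp[OF hX, of x] unfolding E_def by blast
  have ux: "poly u x \<noteq> 0" using u(2) poly_eq_0_iff_dvd by blast
  have "E \<ge> 2"
  proof -
    have "pderiv (h - [:0, 1:]) \<noteq> 0"
    proof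
      assume "pderiv (h - [:0, 1:]) = 0"
      then have "degree (h + - [:0, 1:]) = 0" by (simp only: pderiv_eq_0_iff diff_conv_add_uminus)
      moreover have "degree (h + - [:0, 1:]) = degree h" using deg by (subst degree_add_eq_left) auto
      ultimately show False using deg by simp
    qed
    moreover have "E \<noteq> 0" unfolding E_def using hX fixed order_root[of "h - [:0, 1:]" x] by simp
    ultimately have "E = Suc (Polynomial.order x (pderiv (h - [:0, 1:])))"
      unfolding E_def using fixed hX by (intro order_pderiv) simp_all
    moreover have "Polynomial.order x (pderiv (h - [:0, 1:])) \<noteq> 0"
      using one \<open>pderiv (h - [:0, 1:]) \<noteq> 0\<close> order_root[of "pderiv (h - [:0, 1:])" x]
      by (simp add: pderiv_diff pderiv_pCons)
    ultimately show ?thesis by simp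
  qed
  have "\<exists>v. poly_iter h t - [:0, 1:] = ?L ^ E * v \<and> poly v x = of_nat t * poly u x" for t
  proof (induction t)
    case 0
    show ?case by (rule exI[of _ 0]) simp
  next
    case (Suc t)
    then obtain v where v: "poly_iter h t - [:0, 1:] = ?L ^ E * v" "poly v x = of_nat t * poly u x"
        by blast
    define w where "w = poly_iter h t"
    have w: "w = [:0, 1:] + ?L ^ E * v" using v(1) unfolding w_def by (simp add: algebra_simps)
    have wx: "poly w x = x" using \<open>E \<ge> 2\<close> unfolding w by simp
    have h: "h = [:0, 1:] + ?L ^ E * u" using u(1) by (simp add: algebra_simps)
    have "pcompose ?L w = ?L + ?L ^ E * v" unfolding w pcompose_pCons by simp
    also have "?L ^ E = ?L * ?L ^ (E - 1)" using \<open>E \<ge> 2\<close> by (simp flip: power_Suc)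
    finally have L: "pcompose ?L w = ?L * (1 + ?L ^ (E - 1) * v)"
        by (simp only: ring_distribs mult_1_right mult.assoc)
    have "pcompose h w = w + pcompose ?L w ^ E * pcompose u w"
      by (subst h) (simp add: pcompose_add pcompose_mult pcompose_pow pcompose_pCons)
    then have "pcompose h w - [:0, 1:] = (w - [:0, 1:]) + pcompose ?L w ^ E * pcompose u w"
      by simp
    also have "w - [:0, 1:] = ?L ^ E * v" using v(1) unfolding w_def .
    also have "pcompose ?L w ^ E = ?L ^ E * (1 + ?L ^ (E - 1) * v) ^ E"
      unfolding L by (rule power_mult_distrib)
    finally have "pcompose h w - [:0, 1:] = ?L ^ E * (v + (1 + ?L ^ (E - 1) * v) ^ E * pcompose u w)"
      by (simp only: distrib_left mult.assoc)
    moreover have "poly (v + (1 + ?L ^ (E - 1) * v) ^ E * pcompose u w) x = of_nat (Suc t) * poly u x"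
      using \<open>E \<ge> 2\<close> v(2) wx by (simp add: poly_pcompose algebra_simps power_0_left)
    ultimately show ?case unfolding poly_iter_Suc w_def by blast
  qed
  then obtain v where v: "poly_iter h t - [:0, 1:] = ?L ^ E * v" "poly v x = of_nat t * poly u x"
      by blast
  have "poly v x \<noteq> 0" using v(2) ux t by simp
  then have "v \<noteq> 0" "Polynomial.order x v = 0" by (auto simp: order_0I)
  moreover have "Polynomial.order x (?L ^ E) = E" by (rule order_power_n_n)
  ultimately show ?thesis unfolding v(1) E_def[symmetric]
    by (subst order_mult) auto
qed

text \<open>
  If the multiplier \<open>l\<close> is an \<open>s\<close>-th root of unity, exactly the iterates whose exponents are multiples
  of its order have multiplier \<open>1\<close>; all other ones have a simple fixed point.
\<close>
lemma order_iter_fixed: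
  fixes g :: "'a::field_char_0 poly"
  assumes deg: "degree g \<ge> 2" and fixed: "poly g x = x"
  shows "\<exists>s E. s > 0 \<and> E > 0 \<and>
    (\<forall>i>0. Polynomial.order x (poly_iter g i - [:0, 1:]) = (if s dvd i then E else 1))"
proof -
  define l where "l = poly (pderiv g) x"
  have per: "(poly g ^^ i) x = x" for i
    using funpow_mult_fixed[of 1 "poly g" x i] fixed by simp
  have der: "poly (pderiv (poly_iter g i)) x = l ^ i" for i
    unfolding l_def by (rule poly_pderiv_iter_fixed[OF fixed])
  have simple: "Polynomial.order x (poly_iter g i - [:0, 1:]) = 1" if "l ^ i \<noteq> 1" for i
    by (rule order_simple_root) (use that per in \<open>simp_all add: poly_poly_iter pderiv_diff
        pderiv_pCons der\<close>)
  show ?thesis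
  proof (cases "\<exists>i>0. l ^ i = 1")
    case False
    then have "Polynomial.order x (poly_iter g i - [:0, 1:]) = 1" if "i > 0" for i
      using simple[of i] that by blast
    then show ?thesis by (intro exI[of _ 1] conjI allI impI) simp_all
  next
    case True
    \<comment> \<open>the order of \<open>l\<close> is the exact period of \<open>1\<close> under multiplication by \<open>l\<close>\<close>
    have l: "((*) l ^^ i) 1 = l ^ i" for i by (induction i) auto
    obtain i where "i > 0" "((*) l ^^ i) 1 = 1" using True l by metis
    then obtain s where s: "exact_period ((*) l) s 1" using ex_exact_period[of i "(*) l" 1] by blast
    have dvd: "l ^ i = 1 \<longleftrightarrow> s dvd i" for i using exact_period_iff_dvd[OF s, of i] l by simp
    have s0: "s > 0" using s by (simp add: exact_period_def)
    define h where "h = poly_iter g s"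
    have "degree g ^ 1 \<le> degree g ^ s" using s0 deg by (intro power_increasing) auto
    then have h: "degree h \<ge> 2" "poly h x = x" "poly (pderiv h) x = 1"
      using deg per der[of s] dvd[of s] by (auto simp: h_def degree_poly_iter poly_poly_iter)
    have "Polynomial.order x (poly_iter g i - [:0, 1:]) = Polynomial.order x (h - [:0, 1:])"
      if i: "s dvd i" "i > 0" for i
    proof -
      obtain t where t: "i = s * t" using i(1) by blast
      then show ?thesis using order_iter_multiplier_one[OF h, of t] i(2)
        by (simp add: poly_iter_mult h_def)
    qed
    moreover have "Polynomial.order x (h - [:0, 1:]) > 0"
    proof -
      have "h - [:0, 1:] \<noteq> 0" using h(1) by auto
      then show ?thesis using h(2) order_root[of "h - [:0, 1:]" x] by simp
    qed
    ultimately show ?thesis using s0 simple dvd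
      by (intro exI[of _ s] exI[of _ "Polynomial.order x (h - [:0, 1:])"]) auto
  qed
qed

lemma sum_order_alg_closed:
  fixes p :: "'a::alg_closed_field poly"
  assumes "p \<noteq> 0"
  shows "(\<Sum>x | poly p x = 0. Polynomial.order x p) = degree p"
proof -
  obtain A where A: "size A = degree p" "p = smult (lead_coeff p) (\<Prod>x\<in>#A. [:- x, 1:])"
    using alg_closed_imp_factorization[OF assms] by blast
  have "proots (\<Prod>x\<in>#A. [:- x, 1:]) = A"
  proof (induction A)
    case (add x A)
    have "(\<Prod>x\<in>#A. [:- x, 1:]) \<noteq> 0" by (auto simp: prod_mset_zero_iff)
    then show ?case using add proots_mult[of "[:- x, 1:]" "\<Prod>x\<in>#A. [:- x, 1:]"] by simp
  qed simp
  then have "proots p = A" by (subst A(2)) (use assms in simp)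
  then have "degree p = size (proots p)" using A(1) by simp
  also have "\<dots> = (\<Sum>x | poly p x = 0. Polynomial.order x p)"
    unfolding size_multiset_overloaded_eq using assms by simp
  finally show ?thesis by simp
qed

context
  fixes f :: "'k::{alg_closed_field, field_char_0} poly" and k :: nat
  assumes deg: "degree f \<ge> 2" and k: "k > 0"
begin

definition fixed_point_mult :: "nat \<Rightarrow> 'k \<Rightarrow> nat" where
  "fixed_point_mult j x = Polynomial.order x (poly_iter f j - [:0, 1:])"

lemma fixed_point_mult_0: "j > 0 \<Longrightarrow> (poly f ^^ j) x \<noteq> x \<Longrightarrow> fixed_point_mult j x = 0"
  unfolding fixed_point_mult_def by (rule order_0I) (simp add: poly_poly_iter)

lemma finite_fixed: "j > 0 \<Longrightarrow> finite {x. (poly f ^^ j) x = x}"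
  using poly_roots_finite[OF poly_iter_diff_nonzero(2)[OF deg]] by (simp add: poly_poly_iter)

lemma sum_fixed_point_mult:
  assumes j: "j > 0"
  shows "(\<Sum>x | (poly f ^^ j) x = x. fixed_point_mult j x) = degree f ^ j"
  using sum_order_alg_closed[OF poly_iter_diff_nonzero(2)[OF deg j]] poly_iter_diff_nonzero(1)[OF deg j]
  by (simp add: fixed_point_mult_def poly_poly_iter)

definition periodic_pts :: "'k set" where
  "periodic_pts = {x. (poly f ^^ k) x = x}"

lemma finite_periodic_pts: "finite periodic_pts"
  unfolding periodic_pts_def by (rule finite_fixed[OF k])

lemma moebius_sum_points:
  "(\<Sum>j | j dvd k. moebius_mu (k div j) * int (degree f ^ j)) =
    (\<Sum>x\<in>periodic_pts. \<Sum>j | j dvd k. moebius_mu (k div j) * int (fixed_point_mult j x))"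
proof -
  have "int (degree f ^ j) = (\<Sum>x\<in>periodic_pts. int (fixed_point_mult j x))" if j: "j dvd k" for j
  proof -
    have j0: "j > 0" using j k by (auto intro: Nat.gr0I)
    have "{x. (poly f ^^ j) x = x} \<subseteq> periodic_pts"
      unfolding periodic_pts_def using j by (auto simp: funpow_mult_fixed)
    then have "(\<Sum>x | (poly f ^^ j) x = x. fixed_point_mult j x) =
        (\<Sum>x\<in>periodic_pts. fixed_point_mult j x)"
      by (rule sum.mono_neutral_left[OF finite_periodic_pts]) (auto simp: fixed_point_mult_0[OF j0])
    then show ?thesis using sum_fixed_point_mult[OF j0] by (metis of_nat_sum)
  qed
  then have "(\<Sum>j | j dvd k. moebius_mu (k div j) * int (degree f ^ j)) =
      (\<Sum>j | j dvd k. \<Sum>x\<in>periodic_pts. moebius_mu (k div j) * int (fixed_point_mult j x))"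
    by (intro sum.cong) (simp_all only: mem_Collect_eq sum_distrib_left)
  also have "\<dots> = (\<Sum>x\<in>periodic_pts. \<Sum>j | j dvd k. moebius_mu (k div j) * int (fixed_point_mult j x))"
    by (rule sum.swap)
  finally show ?thesis .
qed

lemma moebius_sum_at_point:
  assumes m: "exact_period (poly f) m x" "m dvd k"
  shows "(\<Sum>j | j dvd k. moebius_mu (k div j) * int (fixed_point_mult j x)) =
    (\<Sum>i | i dvd k div m. moebius_mu (k div m div i) * int (fixed_point_mult (m * i) x))"
proof -
  have fin: "finite {j. j dvd k}" using k by simp
  have "(\<Sum>j | j dvd k. moebius_mu (k div j) * int (fixed_point_mult j x)) =
      (\<Sum>j | j dvd k \<and> m dvd j. moebius_mu (k div j) * int (fixed_point_mult j x))"
  proof (rule sum.mono_neutral_right[OF fin])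
    show "\<forall>j\<in>{j. j dvd k} - {j. j dvd k \<and> m dvd j}. moebius_mu (k div j) * int (fixed_point_mult j
        x) = 0"
    proof
      fix j assume "j \<in> {j. j dvd k} - {j. j dvd k \<and> m dvd j}"
      then have "j > 0" "\<not> m dvd j" using k by (auto intro: Nat.gr0I)
      then show "moebius_mu (k div j) * int (fixed_point_mult j x) = 0"
        using fixed_point_mult_0 exact_period_iff_dvd[OF m(1)] by simp
    qed
  qed auto
  also have "\<dots> = (\<Sum>i | i dvd k div m. moebius_mu (k div (m * i)) * int (fixed_point_mult (m * i) x))"
    by (rule sum_divisors_multiples[OF k m(2)])
  finally show ?thesis by (simp add: div_mult2_eq)
qed

text \<open>
  The local contribution is the order at \<open>x\<close> of the dynatomic polynomial. It is nonnegative
  because, along the multiples of the exact period, the multiplicities of a fixed point of the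
  iterates take the value \<open>1\<close> except at the multiples of a single \<open>s\<close>.
\<close>
lemma moebius_sum_at_point_ge:
  assumes x: "x \<in> periodic_pts"
  shows "(\<Sum>j | j dvd k. moebius_mu (k div j) * int (fixed_point_mult j x)) \<ge>
    (if exact_period (poly f) k x then 1 else 0)"
proof -
  obtain m where m: "exact_period (poly f) m x" "m dvd k"
    using ex_exact_period[of k "poly f" x] x k unfolding periodic_pts_def by blast
  have m0: "m > 0" using m by (simp add: exact_period_def)
  define t where "t = k div m"
  have t0: "t > 0" unfolding t_def using m(2) k by (simp add: dvd_div_pos)
  have "degree f ^ 1 \<le> degree f ^ m" using deg m0 by (intro power_increasing) auto
  then have "degree (poly_iter f m) \<ge> 2" using deg by (simp add: degree_poly_iter)
  moreover have "poly (poly_iter f m) x = x" using m(1) by (simp add: poly_poly_iter exact_period_def)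
  ultimately obtain s E where s: "s > 0" "E > 0"
    "\<And>i. i > 0 \<Longrightarrow> fixed_point_mult (m * i) x = (if s dvd i then E else 1)"
    using order_iter_fixed unfolding fixed_point_mult_def poly_iter_mult by blast
  have fin: "finite {i. i dvd t}" using t0 by simp
  have "(\<Sum>i | i dvd t. moebius_mu (t div i) * int (fixed_point_mult (m * i) x)) =
      (\<Sum>i | i dvd t. moebius_mu (t div i) + (int E - 1) * (if s dvd i then moebius_mu (t div i) else 0))"
  proof (rule sum.cong)
    fix i assume "i \<in> {i. i dvd t}"
    then have "i > 0" using t0 by (auto intro: Nat.gr0I)
    then show "moebius_mu (t div i) * int (fixed_point_mult (m * i) x) =
        moebius_mu (t div i) + (int E - 1) * (if s dvd i then moebius_mu (t div i) else 0)"
      by (cases "s dvd i") (simp_all add: s(3) left_diff_distrib mult.commute[of "int E"])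
  qed simp
  also have "\<dots> = (\<Sum>i | i dvd t. moebius_mu (t div i)) +
      (int E - 1) * (\<Sum>i | i dvd t. if s dvd i then moebius_mu (t div i) else 0)"
    by (simp add: sum.distrib sum_distrib_left)
  also have "(\<Sum>i | i dvd t. if s dvd i then moebius_mu (t div i) else 0) = (if s = t then 1 else 0)"
  proof (cases "s dvd t")
    case True
    have "(\<Sum>i | i dvd t. if s dvd i then moebius_mu (t div i) else 0) =
        (\<Sum>i | i dvd t \<and> s dvd i. moebius_mu (t div i))"
      using fin by (simp add: sum.If_cases Int_def)
    also have "\<dots> = (\<Sum>i | i dvd t div s. moebius_mu (t div (s * i)))"
      by (rule sum_divisors_multiples[OF t0 True])
    also have "\<dots> = (if t div s = 1 then 1 else 0)"
      using sum_moebius_codivisors[of "t div s"] True t0 by (simp add: div_mult2_eq dvd_div_pos)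
    finally show ?thesis using True t0 s(1) by (auto elim!: dvdE)
  next
    case False
    then have "\<not> s dvd i" if "i dvd t" for i using that dvd_trans by blast
    then have "(\<Sum>i | i dvd t. if s dvd i then moebius_mu (t div i) else 0) = 0"
      by (intro sum.neutral) auto
    then show ?thesis using False by auto
  qed
  finally have eq: "(\<Sum>j | j dvd k. moebius_mu (k div j) * int (fixed_point_mult j x)) =
      (if t = 1 then 1 else 0) + (int E - 1) * (if s = t then 1 else 0)"
    using moebius_sum_at_point[OF m] sum_moebius_codivisors[OF t0] unfolding t_def by simp
  have "t = 1" if "exact_period (poly f) k x"
  proof -
    have "m = k"
      using that m unfolding exact_period_def by (metis dvd_imp_le linorder_neqE_nat not_le)
    then show ?thesis unfolding t_def using k by simp
  qed
  then show ?thesis unfolding eq using s(2) by auto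
qed

lemma finite_exact_period: "finite {x. exact_period (poly f) k x}"
  by (rule finite_subset[OF _ finite_periodic_pts]) (auto simp: periodic_pts_def exact_period_def)

theorem card_exact_period_le:
  "int (card {x. exact_period (poly f) k x}) \<le> (\<Sum>j | j dvd k. moebius_mu (k div j) * int (degree f ^ j))"
proof -
  have "int (card {x. exact_period (poly f) k x}) =
      (\<Sum>x\<in>periodic_pts. if exact_period (poly f) k x then 1 else 0)"
  proof -
    have "{x. exact_period (poly f) k x} = {x \<in> periodic_pts. exact_period (poly f) k x}"
      by (auto simp: periodic_pts_def exact_period_def)
    then show ?thesis using finite_periodic_pts by (simp add: sum.If_cases Int_def)
  qed
  also have "\<dots> \<le> (\<Sum>x\<in>periodic_pts. \<Sum>j | j dvd k. moebius_mu (k div j) * int (fixed_point_mult j x))"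
    by (intro sum_mono moebius_sum_at_point_ge)
  finally show ?thesis unfolding moebius_sum_points .
qed

text \<open>If all multiplicities are \<open>1\<close>, then the local contributions are \<open>0\<close> and \<open>1\<close>.\<close>
theorem card_exact_period_eq:
  assumes simple: "\<And>x. (poly f ^^ k) x = x \<Longrightarrow> poly (pderiv (poly_iter f k)) x \<noteq> 1"
  shows "int (card {x. exact_period (poly f) k x}) = (\<Sum>j | j dvd k. moebius_mu (k div j) * int
      (degree f ^ j))"
proof -
  have "(\<Sum>j | j dvd k. moebius_mu (k div j) * int (fixed_point_mult j x)) =
      (if exact_period (poly f) k x then 1 else 0)"
    if x: "x \<in> periodic_pts" for x
  proof -
    obtain m where m: "exact_period (poly f) m x" "m dvd k"
      using ex_exact_period[of k "poly f" x] x k unfolding periodic_pts_def by blast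
    have one: "fixed_point_mult (m * i) x = 1" if i: "i dvd k div m" for i
    proof -
      have "m * i dvd k" using i m(2) by (metis dvd_mult_div_cancel dvd_refl mult_dvd_mono)
      then obtain l where l: "k = (m * i) * l" by blast
      have fixed: "(poly f ^^ (m * i)) x = x" using m(1)
          by (simp add: funpow_mult_fixed exact_period_def)
      have "poly (pderiv (poly_iter f k)) x = poly (pderiv (poly_iter f (m * i))) x ^ l"
        unfolding l poly_iter_mult[of f "m * i" l]
        by (rule poly_pderiv_iter_fixed) (simp add: poly_poly_iter fixed)
      then have "poly (pderiv (poly_iter f (m * i))) x \<noteq> 1"
        using simple[of x] x unfolding periodic_pts_def by auto
      then show ?thesis unfolding fixed_point_mult_def
        by (intro order_simple_root) (simp_all add: poly_poly_iter fixed pderiv_diff pderiv_pCons)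
    qed
    have "(\<Sum>j | j dvd k. moebius_mu (k div j) * int (fixed_point_mult j x)) =
        (\<Sum>i | i dvd k div m. moebius_mu (k div m div i))"
      unfolding moebius_sum_at_point[OF m] by (rule sum.cong) (simp_all add: one)
    also have "\<dots> = (if k div m = 1 then 1 else 0)"
      using m(2) k by (intro sum_moebius_codivisors) (simp add: dvd_div_pos)
    also have "k div m = 1 \<longleftrightarrow> exact_period (poly f) k x"
    proof
      assume "k div m = 1"
      then have "k = m" using m(2) by (metis dvd_mult_div_cancel mult.right_neutral)
      then show "exact_period (poly f) k x" using m(1) by simp
    next
      assume "exact_period (poly f) k x"
      then have "m = k" using m unfolding exact_period_def by (metis dvd_imp_le linorder_neqE_nat not_le)
      then show "k div m = 1" using k by simp
    qed
    finally show ?thesis .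
  qed
  then have "(\<Sum>j | j dvd k. moebius_mu (k div j) * int (degree f ^ j)) =
      (\<Sum>x\<in>periodic_pts. if exact_period (poly f) k x then 1 else 0)"
    unfolding moebius_sum_points by (rule sum.cong[OF refl])
  also have "\<dots> = int (card {x. exact_period (poly f) k x})"
  proof -
    have "{x. exact_period (poly f) k x} = {x \<in> periodic_pts. exact_period (poly f) k x}"
      by (auto simp: periodic_pts_def exact_period_def)
    then show ?thesis using finite_periodic_pts by (simp add: sum.If_cases Int_def)
  qed
  finally show ?thesis by simp
qed

end

section \<open>Cycles of a portrait\<close>

lemma exact_period_mod:
  assumes "exact_period f m x"
  shows "(f ^^ (l mod m)) x = (f ^^ l) x"
proof -
  have "(f ^^ (l mod m + m * (l div m))) x = (f ^^ (l mod m)) x"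
    unfolding funpow_add comp_apply using assms by (simp add: funpow_mult_fixed exact_period_def)
  then show ?thesis by simp
qed

lemma exact_period_inj:
  assumes "exact_period f m x"
  shows "inj_on (\<lambda>l. (f ^^ l) x) {..<m}"
proof (rule linorder_inj_onI')
  fix a b assume ab: "a \<in> {..<m}" "b \<in> {..<m}" "a < b"
  show "(f ^^ a) x \<noteq> (f ^^ b) x"
  proof
    assume eq: "(f ^^ a) x = (f ^^ b) x"
    have "(f ^^ (m - b + a)) x = (f ^^ (m - b)) ((f ^^ b) x)" by (simp add: funpow_add eq)
    also have "\<dots> = (f ^^ (m - b + b)) x" by (simp only: funpow_add comp_apply)
    also have "\<dots> = x" using assms ab by (simp add: exact_period_def)
    finally show False using assms ab unfolding exact_period_def by auto
  qed
qed

lemma exact_period_orbit: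
  assumes "exact_period f m x"
  shows "orbit f x = (\<lambda>l. (f ^^ l) x) ` {..<m}" "card (orbit f x) = m" "x \<in> orbit f x"
proof -
  have m: "m > 0" "(f ^^ m) x = x" using assms by (auto simp: exact_period_def)
  show x: "x \<in> orbit f x" unfolding orbit_altdef using m by (metis (mono_tags, lifting) mem_Collect_eq)
  show orb: "orbit f x = (\<lambda>l. (f ^^ l) x) ` {..<m}"
  proof (intro equalityI subsetI)
    fix y assume "y \<in> orbit f x"
    then obtain l where "y = (f ^^ l) x" unfolding orbit_altdef by blast
    then have "y = (f ^^ (l mod m)) x" by (simp add: exact_period_mod[OF assms])
    moreover have "l mod m \<in> {..<m}" using m by simp
    ultimately show "y \<in> (\<lambda>l. (f ^^ l) x) ` {..<m}" by (rule image_eqI)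
  next
    fix y assume "y \<in> (\<lambda>l. (f ^^ l) x) ` {..<m}"
    then obtain l where "y = (f ^^ l) x" by blast
    then show "y \<in> orbit f x" using x unfolding orbit_altdef_self_in[OF x] by blast
  qed
  show "card (orbit f x) = m" unfolding orb by (simp add: card_image[OF exact_period_inj[OF assms]])
qed

lemma funpow_closed: "(\<And>x. x \<in> A \<Longrightarrow> f x \<in> A) \<Longrightarrow> x \<in> A \<Longrightarrow> (f ^^ l) x \<in> A"
  by (induction l) auto

lemma orbit_closed: "(\<And>x. x \<in> A \<Longrightarrow> f x \<in> A) \<Longrightarrow> x \<in> A \<Longrightarrow> orbit f x \<subseteq> A"
  unfolding orbit_altdef using funpow_closed[of A f x] by auto

text \<open>The cycles partition the points of exact period \<open>k\<close> into classes with \<open>k\<close> elements.\<close>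
lemma card_exact_period_portrait:
  assumes P: "P \<in> {1..n} \<rightarrow> {1..n}" and k: "k > 0"
  shows "card {i \<in> {1..n}. exact_period P k i} = k * card (portrait_cycles n P k)"
proof -
  have cyc: "C = orbit P i" "exact_period P k i" if C: "C \<in> portrait_cycles n P k" and i: "i \<in> C" for C i
  proof -
    have CP: "C \<subseteq> {1..n}" "cyclic_on P C" "card C = k" using C by (auto simp: portrait_cycles_def)
    show orb: "C = orbit P i" using orbit_cyclic_eq3[OF CP(2) i] by simp
    then have "i \<in> orbit P i" using i by simp
    then obtain l where "l > 0" "(P ^^ l) i = i" unfolding orbit_altdef by force
    then obtain m where m: "exact_period P m i" using ex_exact_period[of l P i] by blast
    then have "m = k" using exact_period_orbit(2)[OF m] orb CP(3) by simp
    then show "exact_period P k i" using m by simp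
  qed
  have "{i \<in> {1..n}. exact_period P k i} = \<Union>(portrait_cycles n P k)"
  proof (intro equalityI subsetI)
    fix i assume "i \<in> {i \<in> {1..n}. exact_period P k i}"
    then have i: "i \<in> {1..n}" "exact_period P k i" by auto
    have "orbit P i \<in> portrait_cycles n P k"
      unfolding portrait_cycles_def cyclic_on_def
      using exact_period_orbit[OF i(2)] orbit_closed[of "{1..n}" P i] P i(1) by blast
    then show "i \<in> \<Union>(portrait_cycles n P k)" using exact_period_orbit(3)[OF i(2)] by blast
  next
    fix i assume "i \<in> \<Union>(portrait_cycles n P k)"
    then obtain C where C: "C \<in> portrait_cycles n P k" "i \<in> C" by blast
    then have "i \<in> {1..n}" unfolding portrait_cycles_def by blast
    then show "i \<in> {i \<in> {1..n}. exact_period P k i}" using cyc(2)[OF C] by simp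
  qed
  moreover have "card (\<Union>(portrait_cycles n P k)) = k * card (portrait_cycles n P k)"
  proof (rule card_partition[symmetric])
    have "portrait_cycles n P k \<subseteq> Pow {1..n}" unfolding portrait_cycles_def by blast
    then show "finite (portrait_cycles n P k)" "finite (\<Union>(portrait_cycles n P k))"
      by (auto intro: finite_subset finite_subset[of _ "{1..n}"])
    show "card C = k" if "C \<in> portrait_cycles n P k" for C using that by (simp add: portrait_cycles_def)
    show "C \<inter> D = {}" if "C \<in> portrait_cycles n P k" "D \<in> portrait_cycles n P k" "C \<noteq> D" for C D
      using that cyc(1) by blast
  qed
  ultimately show ?thesis by simp
qed

lemma cycle_bound_iff:
  assumes P: "P \<in> {1..n} \<rightarrow> {1..n}" and k: "k > 0"
  shows "real (card (portrait_cycles n P k)) \<le>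
      1 / real k * (\<Sum>j | j dvd k. of_int (moebius_mu (k div j)) * real d ^ j) \<longleftrightarrow>
    int (card {i \<in> {1..n}. exact_period P k i}) \<le> (\<Sum>j | j dvd k. moebius_mu (k div j) * int (d ^ j))"
    (is "?a \<le> 1 / real k * ?M \<longleftrightarrow> _ \<le> ?N")
proof -
  have M: "?M = of_int ?N" by simp
  have "?a \<le> 1 / real k * ?M \<longleftrightarrow> real k * ?a \<le> ?M"
    using k by (simp add: field_simps)
  also have "\<dots> \<longleftrightarrow> real_of_int (int (k * card (portrait_cycles n P k))) \<le> real_of_int ?N"
    unfolding M by simp
  finally show ?thesis unfolding card_exact_period_portrait[OF P k] of_int_le_iff .
qed

section \<open>Polynomials realizing a portrait\<close>

lemma funpow_equivariant:
  assumes "\<And>i. i \<in> S \<Longrightarrow> P i \<in> S" "\<And>i. i \<in> S \<Longrightarrow> f (q i) = q (P i)" "i \<in> S"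
  shows "(f ^^ l) (q i) = q ((P ^^ l) i)"
  using assms(2) funpow_closed[of S P i] assms(1,3) by (induction l) auto

lemma exact_period_equivariant:
  assumes S: "\<And>i. i \<in> S \<Longrightarrow> P i \<in> S" "\<And>i. i \<in> S \<Longrightarrow> f (q i) = q (P i)" "inj_on q S" and i: "i \<in> S"
  shows "exact_period f k (q i) \<longleftrightarrow> exact_period P k i"
proof -
  have "(f ^^ l) (q i) = q i \<longleftrightarrow> (P ^^ l) i = i" for l
  proof -
    have "(P ^^ l) i \<in> S" by (rule funpow_closed[OF S(1) i])
    moreover have "(f ^^ l) (q i) = q ((P ^^ l) i)"
      by (rule funpow_equivariant[of S P f q, OF S(1,2) i])
    ultimately show ?thesis using inj_on_eq_iff[OF S(3), of "(P ^^ l) i" i] i by simp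
  qed
  then show ?thesis unfolding exact_period_def by simp
qed

text \<open>
  An injective equivariant map preserves exact periods and maps fibres into fibres, so the bounds
  for the polynomial carry over to the portrait.
\<close>
lemma portrait_conditions_necessary:
  fixes q :: "nat \<Rightarrow> 'k::{alg_closed_field, field_char_0}"
  assumes P: "P \<in> {1..n} \<rightarrow> {1..n}" and q: "inj_on q {1..n}"
    and f: "degree f = d" "d \<ge> 2" "\<And>i. i \<in> {1..n} \<Longrightarrow> poly f (q i) = q (P i)"
  shows "card {j \<in> {1..n}. P j = i} \<le> d"
    and "k > 0 \<Longrightarrow> int (card {i \<in> {1..n}. exact_period P k i}) \<le>
      (\<Sum>j | j dvd k. moebius_mu (k div j) * int (d ^ j))"
proof -
  have "degree (f + - [:q i:]) = d" using f by (subst degree_add_eq_left) auto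
  then have deg: "degree (f - [:q i:]) = d" by (simp only: diff_conv_add_uminus)
  then have ne: "f - [:q i:] \<noteq> 0" using f(2) by auto
  have "card {j \<in> {1..n}. P j = i} = card (q ` {j \<in> {1..n}. P j = i})"
    by (rule card_image[symmetric]) (rule inj_on_subset[OF q], auto)
  also have "\<dots> \<le> card {x. poly (f - [:q i:]) x = 0}"
    by (rule card_mono[OF poly_roots_finite[OF ne]]) (use f(3) in auto)
  also have "\<dots> \<le> d" using card_poly_roots_bound[OF ne] deg by simp
  finally show "card {j \<in> {1..n}. P j = i} \<le> d" .
  assume k: "k > 0"
  have "card {i \<in> {1..n}. exact_period P k i} = card (q ` {i \<in> {1..n}. exact_period P k i})"
    by (rule card_image[symmetric]) (rule inj_on_subset[OF q], auto)
  also have "\<dots> \<le> card {x. exact_period (poly f) k x}"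
  proof (intro card_mono finite_exact_period subsetI)
    fix x assume "x \<in> q ` {i \<in> {1..n}. exact_period P k i}"
    then obtain i where i: "i \<in> {1..n}" "exact_period P k i" "x = q i" by blast
    then show "x \<in> {x. exact_period (poly f) k x}"
      using exact_period_equivariant[of "{1..n}" P "poly f" q i k, OF funcset_mem[OF P] f(3) q i(1)]
      by simp
  qed (use f k in auto)
  finally show "int (card {i \<in> {1..n}. exact_period P k i}) \<le>
      (\<Sum>j | j dvd k. moebius_mu (k div j) * int (d ^ j))"
    using card_exact_period_le[of f k] f k by simp
qed

lemma card_roots_simple:
  fixes p :: "'k::{alg_closed_field, field_char_0} poly"
  assumes "p \<noteq> 0" "\<And>x. poly p x = 0 \<Longrightarrow> poly (pderiv p) x \<noteq> 0"
  shows "card {x. poly p x = 0} = degree p"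
proof -
  have "degree p = (\<Sum>x | poly p x = 0. Polynomial.order x p)"
      by (rule sum_order_alg_closed[OF assms(1), symmetric])
  also have "\<dots> = (\<Sum>x | poly p x = 0. 1)"
    by (rule sum.cong) (use order_simple_root assms(2) in auto)
  finally show ?thesis by simp
qed

text \<open>Two of the first \<open>n + 1\<close> points of an orbit coincide, and their distance divides \<open>n!\<close>.\<close>
lemma funpow_preperiodic:
  assumes A: "finite A" "card A = n" "\<And>x. x \<in> A \<Longrightarrow> f x \<in> A" and s: "s \<in> A"
  shows "(f ^^ (n + fact n)) s = (f ^^ n) s"
proof -
  have "(\<lambda>l. (f ^^ l) s) ` {..n} \<subseteq> A" using funpow_closed[of A f s] A(3) s by blast
  then have "card ((\<lambda>l. (f ^^ l) s) ` {..n}) \<le> n" using card_mono[OF A(1)] A(2) by metis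
  then have "\<not> inj_on (\<lambda>l. (f ^^ l) s) {..n}"
    using card_image[of "\<lambda>l. (f ^^ l) s" "{..n}"] by auto
  then obtain a b where ab: "a < b" "b \<le> n" "(f ^^ a) s = (f ^^ b) s"
    by (metis (mono_tags, lifting) atMost_iff linorder_inj_onI')
  define y where "y = (f ^^ a) s"
  have "(f ^^ (b - a)) y = (f ^^ (b - a + a)) s" unfolding y_def funpow_add by simp
  then have y: "(f ^^ (b - a)) y = y" using ab by (simp add: y_def)
  have "b - a dvd fact n" using ab by (intro dvd_fact) auto
  then obtain c where "fact n = (b - a) * c" by blast
  then have fy: "(f ^^ fact n) y = y" using funpow_mult_fixed[OF y] by simp
  have "n + fact n = (n - a) + fact n + a" "n = (n - a) + a" using ab by auto
  then show ?thesis using fy unfolding y_def by (metis comp_apply funpow_add)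
qed

text \<open>
  A portrait is realized by extending an injective equivariant map that is defined on a forward
  invariant set. If some missing point maps into the set, it is sent to an unused preimage, which
  exists because the relevant fibres of \<open>f\<close> have the full number \<open>d\<close> of elements. Otherwise the
  complement contains a cycle, and it is sent to an unused cycle of \<open>f\<close> of the same length.
\<close>
theorem realize_portrait:
  fixes f :: "'k::{alg_closed_field, field_char_0} poly"
  assumes P: "P \<in> {1..n} \<rightarrow> {1..n}" and f: "degree f = d" "d \<ge> 2"
    and fibres: "\<And>i. i \<in> {1..n} \<Longrightarrow> card {j \<in> {1..n}. P j = i} \<le> d"
    and cycles: "\<And>k. k > 0 \<Longrightarrow> int (card {i \<in> {1..n}. exact_period P k i}) \<le>
      (\<Sum>j | j dvd k. moebius_mu (k div j) * int (d ^ j))"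
    and simple: "\<And>x. (poly f ^^ fact n) x = x \<Longrightarrow> poly (pderiv (poly_iter f (fact n))) x \<noteq> 1"
    and crit: "\<And>c. poly (pderiv f) c = 0 \<Longrightarrow> (poly f ^^ Suc (n + fact n)) c \<noteq> (poly f ^^ Suc n) c"
  shows "\<exists>q. inj_on q {1..n} \<and> (\<forall>i\<in>{1..n}. poly f (q i) = q (P i))"
proof -
  have Pn: "P i \<in> {1..n}" if "i \<in> {1..n}" for i using P that by blast
  have pre: "(P ^^ (n + fact n)) i = (P ^^ n) i" if "i \<in> {1..n}" for i
    by (rule funpow_preperiodic[of "{1..n}"]) (use Pn that in auto)
  have full: "card {x. poly f x = w} = d" if w: "(poly f ^^ (n + fact n)) w = (poly f ^^ n) w" for w
  proof -
    have "degree (f + - [:w:]) = d" using f by (subst degree_add_eq_left) auto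
    then have deg: "degree (f - [:w:]) = d" by (simp only: diff_conv_add_uminus)
    then have ne: "f - [:w:] \<noteq> 0" using f(2) by auto
    have "poly (pderiv (f - [:w:])) x \<noteq> 0" if x: "poly (f - [:w:]) x = 0" for x
    proof
      assume "poly (pderiv (f - [:w:])) x = 0"
      then have "(poly f ^^ Suc (n + fact n)) x \<noteq> (poly f ^^ Suc n) x"
        by (intro crit) (simp add: pderiv_diff pderiv_pCons)
      then show False using w x by (simp add: funpow_swap1 del: funpow.simps add: funpow_Suc_right)
    qed
    then show ?thesis using card_roots_simple[OF ne] deg by simp
  qed
  have full_cycles: "int (card {x. exact_period (poly f) k x}) = (\<Sum>j | j dvd k. moebius_mu (k div j)
      * int (d ^ j))"
    if k: "k > 0" "k \<le> n" for k
  proof -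
    obtain l where l: "fact n = k * l" using dvd_fact[of k n] k by auto
    have "poly (pderiv (poly_iter f k)) x \<noteq> 1" if x: "(poly f ^^ k) x = x" for x
    proof
      assume 1: "poly (pderiv (poly_iter f k)) x = 1"
      have "poly (pderiv (poly_iter f (fact n))) x = poly (pderiv (poly_iter f k)) x ^ l"
        unfolding l poly_iter_mult by (rule poly_pderiv_iter_fixed) (simp add: poly_poly_iter x)
      moreover have "(poly f ^^ fact n) x = x" unfolding l by (rule funpow_mult_fixed[OF x])
      ultimately show False using simple 1 by simp
    qed
    then show ?thesis using card_exact_period_eq[of f k] f k by simp
  qed
  define embeds where "embeds = (\<lambda>S q. S \<subseteq> {1..n} \<and> (\<forall>i\<in>S. P i \<in> S) \<and> inj_on q S \<and>
      (\<forall>i\<in>S. poly f (q i) = q (P i)))"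
  have step: "\<exists>S' q'. embeds S' q' \<and> S \<subset> S'" if emb: "embeds S q" and ne: "S \<noteq> {1..n}" for S q
  proof -
    have S: "S \<subseteq> {1..n}" "\<And>i. i \<in> S \<Longrightarrow> P i \<in> S" "inj_on q S" "\<And>i. i \<in> S \<Longrightarrow> poly f (q i) = q (P i)"
      using emb unfolding embeds_def by auto
    have it: "(poly f ^^ l) (q i) = q ((P ^^ l) i)" if "i \<in> S" for i l
      by (rule funpow_equivariant[of S]) (use S that in auto)
    show ?thesis
    proof (cases "\<exists>i\<in>{1..n} - S. P i \<in> S")
      case True
      then obtain i where i: "i \<in> {1..n}" "i \<notin> S" "P i \<in> S" by blast
      let ?A = "{x. poly f x = q (P i)}"
      let ?Q = "{j \<in> S. P j = P i}"
      have "(poly f ^^ (n + fact n)) (q (P i)) = (poly f ^^ n) (q (P i))"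
        unfolding it[OF i(3)] using pre[of "P i"] i(3) S(1) by auto
      then have A: "card ?A = d" by (rule full)
      have "card (q ` ?Q) \<le> card ?Q" by (rule card_image_le) (use S(1) in \<open>auto intro: finite_subset\<close>)
      also have "\<dots> < card {j \<in> {1..n}. P j = P i}"
        by (rule psubset_card_mono) (use i S(1) in auto)
      also have "\<dots> \<le> d" using fibres Pn[OF i(1)] by simp
      finally have "card (q ` ?Q) < card ?A" using A by simp
      moreover have "finite (q ` ?Q)" using S(1) by (auto intro: finite_subset)
      ultimately have "\<not> ?A \<subseteq> q ` ?Q" by (metis card_mono not_le)
      then obtain x where x: "poly f x = q (P i)" "x \<notin> q ` ?Q" by blast
      have xS: "x \<notin> q ` S"
      proof
        assume "x \<in> q ` S"
        then obtain j where j: "j \<in> S" "x = q j" by blast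
        then have "q (P j) = q (P i)" using x(1) S(4) by simp
        then have "P j = P i" using inj_onD[OF S(3)] S(2) j(1) i(3) by blast
        then show False using x(2) j by blast
      qed
      have "embeds (insert i S) (q(i := x))"
        unfolding embeds_def
      proof (intro conjI ballI)
        show "inj_on (q(i := x)) (insert i S)"
          using S(3) xS i(2) by (auto simp: inj_on_def)
        fix j assume j: "j \<in> insert i S"
        then show Pj: "P j \<in> insert i S" using S(2) i(3) by auto
        have "P j \<noteq> i" using j S(2) i(2,3) by auto
        then show "poly f ((q(i := x)) j) = (q(i := x)) (P j)"
          using j S(4) x(1) by auto
      qed (use S(1) i(1) in auto)
      then show ?thesis using i(2) by blast
    next
      case False
      then have out: "P i \<in> {1..n} - S" if "i \<in> {1..n} - S" for i using Pn that by blast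
      obtain i0 where i0: "i0 \<in> {1..n} - S" using ne S(1) by blast
      define i where "i = (P ^^ n) i0"
      have i: "i \<in> {1..n} - S" unfolding i_def by (rule funpow_closed[OF out i0])
      have "(P ^^ fact n) i = (P ^^ (fact n + n)) i0" unfolding i_def funpow_add by simp
      then have "(P ^^ fact n) i = i" using pre[of i0] i0 by (simp add: i_def add.commute)
      then obtain k where k: "exact_period P k i" using ex_exact_period[of "fact n" P i] by auto
      have k0: "k > 0" using k by (simp add: exact_period_def)
      have orb: "orbit P i \<subseteq> {1..n} - S" by (rule orbit_closed[OF out i])
      then have "card (orbit P i) \<le> card {1..n}" by (intro card_mono) auto
      then have kn: "k \<le> n" using exact_period_orbit(2)[OF k] by simp
      let ?E = "{j \<in> S. exact_period P k j}"
      have finE: "finite ?E" using S(1) by (auto intro: finite_subset)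
      have "card (q ` ?E) \<le> card ?E" using finE by (rule card_image_le)
      also have "\<dots> < card {j \<in> {1..n}. exact_period P k j}"
        by (rule psubset_card_mono) (use i k S(1) in auto)
      also have "\<dots> \<le> card {x. exact_period (poly f) k x}"
        using cycles[OF k0] full_cycles[OF k0 kn] by linarith
      finally have "\<not> {x. exact_period (poly f) k x} \<subseteq> q ` ?E"
        using finE by (metis card_mono finite_imageI not_le)
      then obtain x where x: "exact_period (poly f) k x" "x \<notin> q ` ?E" by blast
      have xS: "x \<notin> q ` S"
        using x exact_period_equivariant[of S P "poly f" q, OF S(2) S(4) S(3)] by blast
      define C where "C = orbit P i"
      have C: "C = (\<lambda>l. (P ^^ l) i) ` {..<k}" unfolding C_def by (rule exact_period_orbit(1)[OF k])
      have CS: "C \<inter> S = {}" "C \<subseteq> {1..n}" using orb unfolding C_def by auto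
      \<comment> \<open>the point \<open>P\<^sup>l i\<close> of the new cycle is sent to \<open>f\<^sup>l x\<close>, with \<open>l < k\<close>\<close>
      define q' where "q' = (\<lambda>j. if j \<in> C then (poly f ^^ inv_into {..<k} (\<lambda>l. (P ^^ l) i) j) x else
          q j)"
      have q'lt: "q' ((P ^^ l) i) = (poly f ^^ l) x" if "l < k" for l
        using that inv_into_f_f[OF exact_period_inj[OF k], of l] unfolding q'_def C by auto
      have q': "q' ((P ^^ l) i) = (poly f ^^ l) x" for l
        using q'lt[of "l mod k"] k0 exact_period_mod[OF k] exact_period_mod[OF x(1)] by simp
      have PC: "(P ^^ l) i \<in> C" for l
      proof -
        have "(P ^^ l) i = (P ^^ (l mod k)) i" by (simp add: exact_period_mod[OF k])
        then show ?thesis unfolding C using k0 by (intro image_eqI[of _ _ "l mod k"]) auto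
      qed
      have q'S: "q' j = q j" if "j \<in> S" for j using that CS(1) unfolding q'_def by auto
      have "embeds (S \<union> C) q'"
        unfolding embeds_def
      proof (intro conjI ballI)
        show "S \<union> C \<subseteq> {1..n}" using S(1) CS(2) by blast
        show "inj_on q' (S \<union> C)"
        proof (rule inj_on_Un[THEN iffD2], intro conjI)
          show "inj_on q' S" using S(3) q'S by (simp cong: inj_on_cong)
          show "inj_on q' C"
          proof (rule inj_onI)
            fix a b assume ab: "a \<in> C" "b \<in> C" "q' a = q' b"
            then obtain l m where lm: "l < k" "m < k" "a = (P ^^ l) i" "b = (P ^^ m) i" unfolding C
                by blast
            then have "(poly f ^^ l) x = (poly f ^^ m) x" using ab(3) q' by simp
            then show "a = b" using inj_onD[OF exact_period_inj[OF x(1)], of l m] lm by simp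
          qed
          show "q' ` (S - C) \<inter> q' ` (C - S) = {}"
          proof (rule ccontr)
            assume "q' ` (S - C) \<inter> q' ` (C - S) \<noteq> {}"
            then obtain j c where jc: "j \<in> S" "c \<in> C" "q' j = q' c" by blast
            then obtain l where l: "l < k" "c = (P ^^ l) i" unfolding C by blast
            have "x = (poly f ^^ (k - l + l)) x" using x(1) l(1) by (simp add: exact_period_def)
            also have "\<dots> = (poly f ^^ (k - l)) (q j)"
              using jc q'S q'[of l] l(2) unfolding funpow_add by simp
            also have "\<dots> = q ((P ^^ (k - l)) j)" by (rule it[OF jc(1)])
            finally show False using xS funpow_closed[of S P j] S(2) jc(1) by blast
          qed
        qed
        fix j assume j: "j \<in> S \<union> C"
        have "P j \<in> S \<union> C \<and> poly f (q' j) = q' (P j)"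
        proof (cases "j \<in> S")
          case True
          then show ?thesis using S(2,4) q'S by simp
        next
          case False
          then obtain l where l: "j = (P ^^ l) i" using j unfolding C by blast
          then show ?thesis using PC[of "Suc l"] q'[of "Suc l"] q'[of l] by simp
        qed
        then show "P j \<in> S \<union> C" "poly f (q' j) = q' (P j)" by auto
      qed
      moreover have "i \<in> C" using PC[of 0] by simp
      ultimately show ?thesis using i by blast
    qed
  qed
  have all: "\<exists>q'. embeds {1..n} q'" if "embeds S q" for S q
    using that
  proof (induction "card ({1..n} - S)" arbitrary: S q rule: less_induct)
    case less
    show ?case
    proof (cases "S = {1..n}")
      case True
      then show ?thesis using less.prems by blast
    next
      case False
      then obtain S' q' where S': "embeds S' q'" "S \<subset> S'" using step[OF less.prems] by blast
      then have "{1..n} - S' \<subset> {1..n} - S" unfolding embeds_def by blast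
      then have "card ({1..n} - S') < card ({1..n} - S)" by (intro psubset_card_mono) auto
      then show ?thesis using less.hyps S'(1) by blast
    qed
  qed
  have "embeds {} (\<lambda>i. 0)" unfolding embeds_def by simp
  from all[OF this] obtain q' where "embeds {1..n} q'" by (elim exE)
  then show ?thesis unfolding embeds_def by (intro exI[of _ q']) simp
qed

section \<open>Generic polynomials\<close>

lemma dvd_of_dvd_mult_no_common_root:
  fixes A B C :: "'k::alg_closed_field poly"
  assumes "A \<noteq> 0" "\<And>x. poly A x = 0 \<Longrightarrow> poly B x \<noteq> 0" "A dvd C * B"
  shows "A dvd C"
  using assms
proof (induction "degree A" arbitrary: A C)
  case 0
  then have "is_unit A" by (simp add: is_unit_iff_degree)
  then show ?case by (simp add: unit_imp_dvd)
next
  case (Suc e)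
  from Suc.hyps(2) have "degree A > 0" by simp
  then obtain c where c: "poly A c = 0" using alg_closed_imp_poly_has_root by blast
  then obtain A' where A': "A = [:-c, 1:] * A'" using poly_eq_0_iff_dvd by (metis dvdE)
  obtain q where "C * B = A * q" using Suc.prems(3) by (elim dvdE)
  then have "poly (C * B) c = 0" using c by simp
  then have "poly C c = 0" using Suc.prems(2)[OF c] by simp
  then obtain C' where C': "C = [:-c, 1:] * C'" using poly_eq_0_iff_dvd by (metis dvdE)
  have "A' \<noteq> 0" using A' Suc.prems(1) by auto
  then have "degree A = Suc (degree A')" unfolding A' by (subst degree_mult_eq) auto
  then have "e = degree A'" using Suc.hyps(2) by simp
  moreover have "[:-c, 1:] * A' dvd [:-c, 1:] * (C' * B)" using Suc.prems(3) unfolding A' C'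
      by (simp only: mult.assoc)
  then have "A' dvd C' * B" using dvd_mult_cancel_left[of "[:-c, 1:]" A' "C' * B"] by simp
  ultimately have "A' dvd C'" using Suc.hyps(1)[of A' C'] \<open>A' \<noteq> 0\<close> Suc.prems(2) unfolding A' by simp
  then show ?case unfolding A' C' by (rule mult_dvd_mono[OF dvd_refl])
qed

text \<open>
  The resultant of a monic family \<open>A\<close> and a family \<open>B\<close>, as the determinant of the multiplication by
  \<open>B\<close> on polynomials modulo \<open>A\<close>.
\<close>
lemma ex_resultant:
  fixes A B :: "(nat \<Rightarrow> 'k::alg_closed_field) \<Rightarrow> 'k poly"
  assumes A: "A \<in> poly_fams r" and B: "B \<in> poly_fams r"
    and monic: "\<And>a. coeff (A a) e = 1" and deg: "\<And>a j. j > e \<Longrightarrow> coeff (A a) j = 0"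
  shows "\<exists>D\<in>poly_funs r. \<forall>a. D a \<noteq> 0 \<longleftrightarrow> (\<forall>x. poly (A a) x = 0 \<longrightarrow> poly (B a) x \<noteq> 0)"
proof -
  have dege: "degree (A a) = e" for a
    using monic[of a] deg[of e a] by (intro antisym degree_le le_degree) (auto simp: deg)
  have "\<exists>S R. S \<in> poly_fams r \<and> R \<in> poly_fams r \<and> (\<forall>a. \<forall>i\<ge>e. coeff (R a) i = 0) \<and>
      (\<forall>a. monom 1 j * B a = A a * S a + R a)" for j
    using poly_fams_pseudo_division[where F = A and e = e and G = "\<lambda>a. monom 1 j * B a",
        OF A deg poly_fams_mult[OF poly_fams_monom[OF poly_funs.const] B]]
    unfolding monic by simp
  then obtain S R where S: "\<And>j. S j \<in> poly_fams r" and R: "\<And>j. R j \<in> poly_fams r"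
    and Re: "\<And>j a i. i \<ge> e \<Longrightarrow> coeff (R j a) i = 0"
    and eq: "\<And>j a. monom 1 j * B a = A a * S j a + R j a"
    by metis
  \<comment> \<open>row \<open>j\<close> holds the remainder of \<open>X\<^sup>j B\<close>; a common root \<open>x\<close> makes \<open>(1, x, x\<^sup>2, \<dots>)\<close> a kernel vector\<close>
  define M where "M = (\<lambda>a. mat e e (\<lambda>(j, i). coeff (R j a) i))"
  have M: "M a \<in> carrier_mat e e" for a by (simp add: M_def)
  have polyR: "poly (R j a) x = (\<Sum>i<e. coeff (R j a) i * x ^ i)" for j a x
  proof -
    have "poly (R j a) x = (\<Sum>i\<le>e. coeff (R j a) i * x ^ i)"
      by (rule poly_eq_sum_atMost) (use Re in \<open>auto intro: degree_le\<close>)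
    then show ?thesis using Re[of e j a] by (simp add: lessThan_Suc_atMost[symmetric])
  qed
  have "(\<lambda>a. det (M a)) \<in> poly_funs r"
  proof -
    have "det (M a) = (\<Sum>p\<in>{p. p permutes {0..<e}}. signof p * (\<Prod>i =
        0..<e. coeff (R i a) (if i < e then p i else 0)))" for a
      unfolding det_def'[OF M]
    proof (rule sum.cong[OF refl], rule arg_cong[of _ _ "(*) _"], rule prod.cong[OF refl])
      fix p i assume "p \<in> {p. p permutes {0..<e}}" "i \<in> {0..<e}"
      then have "p i < e" "i < e" using permutes_in_image[of p "{0..<e}" i] by auto
      then show "M a $$ (i, p i) = coeff (R i a) (if i < e then p i else 0)" by (simp add: M_def)
    qed
    then show ?thesis
      by (simp only:) (intro poly_funs_sum poly_funs.mult poly_funs.const poly_funs_prod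
          poly_fams_coeff R)
  qed
  moreover have "det (M a) \<noteq> 0 \<longleftrightarrow> (\<forall>x. poly (A a) x = 0 \<longrightarrow> poly (B a) x \<noteq> 0)" for a
  proof
    assume det: "det (M a) \<noteq> 0"
    show "\<forall>x. poly (A a) x = 0 \<longrightarrow> poly (B a) x \<noteq> 0"
    proof (intro allI impI notI)
      fix x assume x: "poly (A a) x = 0" "poly (B a) x = 0"
      have e: "e > 0"
      proof (rule ccontr)
        assume "\<not> e > 0"
        then obtain c where "A a = [:c:]" using dege[of a] by (auto elim: degree_eq_zeroE)
        then show False using x monic[of a] by auto
      qed
      define v where "v = vec e (\<lambda>i. x ^ i)"
      have "M a *\<^sub>v v = 0\<^sub>v e"
      proof (rule eq_vecI)
        fix j assume j: "j < dim_vec (0\<^sub>v e :: 'k vec)"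
        have "(M a *\<^sub>v v) $ j = poly (R j a) x"
          using j unfolding polyR M_def v_def by (simp add: scalar_prod_def lessThan_atLeast0)
        also have "\<dots> = 0" using arg_cong[OF eq[of j a], of "\<lambda>p. poly p x"] x by simp
        finally show "(M a *\<^sub>v v) $ j = 0\<^sub>v e $ j" using j by simp
      qed (simp add: M_def)
      moreover have "v \<in> carrier_vec e" by (simp add: v_def)
      moreover have "v \<noteq> 0\<^sub>v e"
      proof
        assume "v = 0\<^sub>v e"
        then have "v $ 0 = 0" using e by simp
        then show False using e by (simp add: v_def)
      qed
      ultimately show False using det det_0_iff_vec_prod_zero_field[OF M] by blast
    qed
  next
    assume no: "\<forall>x. poly (A a) x = 0 \<longrightarrow> poly (B a) x \<noteq> 0"
    show "det (M a) \<noteq> 0"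
    proof
      assume "det (M a) = 0"
      then have "det (transpose_mat (M a)) = 0" using det_transpose[OF M] by simp
      then obtain w where w: "w \<in> carrier_vec e" "w \<noteq> 0\<^sub>v e" "transpose_mat (M a) *\<^sub>v w = 0\<^sub>v e"
        using det_0_iff_vec_prod_zero_field[of "transpose_mat (M a)" e] M by auto
      \<comment> \<open>a kernel vector of the transpose is a polynomial \<open>C\<close> of degree below \<open>e\<close> with \<open>A\<close> dividing
          \<open>C B\<close>\<close>
      define C where "C = (\<Sum>j<e. monom (w $ j) j)"
      have coC: "coeff C j = (if j < e then w $ j else 0)" for j
        unfolding C_def by (simp add: coeff_sum)
      have R0: "(\<Sum>j<e. smult (w $ j) (R j a)) = 0"
      proof (rule poly_eqI)
        fix i
        show "coeff (\<Sum>j<e. smult (w $ j) (R j a)) i = coeff 0 i"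
        proof (cases "i < e")
          case True
          then have "(transpose_mat (M a) *\<^sub>v w) $ i = (\<Sum>j<e. coeff (R j a) i * w $ j)"
            using w(1) unfolding M_def by (simp add: scalar_prod_def lessThan_atLeast0)
          then show ?thesis using w(3) True by (simp add: coeff_sum mult.commute)
        next
          case False
          then show ?thesis by (simp add: coeff_sum Re)
        qed
      qed
      have "C * B a = (\<Sum>j<e. smult (w $ j) (monom 1 j * B a))"
        unfolding C_def by (simp add: sum_distrib_right smult_monom flip: mult_smult_left)
      also have "\<dots> = A a * (\<Sum>j<e. smult (w $ j) (S j a)) + (\<Sum>j<e. smult (w $ j) (R j a))"
        unfolding eq by (simp add: smult_add_right sum.distrib sum_distrib_left)
      finally have "A a dvd C * B a" unfolding R0 by simp
      moreover have "A a \<noteq> 0" using monic[of a] by auto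
      ultimately have "A a dvd C" using dvd_of_dvd_mult_no_common_root no by blast
      moreover have "C \<noteq> 0"
      proof
        assume "C = 0"
        have "w = 0\<^sub>v e"
        proof (rule eq_vecI)
          fix j assume "j < dim_vec (0\<^sub>v e :: 'k vec)"
          then show "w $ j = 0\<^sub>v e $ j" using coC[of j] \<open>C = 0\<close> by simp
        qed (use w(1) in auto)
        then show False using w(2) by simp
      qed
      ultimately have "e \<le> degree C" using dvd_imp_degree_le dege by metis
      moreover have "coeff C (degree C) \<noteq> 0" using \<open>C \<noteq> 0\<close> by simp
      ultimately show False using coC by simp
    qed
  qed
  ultimately show ?thesis by (intro bexI[of _ "\<lambda>a. det (M a)"] allI)
qed

text \<open>
  The monic polynomials of degree \<open>d\<close> without a term of degree \<open>d - 1\<close>. Coordinates are numbered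
  from \<open>1\<close>, so \<open>a (Suc i)\<close> is the coefficient of \<open>X\<^sup>i\<close>.
\<close>
definition centered_poly :: "nat \<Rightarrow> (nat \<Rightarrow> 'k::field) \<Rightarrow> 'k poly" where
  "centered_poly d a = monom 1 d + (\<Sum>i<d - 1. monom (a (Suc i)) i)"

lemma coeff_centered_poly:
  "d \<ge> 1 \<Longrightarrow> coeff (centered_poly d a) j = (if j = d then 1 else if j < d - 1 then a (Suc j) else 0)"
  unfolding centered_poly_def by (auto simp: coeff_sum)

lemma degree_centered_poly: "d \<ge> 1 \<Longrightarrow> degree (centered_poly d a) = d"
  by (intro antisym degree_le le_degree) (auto simp: coeff_centered_poly)

lemma centered_poly_fams: "centered_poly d \<in> poly_fams (d - 1)"
proof -
  have "(\<lambda>a. monom 1 d + (\<Sum>i<d - 1. monom (a (Suc i)) i)) \<in> poly_fams (d - 1)"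
    by (intro poly_fams_add poly_fams_sum poly_fams_monom poly_funs.const poly_funs.coord) auto
  then show ?thesis unfolding centered_poly_def .
qed

lemma poly_iter_fams: "F \<in> poly_fams r \<Longrightarrow> (\<lambda>a. poly_iter (F a) k) \<in> poly_fams r"
proof (induction k)
  case 0
  have "(\<lambda>a. [:0, 1:]) \<in> poly_fams r" by (intro poly_fams.intros poly_funs.const)
  then show ?case by simp
next
  case (Suc k)
  show ?case using poly_fams_pcompose[OF Suc.prems Suc.IH[OF Suc.prems]] by simp
qed

lemma lead_coeff_poly_iter:
  fixes f :: "'a::idom poly"
  assumes "lead_coeff f = 1" "degree f > 0"
  shows "lead_coeff (poly_iter f k) = 1"
proof (induction k)
  case (Suc k)
  have "lead_coeff (pcompose f (poly_iter f k)) = lead_coeff f * lead_coeff (poly_iter f k) ^ degree f"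
    by (rule lead_coeff_comp) (use assms in \<open>simp add: degree_poly_iter\<close>)
  then show ?case using Suc assms by simp
qed simp

lemma coeff_poly_iter_diff:
  fixes f :: "'a::idom poly"
  assumes "lead_coeff f = 1" "degree f \<ge> 2" "l < k"
  shows "coeff (poly_iter f k - poly_iter f l) (degree f ^ k) = 1"
    "j > degree f ^ k \<Longrightarrow> coeff (poly_iter f k - poly_iter f l) j = 0"
proof -
  have lt: "degree f ^ l < degree f ^ k" using assms by (intro power_strict_increasing) auto
  then show "coeff (poly_iter f k - poly_iter f l) (degree f ^ k) = 1"
    using lead_coeff_poly_iter[OF assms(1), of k] assms(2)
    by (simp add: degree_poly_iter coeff_eq_0)
  show "coeff (poly_iter f k - poly_iter f l) j = 0" if "j > degree f ^ k"
    using that lt by (simp add: coeff_eq_0 degree_poly_iter)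
qed

text \<open>Nonempty Zariski open sets are dense.\<close>
lemma poly_funs_zero_of_mult:
  fixes F G :: "(nat \<Rightarrow> 'k::field_char_0) \<Rightarrow> 'k"
  assumes "F \<in> poly_funs n" "G \<in> poly_funs n" "\<And>a. G a \<noteq> 0 \<Longrightarrow> F a = 0" "G b \<noteq> 0"
  shows "F a = 0"
  using poly_funs_nonzero_mult[OF assms(1,2), of a b] assms(3,4) by blast

text \<open>
  Both resultants are nonzero polynomials in the coefficients: the periodic points of \<open>X ^ d\<close>
  are \<open>0\<close> and roots of unity and all of them are simple, and the critical orbit
  \<open>0, 1, 2, \<dots>\<close> of \<open>X ^ d + 1\<close> is infinite.
\<close>
theorem generic_centered_poly:
  assumes d: "d \<ge> 2" and N: "N > 0"
  shows "\<exists>D\<in>poly_funs (d - 1). (\<exists>a. D a \<noteq> 0) \<and> (\<forall>a :: nat \<Rightarrow> 'k::{alg_closed_field, field_char_0}. D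
      a \<noteq> 0 \<longrightarrow>
    (\<forall>x. (poly (centered_poly d a) ^^ N) x = x \<longrightarrow> poly (pderiv (poly_iter (centered_poly d a) N)) x \<noteq> 1) \<and>
    (\<forall>c. poly (pderiv (centered_poly d a)) c = 0 \<longrightarrow>
      (poly (centered_poly d a) ^^ (n + N)) c \<noteq> (poly (centered_poly d a) ^^ n) c))"
proof -
  let ?f = "centered_poly d :: (nat \<Rightarrow> 'k) \<Rightarrow> 'k poly"
  have deg: "degree (?f a) = d" for a using degree_centered_poly[of d a] d by simp
  have lead: "lead_coeff (?f a) = 1" for a using deg coeff_centered_poly[of d a d] d by simp
  have X: "poly_iter (?f a) 0 = [:0, 1:]" for a by simp
  have "\<exists>D\<in>poly_funs (d - 1). \<forall>a. D a \<noteq> 0 \<longleftrightarrow> (\<forall>x. poly (poly_iter (?f a) N - poly_iter (?f a) 0) x = 0 \<longrightarrow>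
      poly (pderiv (poly_iter (?f a) N - poly_iter (?f a) 0)) x \<noteq> 0)"
    using coeff_poly_iter_diff[OF lead, of _ 0 N] deg d N
    by (intro ex_resultant[where e = "d ^ N"] poly_fams_diff poly_fams_pderiv poly_iter_fams
        centered_poly_fams) auto
  then obtain D1 where D1: "D1 \<in> poly_funs (d - 1)" "\<And>a. D1 a \<noteq> 0 \<longleftrightarrow>
      (\<forall>x. (poly (?f a) ^^ N) x = x \<longrightarrow> poly (pderiv (poly_iter (?f a) N)) x \<noteq> 1)"
    by (auto simp: poly_poly_iter pderiv_diff pderiv_pCons)
  have "\<exists>D\<in>poly_funs (d - 1). \<forall>a. D a \<noteq> 0 \<longleftrightarrow> (\<forall>x. poly (smult (inverse (of_nat d)) (pderiv (?f a))) x
      = 0 \<longrightarrow>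
      poly (poly_iter (?f a) (n + N) - poly_iter (?f a) n) x \<noteq> 0)"
  proof (rule ex_resultant[where e = "d - 1"])
    show "(\<lambda>a. smult (inverse (of_nat d)) (pderiv (?f a))) \<in> poly_fams (d - 1)"
      by (intro poly_fams_smult poly_funs.const poly_fams_pderiv centered_poly_fams)
    show "(\<lambda>a. poly_iter (?f a) (n + N) - poly_iter (?f a) n) \<in> poly_fams (d - 1)"
      by (intro poly_fams_diff poly_iter_fams centered_poly_fams)
    show "coeff (smult (inverse (of_nat d)) (pderiv (?f a))) (d - 1) = 1" for a
      using d by (simp add: coeff_pderiv coeff_centered_poly)
    show "coeff (smult (inverse (of_nat d)) (pderiv (?f a))) j = 0" if "j > d - 1" for a j
      using d that by (simp add: coeff_pderiv coeff_centered_poly)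
  qed
  then obtain D2 where D2: "D2 \<in> poly_funs (d - 1)" "\<And>a. D2 a \<noteq> 0 \<longleftrightarrow>
      (\<forall>c. poly (pderiv (?f a)) c = 0 \<longrightarrow> (poly (?f a) ^^ (n + N)) c \<noteq> (poly (?f a) ^^ n) c)"
    using d by (auto simp: poly_poly_iter)
  have "D1 (\<lambda>i. 0) \<noteq> 0"
    unfolding D1(2)
  proof (intro allI impI notI)
    let ?e = "d ^ N"
    have it: "poly_iter (?f (\<lambda>i. 0)) k = monom 1 (d ^ k)" for k
    proof (induction k)
      case (Suc k)
      have "pcompose (monom 1 d) (monom 1 (d ^ k)) = (monom 1 (d ^ Suc k) :: 'k poly)"
        by (simp add: monom_altdef[of 1 d] pcompose_pow pcompose_pCons monom_power mult.commute)
      then show ?case using Suc by (simp add: centered_poly_def)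
    qed (simp add: monom_Suc monom_0)
    have "d ^ 1 \<le> ?e" using d N by (intro power_increasing) auto
    then have e: "?e \<ge> 2" using d by simp
    fix x assume "(poly (?f (\<lambda>i. 0)) ^^ N) x = x"
    then have x: "x ^ ?e = x" by (simp add: it poly_monom flip: poly_poly_iter)
    assume "poly (pderiv (poly_iter (?f (\<lambda>i. 0)) N)) x = 1"
    then have der: "of_nat ?e * x ^ (?e - 1) = 1" by (simp add: it pderiv_monom poly_monom)
    have "x \<noteq> 0" using der e by (auto simp: power_0_left)
    moreover have "x ^ ?e = x * x ^ (?e - 1)"
      using power_Suc[of x "?e - 1"] Suc_diff_1[of ?e] e by (metis not_gr_zero not_numeral_le_zero)
    ultimately have "x ^ (?e - 1) = 1" using x by simp
    then have "of_nat ?e = (of_nat 1 :: 'k)" using der by simp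
    then show False using e unfolding of_nat_eq_iff by linarith
  qed
  moreover have "D2 (\<lambda>i. if i = 1 then 1 else 0) \<noteq> 0"
    unfolding D2(2)
  proof (intro allI impI)
    let ?a = "\<lambda>i. if i = 1 then 1 else 0 :: 'k"
    have f: "?f ?a = monom 1 d + 1"
    proof (rule poly_eqI)
      fix j
      show "coeff (?f ?a) j = coeff (monom 1 d + 1) j" using d by (auto simp: coeff_centered_poly)
    qed
    fix c assume "poly (pderiv (?f ?a)) c = 0"
    then have c: "c = 0" using d unfolding f by (simp add: pderiv_add pderiv_monom poly_monom)
    define g where "g = (\<lambda>m::nat. m ^ d + 1)"
    have orb: "(poly (?f ?a) ^^ l) 0 = of_nat ((g ^^ l) 0)" for l
      unfolding f by (induction l) (simp_all add: g_def poly_monom)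
    have "m < g m" for m
    proof (cases "m = 0")
      case False
      then show ?thesis using d power_increasing[of 1 d m] by (simp add: g_def)
    qed (simp add: g_def)
    then have "strict_mono (\<lambda>l. (g ^^ l) 0)" by (intro strict_mono_Suc_iff[THEN iffD2]) simp
    then have "(g ^^ n) 0 < (g ^^ (n + N)) 0" by (rule strict_monoD) (use N in simp)
    then show "(poly (?f ?a) ^^ (n + N)) c \<noteq> (poly (?f ?a) ^^ n) c" unfolding c orb of_nat_eq_iff by simp
  qed
  ultimately obtain a where "D1 a * D2 a \<noteq> 0"
    using poly_funs_nonzero_mult[OF D1(1) D2(1)] by (metis mult_eq_0_iff)
  then show ?thesis using D1 D2
    by (intro bexI[of _ "\<lambda>a. D1 a * D2 a"] conjI exI[of _ a] allI impI poly_funs.mult) auto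
qed

section \<open>Affine conjugation and centered coordinates\<close>

lemma coeff_pcompose_scale: "coeff (pcompose p [:0, r:]) k = r ^ k * coeff p k" for r ::
    "'a::comm_ring_1"
proof (induction p arbitrary: k)
  case (pCons a p)
  then show ?case by (cases k) (simp_all add: pcompose_pCons algebra_simps)
qed simp

lemma coeff_pcompose_shift:
  fixes f :: "'a::comm_ring_1 poly"
  assumes "degree f \<le> d"
  shows "coeff (pcompose f [:z, 1:]) k = (\<Sum>i\<le>d. coeff f i * of_nat (i choose k) * z ^ (i - k))"
proof -
  have "pcompose f [:z, 1:] = (\<Sum>i\<le>d. smult (coeff f i) ([:z, 1:] ^ i))"
  proof -
    have "f = (\<Sum>i\<le>d. monom (coeff f i) i)" by (rule poly_as_sum_of_monoms'[OF assms, symmetric])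
    then have "pcompose f [:z, 1:] = pcompose (\<Sum>i\<le>d. monom (coeff f i) i) [:z, 1:]" by simp
    also have "\<dots> = (\<Sum>i\<le>d. smult (coeff f i) ([:z, 1:] ^ i))"
      by (simp add: pcompose_sum monom_altdef pcompose_smult pcompose_pow pcompose_pCons)
    finally show ?thesis .
  qed
  then have "coeff (pcompose f [:z, 1:]) k = (\<Sum>i\<le>d. coeff f i * coeff ([:z, 1:] ^ i) k)"
    by (simp add: coeff_sum)
  also have "\<dots> = (\<Sum>i\<le>d. coeff f i * of_nat (i choose k) * z ^ (i - k))"
  proof (rule sum.cong[OF refl])
    fix i
    show "coeff f i * coeff ([:z, 1:] ^ i) k = coeff f i * of_nat (i choose k) * z ^ (i - k)"
    proof (cases "k \<le> i")
      case True
      then show ?thesis by (simp add: coeff_linear_poly_power mult.assoc)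
    next
      case False
      have "degree ([:z, 1:] ^ i) \<le> degree [:z, 1:] * i" by (rule degree_power_le)
      then have "coeff ([:z, 1:] ^ i) k = 0" using False by (intro coeff_eq_0) auto
      then show ?thesis using False by (simp add: binomial_eq_0)
    qed
  qed
  finally show ?thesis .
qed

text \<open>
  The mean of the \<open>d\<close> preimages of a point, counted with multiplicity, which for \<open>d \<ge> 2\<close> is the same
  for all points. Affine conjugation therefore carries it along.
\<close>
definition center :: "nat \<Rightarrow> 'a::field poly \<Rightarrow> 'a" where
  "center d f = - coeff f (d - 1) / (of_nat d * coeff f d)"

definition recenter :: "'a::field \<Rightarrow> 'a poly \<Rightarrow> 'a poly" where
  "recenter z f = pcompose f [:z, 1:] - [:z:]"

lemma coeff_recenter_subleading:
  fixes f :: "'a::field_char_0 poly"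
  assumes "degree f = d" "d \<ge> 2"
  shows "coeff (recenter z f) (d - 1) = 0 \<longleftrightarrow> z = center d f"
proof -
  obtain e where e: "d = Suc e" "e \<ge> 1" using assms(2) by (cases d) auto
  have "coeff (recenter z f) (d - 1) = coeff (pcompose f [:z, 1:]) e"
    using e by (cases e) (auto simp: recenter_def)
  also have "\<dots> = (\<Sum>i\<le>d. coeff f i * of_nat (i choose e) * z ^ (i - e))"
    by (rule coeff_pcompose_shift) (use assms in simp)
  also have "\<dots> = (\<Sum>i\<in>{e, Suc e}. coeff f i * of_nat (i choose e) * z ^ (i - e))"
    by (rule sum.mono_neutral_right) (auto simp: e binomial_eq_0)
  also have "\<dots> = coeff f e + coeff f d * of_nat d * z" by (simp add: e)
  finally have "coeff (recenter z f) (d - 1) = coeff f e + coeff f d * of_nat d * z" .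
  moreover have "coeff f d \<noteq> 0" using assms leading_coeff_0_iff[of f] by auto
  moreover have "of_nat d \<noteq> (0 :: 'a)" using assms(2) by simp
  moreover have "coeff f e + coeff f d * of_nat d * z = 0 \<longleftrightarrow> z * (of_nat d * coeff f d) = - coeff f e"
    by (simp add: eq_neg_iff_add_eq_0 ac_simps)
  moreover have "z * B = - A \<longleftrightarrow> z = - A / B" if "B \<noteq> 0" for A B
    by (rule nonzero_eq_divide_eq[OF that, symmetric])
  ultimately show ?thesis using e(1) unfolding center_def by (simp del: of_nat_Suc)
qed

lemma degree_recenter:
  assumes "degree (f :: 'a::field poly) = d" "d \<ge> 1"
  shows "degree (recenter z f) = d"
proof -
  have "degree (pcompose f [:z, 1:]) = d" using assms by (simp add: degree_pcompose)
  then have "degree (pcompose f [:z, 1:] + - [:z:]) = d" using assms by (subst degree_add_eq_left) auto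
  then show ?thesis by (simp only: recenter_def diff_conv_add_uminus)
qed

lemma lead_coeff_recenter:
  assumes "degree (f :: 'a::field poly) = d" "d \<ge> 1"
  shows "coeff (recenter z f) d = coeff f d"
proof -
  have "coeff (pcompose f [:z, 1:]) d = (\<Sum>i\<le>d. coeff f i * of_nat (i choose d) * z ^ (i - d))"
    by (rule coeff_pcompose_shift) (use assms in simp)
  also have "\<dots> = (\<Sum>i\<in>{d}. coeff f i * of_nat (i choose d) * z ^ (i - d))"
    by (rule sum.mono_neutral_right) (auto simp: binomial_eq_0)
  finally show ?thesis using assms(2) by (cases d) (simp_all add: recenter_def)
qed

lemma centered_polyI:
  assumes "degree c = d" "d \<ge> 2" "coeff c d = 1" "coeff c (d - 1) = (0 :: 'a::field)"
  shows "c = centered_poly d (\<lambda>i. coeff c (i - 1))"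
proof (rule poly_eqI)
  fix j
  have "j = d \<or> j < d - 1 \<or> j = d - 1 \<or> j > d" by linarith
  then show "coeff c j = coeff (centered_poly d (\<lambda>i. coeff c (i - 1))) j"
    using assms by (auto simp: coeff_centered_poly coeff_eq_0)
qed

text \<open>Recentering removes the subleading term; the scale is a \<open>(d - 1)\<close>-th root of the leading
    coefficient.\<close>
lemma conjugate_centered:
  fixes f :: "'k::{alg_closed_field, field_char_0} poly"
  assumes deg: "degree f = d" and d: "d \<ge> 2"
  shows "\<exists>s z a. s \<noteq> 0 \<and> (\<forall>x. poly (centered_poly d a) (s * (x - z)) = s * (poly f x - z))"
proof -
  define z where "z = center d f"
  define g where "g = recenter z f"
  have lc: "coeff f d \<noteq> 0" using deg d leading_coeff_0_iff[of f] by auto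
  obtain s where s: "s ^ (d - 1) = coeff f d" using nth_root_exists[of "d - 1" "coeff f d"] d by auto
  have s0: "s \<noteq> 0" using s lc d by (auto simp: power_0_left)
  define c where "c = smult s (pcompose g [:0, inverse s:])"
  have co: "coeff c j = s * inverse s ^ j * coeff g j" for j
    unfolding c_def by (simp add: coeff_pcompose_scale mult.assoc)
  have "degree c = d" unfolding c_def g_def using degree_recenter[OF deg, of z] d s0
    by (simp add: degree_pcompose)
  moreover have "coeff c d = 1"
  proof -
    have "s * inverse s ^ d * s ^ (d - 1) = inverse s ^ d * s ^ Suc (d - 1)" by simp
    also have "\<dots> = (inverse s * s) ^ d" using d by (simp add: power_mult_distrib del: power_Suc)
    finally show ?thesis using lead_coeff_recenter[OF deg, of z] d s s0 by (simp add: co g_def)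
  qed
  moreover have "coeff c (d - 1) = 0"
    unfolding co g_def z_def using coeff_recenter_subleading[OF deg d] by simp
  ultimately have c: "c = centered_poly d (\<lambda>i. coeff c (i - 1))" using centered_polyI d by blast
  have "poly c (s * (x - z)) = s * (poly f x - z)" for x
  proof -
    have "s * (x - z) * inverse s = x - z" using s0 by (simp add: mult.commute[of s] mult.assoc)
    then have "z + s * (x - z) * inverse s = z + (x - z)" by (rule arg_cong)
    also have "\<dots> = x" by simp
    finally have "z + s * (x - z) * inverse s = x" .
    then show ?thesis by (simp add: c_def g_def recenter_def poly_pcompose)
  qed
  with s0 c show ?thesis by metis
qed

section \<open>The upper bounds for the dimension of the moduli space\<close>

lemma krull_dim_le:
  fixes X :: "(nat \<Rightarrow> 'k::field) set"
  assumes "\<And>r g. (\<And>i. i \<in> {1..r} \<Longrightarrow> g i \<in> poly_funs n) \<Longrightarrow> alg_indep X r g \<Longrightarrow> r \<le> m"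
  shows "krull_dim (subtopology (zariski n) X) \<le> enat m"
  unfolding krull_dim_def
proof (rule SUP_least)
  fix r assume "r \<in> {r. \<exists>Z :: nat \<Rightarrow> (nat \<Rightarrow> 'k) set.
    (\<forall>i\<le>r. closedin (subtopology (zariski n) X) (Z i) \<and> irreducible_in (subtopology (zariski n) X)
        (Z i)) \<and>
    (\<forall>i<r. Z i \<subset> Z (Suc i))}"
  then obtain Z :: "nat \<Rightarrow> (nat \<Rightarrow> 'k) set" where
    Z: "\<forall>i\<le>r. closedin (subtopology (zariski n) X) (Z i) \<and> irreducible_in (subtopology (zariski n)
        X) (Z i)"
      "\<forall>i<r. Z i \<subset> Z (Suc i)" by (elim CollectE exE conjE)
  obtain g where g: "\<forall>i\<in>{1..r}. g i \<in> poly_funs n" "alg_indep (Z r) r g"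
    using chain_alg_indep[of r n X Z] Z by auto
  have "Z r \<subseteq> X" using Z(1) unfolding irreducible_in_def topspace_subtopology by blast
  then have "alg_indep X r g" using g(2) unfolding alg_indep_def by blast
  then show "enat r \<le> enat m" using assms[of r g] g(1) by simp
qed

lemma portrait_moduliD:
  assumes "q \<in> portrait_moduli n P d"
  shows "q \<in> affine_space n" "inj_on q {1..n}" "q 1 = 0" "q 2 = 1"
    "\<exists>f. degree f = d \<and> (\<forall>i\<in>{1..n}. poly f (q i) = q (P i))"
  using assms unfolding portrait_moduli_def conf_portrait_def conf_def by auto

text \<open>A normalized configuration has \<open>n - 2\<close> free coordinates.\<close>
lemma krull_dim_moduli_le_points:
  fixes n d P
  assumes n: "n \<ge> 2"
  shows "krull_dim (subtopology (zariski n) (portrait_moduli n P d :: (nat \<Rightarrow> 'k::field_char_0) set))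
      \<le> enat (n - 2)"
proof (rule krull_dim_le)
  let ?M = "portrait_moduli n P d :: (nat \<Rightarrow> 'k) set"
  fix r and g :: "nat \<Rightarrow> (nat \<Rightarrow> 'k) \<Rightarrow> 'k"
  assume g: "\<And>i. i \<in> {1..r} \<Longrightarrow> g i \<in> poly_funs n" "alg_indep ?M r g"
  define G :: "nat \<Rightarrow> (nat \<Rightarrow> 'k) \<Rightarrow> 'k poly"
    where "G = (\<lambda>j a. [: - (if j = 1 then 0 else if j = 2 then 1 else a (j - 2)), 1:])"
  show "r \<le> n - 2"
  proof (rule alg_indep_le_parameters[where e = 1 and G = G and T = "(\<lambda>q. (\<lambda>i. q (i + 2), q)) ` ?M"
      and \<delta> = "\<lambda>q. 1" and n = n and \<phi> = g])
    show "G j \<in> poly_fams (n - 2)" if j: "j \<in> {1..n}" for j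
    proof -
      have "(\<lambda>a. - (if j = 1 then 0 else if j = 2 then 1 else a (j - 2))) \<in> poly_funs (n - 2)"
        using j by (cases "j = 1"; cases "j = 2") (auto intro!: poly_funs_uminus poly_funs.intros)
      then show ?thesis unfolding G_def by (intro poly_fams.intros poly_funs.const)
    qed
    show "poly (G j a) (x j) = 0" if ax: "(a, x) \<in> (\<lambda>q. (\<lambda>i. q (i + 2), q)) ` ?M" and j:
        "j \<in> {1..n}" for a x j
    proof -
      have x: "x \<in> ?M" "a = (\<lambda>i. x (i + 2))" using ax by auto
      have "j = 1 \<or> j = 2 \<or> j - 2 + 2 = j" using j by auto
      then show ?thesis using portrait_moduliD(3,4)[OF x(1)] unfolding G_def x(2) by auto
    qed
    show "g i \<in> regular_funs n (\<lambda>q. 1)" if "i \<in> {1..r}" for i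
        by (rule regular_funs_poly[OF g(1)[OF that]])
    show "alg_indep ((\<lambda>q. (\<lambda>i. q (i + 2), q)) ` ?M) r (\<lambda>i t. g i (snd t))"
      using g(2) unfolding alg_indep_def by simp
    show "coeff (G j a) i = 0" if "i > 1" for j a i
      using that unfolding G_def by (intro coeff_eq_0) simp
  qed (simp_all add: G_def poly_funs.const)
qed

text \<open>
  Over the moduli space lie the pairs of a monic centered polynomial \<open>f\<close>, given by \<open>d - 1\<close>
  parameters, and a configuration \<open>x\<close> that realizes the portrait on \<open>f\<close>. The coordinates of \<open>x\<close> are
  roots of the monic polynomial \<open>f\<^sup>n\<^sup>+\<^sup>n\<^sup>! - f\<^sup>n\<close>, and normalizing \<open>x\<close> maps onto the moduli space.
\<close>
lemma krull_dim_moduli_le_coeffs: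
  fixes n d P
  assumes n: "n \<ge> 2" and d: "d \<ge> 2" and P: "P \<in> {1..n} \<rightarrow> {1..n}"
  shows "krull_dim (subtopology (zariski n)
    (portrait_moduli n P d :: (nat \<Rightarrow> 'k::{alg_closed_field, field_char_0}) set)) \<le> enat (d - 1)"
proof (rule krull_dim_le)
  let ?M = "portrait_moduli n P d :: (nat \<Rightarrow> 'k) set"
  fix r and g :: "nat \<Rightarrow> (nat \<Rightarrow> 'k) \<Rightarrow> 'k"
  assume g: "\<And>i. i \<in> {1..r} \<Longrightarrow> g i \<in> poly_funs n" "alg_indep ?M r g"
  have n12: "1 \<in> {1..n}" "2 \<in> {1..n}" using n by auto
  define T where "T = {(a, x :: nat \<Rightarrow> 'k). x 1 \<noteq> x 2 \<and> (\<forall>j\<in>{1..n}. poly (centered_poly d a) (x j) =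
      x (P j))}"
  define \<pi> where "\<pi> = (\<lambda>(x :: nat \<Rightarrow> 'k) (j :: nat). (x j - x 1) * inverse (x 2 - x 1) :: 'k)"
  define G :: "nat \<Rightarrow> (nat \<Rightarrow> 'k) \<Rightarrow> 'k poly" where "G = (\<lambda>j a. poly_iter (centered_poly d a) (n +
      fact n) - poly_iter (centered_poly d a) n)"
  have deg: "degree (centered_poly d a) = d" for a :: "nat \<Rightarrow> 'k"
      using degree_centered_poly[of d a] d by simp
  have lead: "lead_coeff (centered_poly d a) = 1" for a :: "nat \<Rightarrow> 'k"
      using deg coeff_centered_poly[of d a d] d by simp
  show "r \<le> d - 1"
  proof (rule alg_indep_le_parameters[where e = "d ^ (n + fact n)" and G = G and T = T
      and \<delta> = "\<lambda>x. x 2 - x 1" and n = n and \<phi> = "\<lambda>i x. g i (\<pi> x)"])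
    show "G j \<in> poly_fams (d - 1)" for j
      unfolding G_def by (intro poly_fams_diff poly_iter_fams centered_poly_fams)
    show "coeff (G j a) (d ^ (n + fact n)) = 1" for j a
      using coeff_poly_iter_diff(1)[OF lead, of a n "n + fact n"] deg[of a] d unfolding G_def by simp
    show "coeff (G j a) i = 0" if "i > d ^ (n + fact n)" for j a i
      using coeff_poly_iter_diff(2)[OF lead, of a n "n + fact n" i] deg[of a] d that unfolding G_def
          by simp
    show "poly (G j a) (x j) = 0" if ax: "(a, x) \<in> T" and j: "j \<in> {1..n}" for a x j
    proof -
      have it: "(poly (centered_poly d a) ^^ l) (x j) = x ((P ^^ l) j)" for l
        by (rule funpow_equivariant[of "{1..n}", OF funcset_mem[OF P] _ j])
            (use ax in \<open>auto simp: T_def\<close>)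
      have "(P ^^ (n + fact n)) j = (P ^^ n) j"
        by (rule funpow_preperiodic[of "{1..n}", OF _ _ funcset_mem[OF P] j]) auto
      then show ?thesis unfolding G_def by (simp add: poly_poly_iter it)
    qed
    show "(\<lambda>x. x 2 - x 1) \<in> poly_funs n" by (intro poly_funs_diff poly_funs.coord n12)
    show "x 2 - x 1 \<noteq> 0" if "(a, x) \<in> T" for a x using that by (auto simp: T_def)
    show "(\<lambda>x. g i (\<pi> x)) \<in> regular_funs n (\<lambda>x. x 2 - x 1)" if i: "i \<in> {1..r}" for i
    proof -
      have "(\<lambda>x. g i (\<lambda>j. \<pi> x j)) \<in> regular_funs n (\<lambda>x. x 2 - x 1)"
      proof (rule regular_funs_subst[OF g(1)[OF i]])
        show "(\<lambda>x. \<pi> x j) \<in> regular_funs n (\<lambda>x. x 2 - x 1)" if "j \<in> {1..n}" for j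
          unfolding \<pi>_def
          by (intro regular_funs_mult regular_funs_poly poly_funs_diff poly_funs.coord that n12
              regular_funs_inverse[where f = "\<lambda>x. 1"] poly_funs.const) simp
      qed (intro poly_funs_diff poly_funs.coord n12)
      then show ?thesis .
    qed
    show "alg_indep T r (\<lambda>i t. g i (\<pi> (snd t)))"
      unfolding alg_indep_def
    proof (intro ballI impI allI)
      fix F y assume F: "F \<in> poly_funs r" and van: "\<forall>t\<in>T. F (\<lambda>i. g i (\<pi> (snd t))) = 0"
      have "F (\<lambda>i. g i q) = 0" if q: "q \<in> ?M" for q
      proof -
        obtain f where f: "degree f = d" "\<forall>i\<in>{1..n}. poly f (q i) = q (P i)"
          using portrait_moduliD(5)[OF q] by blast
        obtain s z a where s: "s \<noteq> 0" "\<And>x. poly (centered_poly d a) (s * (x - z)) = s * (poly f x - z)"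
          using conjugate_centered[OF f(1) d] by blast
        define x where "x = (\<lambda>j. s * (q j - z))"
        have x12: "x 2 - x 1 = s" using portrait_moduliD(3,4)[OF q] by (simp add: x_def algebra_simps)
        have "(a, x) \<in> T" unfolding T_def using x12 s f(2) by (auto simp: x_def)
        then have "F (\<lambda>i. g i (\<pi> x)) = 0" using van by fastforce
        moreover have "\<pi> x = q"
        proof
          fix j
          have "x j - x 1 = s * q j" using portrait_moduliD(3)[OF q] by (simp add: x_def algebra_simps)
          then show "\<pi> x j = q j" unfolding \<pi>_def x12 using s(1) by simp
        qed
        ultimately show ?thesis by simp
      qed
      then show "F y = 0" using g(2) F unfolding alg_indep_def by blast
    qed
  qed (use d in auto)
qed

section \<open>The moduli space as a locally closed set\<close>

text \<open>The product runs over all ordered pairs, so up to sign this is the squared Vandermonde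
    determinant.\<close>
definition points_discriminant :: "nat \<Rightarrow> (nat \<Rightarrow> 'k::field) \<Rightarrow> 'k" where
  "points_discriminant n q = (\<Prod>i\<in>{1..n}. \<Prod>j\<in>{1..n} - {i}. (q i - q j))"

lemma points_discriminant_eq_0_iff: "points_discriminant n q = 0 \<longleftrightarrow> \<not> inj_on q {1..n}"
  unfolding points_discriminant_def inj_on_def by (auto simp: prod_zero_iff)

lemma points_discriminant_poly_funs: "points_discriminant n \<in> poly_funs n"
proof -
  have "(\<lambda>q. \<Prod>i\<in>{1..n}. \<Prod>j\<in>{1..n} - {i}. (q i - q j)) \<in> poly_funs n"
    by (intro poly_funs_prod poly_funs_diff poly_funs.coord) auto
  then show ?thesis unfolding points_discriminant_def .
qed

text \<open>
  The Lagrange interpolation polynomial of the values \<open>q (P i)\<close> at the nodes \<open>q i\<close>, with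
  denominators cleared by \<^const>\<open>points_discriminant\<close>.
\<close>
definition interpolant :: "nat \<Rightarrow> (nat \<Rightarrow> nat) \<Rightarrow> (nat \<Rightarrow> 'k::field) \<Rightarrow> 'k poly" where
  "interpolant n P q = (\<Sum>i\<in>{1..n}.
    smult (q (P i) * (\<Prod>k\<in>{1..n} - {i}. \<Prod>j\<in>{1..n} - {k}. (q k - q j))) (\<Prod>j\<in>{1..n} - {i}. [:- q j, 1:]))"

lemma interpolant_poly_fams:
  assumes P: "P \<in> {1..n} \<rightarrow> {1..n}"
  shows "interpolant n P \<in> poly_fams n"
proof -
  have "(\<lambda>q. \<Sum>i\<in>{1..n}. smult (q (P i) * (\<Prod>k\<in>{1..n} - {i}. \<Prod>j\<in>{1..n} - {k}. (q k - q j)))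
      (\<Prod>j\<in>{1..n} - {i}. [:- q j, 1:])) \<in> poly_fams n"
    by (intro poly_fams_sum poly_fams_smult poly_funs.mult poly_funs.coord funcset_mem[OF P]
        poly_funs_prod
        poly_funs_diff poly_fams_prod poly_fams.intros poly_funs_uminus poly_funs.const) auto
  then show ?thesis unfolding interpolant_def .
qed

lemma poly_interpolant:
  assumes k: "k \<in> {1..n}"
  shows "poly (interpolant n P q) (q k) = points_discriminant n q * q (P k)"
proof -
  have "poly (interpolant n P q) (q k) =
      (\<Sum>i\<in>{1..n}. q (P i) * (\<Prod>k\<in>{1..n} - {i}. \<Prod>j\<in>{1..n} - {k}. (q k - q j)) * (\<Prod>j\<in>{1..n} - {i}. (q k
          - q j)))"
    unfolding interpolant_def by (simp add: poly_sum poly_prod)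
  also have "\<dots> = (\<Sum>i\<in>{k}. q (P i) * (\<Prod>k\<in>{1..n} - {i}. \<Prod>j\<in>{1..n} - {k}. (q k - q j)) * (\<Prod>j\<in>{1..n} -
      {i}. (q k - q j)))"
  proof (rule sum.mono_neutral_right)
    show "\<forall>i\<in>{1..n} - {k}. q (P i) * (\<Prod>k\<in>{1..n} - {i}. \<Prod>j\<in>{1..n} - {k}. (q k - q j)) * (\<Prod>j\<in>{1..n} -
        {i}. (q k - q j)) = 0"
    proof
      fix i assume "i \<in> {1..n} - {k}"
      then have "k \<in> {1..n} - {i}" using k by auto
      then have "(\<Prod>j\<in>{1..n} - {i}. (q k - q j)) = 0" by (intro prod_zero) auto
      then show "q (P i) * (\<Prod>k\<in>{1..n} - {i}. \<Prod>j\<in>{1..n} - {k}. (q k - q j)) * (\<Prod>j\<in>{1..n} - {i}. (q k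
          - q j)) = 0"
        by simp
    qed
  qed (use k in auto)
  also have "\<dots> = points_discriminant n q * q (P k)"
    unfolding points_discriminant_def using k by (subst prod.remove[of "{1..n}" k]) (auto simp: ac_simps)
  finally show ?thesis .
qed

lemma degree_interpolant:
  assumes "n \<ge> 1"
  shows "degree (interpolant n P q) < n"
proof -
  have "degree (interpolant n P q) \<le> n - 1"
    unfolding interpolant_def
  proof (rule degree_sum_le)
    fix i assume i: "i \<in> {1..n}"
    have "degree (\<Prod>j\<in>{1..n} - {i}. [:- q j, 1:]) \<le> (\<Sum>j\<in>{1..n} - {i}. degree [:- q j, 1:])"
      using degree_prod_sum_le[of "{1..n} - {i}" "\<lambda>j. [:- q j, 1:]"] by (simp add: o_def)
    also have "\<dots> = n - 1" using i by simp
    finally show "degree (smult (q (P i) * (\<Prod>k\<in>{1..n} - {i}. \<Prod>j\<in>{1..n} - {k}. (q k - q j)))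
        (\<Prod>j\<in>{1..n} - {i}. [:- q j, 1:])) \<le> n - 1"
      using degree_smult_le le_trans by blast
  qed simp
  then show ?thesis using assms by simp
qed

lemma interpolant_unique:
  assumes inj: "inj_on q {1..n}" and f: "\<And>i. i \<in> {1..n} \<Longrightarrow> poly f (q i) = q (P i)"
    and deg: "degree f < n"
  shows "interpolant n P q = smult (points_discriminant n q) f"
proof (rule poly_eqI_degree[of "q ` {1..n}"])
  show "poly (interpolant n P q) x = poly (smult (points_discriminant n q) f) x" if x:
      "x \<in> q ` {1..n}" for x
  proof -
    obtain k where k: "k \<in> {1..n}" "x = q k" using x by blast
    then show ?thesis by (simp add: poly_interpolant[OF k(1)] f[OF k(1)])
  qed
  have "card (q ` {1..n}) = n" using card_image[OF inj] by simp
  then show "degree (interpolant n P q) < card (q ` {1..n})"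
      "degree (smult (points_discriminant n q) f) < card (q ` {1..n})"
    using degree_interpolant[of n P q] deg degree_smult_le[of "points_discriminant n q" f] by auto
qed

text \<open>
  For \<open>n \<le> d\<close> every configuration is allowed: adding a multiple of \<open>\<Prod>\<^sub>j (X - q j)\<close> raises the degree of
  the interpolation polynomial to \<open>d\<close>.
\<close>
lemma portrait_moduli_few_points:
  assumes n: "1 \<le> n" "n \<le> d"
  shows "portrait_moduli n P d = {q \<in> affine_space n. (\<forall>f\<in>{\<lambda>q. q 1, \<lambda>q. q 2 - 1}. f q = 0) \<and>
      points_discriminant n q \<noteq> (0 :: 'k::field)}"
proof -
  have "\<exists>f. degree f = d \<and> (\<forall>i\<in>{1..n}. poly f (q i) = q (P i))" if inj: "inj_on q {1..n}" for q ::
      "nat \<Rightarrow> 'k"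
  proof -
    let ?L = "smult (inverse (points_discriminant n q)) (interpolant n P q)"
    let ?W = "monom 1 (d - n) * (\<Prod>j\<in>{1..n}. [:- q j, 1:])"
    have v: "points_discriminant n q \<noteq> 0" using inj by (simp add: points_discriminant_eq_0_iff)
    have "degree (\<Prod>j\<in>{1..n}. [:- q j, 1:]) = n"
      by (subst degree_prod_eq_sum_degree) auto
    moreover have "(\<Prod>j\<in>{1..n}. [:- q j, 1:]) \<noteq> 0" by simp
    ultimately have "degree ?W = d" using n by (subst degree_mult_eq) (auto simp: degree_monom_eq
        monom_eq_0_iff)
    moreover have "degree ?L < d"
      using degree_smult_le[of "inverse (points_discriminant n q)"
          "interpolant n P q"] degree_interpolant[of n P q] n by linarith
    ultimately have "degree (?W + ?L) = d" by (subst degree_add_eq_left) auto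
    moreover have "poly (?W + ?L) (q i) = q (P i)" if i: "i \<in> {1..n}" for i
    proof -
      have "poly ?W (q i) = 0" using i by (auto simp: poly_prod prod_zero_iff)
      moreover have "poly ?L (q i) = q (P i)" using v poly_interpolant[OF i, of P q] by simp
      ultimately show ?thesis by (simp only: poly_add add_0)
    qed
    ultimately show ?thesis by blast
  qed
  then show ?thesis
    unfolding portrait_moduli_def conf_portrait_def conf_def by (auto simp: points_discriminant_eq_0_iff)
qed

text \<open>
  For \<open>n > d\<close> a polynomial of degree \<open>d\<close> through the points is the interpolation polynomial, so its
  coefficients express the condition.
\<close>
lemma portrait_moduli_many_points:
  assumes n: "n > d" and d: "d \<ge> 1"
  shows "portrait_moduli n P d = {q \<in> affine_space n.
    (\<forall>f\<in>{\<lambda>q. q 1, \<lambda>q. q 2 - 1} \<union> (\<lambda>j q. coeff (interpolant n P q) j) ` {d<..}. f q = 0) \<and>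
    points_discriminant n q * coeff (interpolant n P q) d \<noteq> (0 :: 'k::field)}" (is "_ = ?R")
proof (intro equalityI subsetI)
  fix q :: "nat \<Rightarrow> 'k" assume q: "q \<in> portrait_moduli n P d"
  obtain f where f: "degree f = d" "\<forall>i\<in>{1..n}. poly f (q i) = q (P i)"
      using portrait_moduliD(5)[OF q] by blast
  have v: "points_discriminant n q \<noteq> 0" using portrait_moduliD(2)[OF q]
      by (simp add: points_discriminant_eq_0_iff)
  have i: "interpolant n P q = smult (points_discriminant n q) f"
    using interpolant_unique[of q n f P] portrait_moduliD(2)[OF q] f n by auto
  have "coeff f d \<noteq> 0" using f(1) d leading_coeff_0_iff[of f] by auto
  then show "q \<in> ?R" using portrait_moduliD(1,3,4)[OF q] v f(1) by (auto simp: i coeff_eq_0)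
next
  fix q :: "nat \<Rightarrow> 'k" assume q: "q \<in> ?R"
  then have v: "points_discriminant n q \<noteq> 0" "coeff (interpolant n P q) d \<noteq> 0" by auto
  let ?f = "smult (inverse (points_discriminant n q)) (interpolant n P q)"
  have "degree ?f = d"
    using v q by (intro antisym degree_le le_degree) auto
  moreover have "poly ?f (q i) = q (P i)" if "i \<in> {1..n}" for i
      using poly_interpolant[OF that, of P q] v(1) by simp
  ultimately show "q \<in> portrait_moduli n P d"
    using q v(1) unfolding portrait_moduli_def conf_portrait_def conf_def
    by (auto simp: points_discriminant_eq_0_iff intro!: exI[of _ ?f])
qed

section \<open>The lower bounds for the dimension of the moduli space\<close>

text \<open>The affine map that moves the first two points to \<open>0\<close> and \<open>1\<close>.\<close>
lemma normalize_realization: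
  fixes Q :: "nat \<Rightarrow> 'k::field"
  assumes n: "n \<ge> 2" and d: "d \<ge> 1" and P: "P \<in> {1..n} \<rightarrow> {1..n}" and Q: "inj_on Q {1..n}"
    and f: "degree f = d" "\<And>i. i \<in> {1..n} \<Longrightarrow> poly f (Q i) = Q (P i)"
  shows "(\<lambda>i\<in>{1..n}. (Q i - Q 1) / (Q 2 - Q 1)) \<in> portrait_moduli n P d" (is "?q \<in> _")
proof -
  let ?s = "Q 2 - Q 1"
  have n12: "1 \<in> {1..n}" "2 \<in> {1..n}" using n by auto
  have s: "?s \<noteq> 0" using inj_onD[OF Q, of 2 1] n12 by auto
  have "restrict Q {1..n} \<in> conf n"
    unfolding conf_def affine_space_def using Q
    by (intro CollectI conjI restrict_PiE_iff[THEN iffD2] ballI UNIV_I) (simp add: inj_on_restrict_eq)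
  moreover have "poly f (restrict Q {1..n} i) = restrict Q {1..n} (P i)" if "i \<in> {1..n}" for i
    using f(2)[OF that] that funcset_mem[OF P that] by simp
  ultimately have "restrict Q {1..n} \<in> conf_portrait n P d"
    unfolding conf_portrait_def using f(1) by blast
  then have "aff_act n (1 / ?s) (- Q 1 / ?s) (restrict Q {1..n}) \<in> conf_portrait n P d"
    by (intro aff_act_conf_portrait[OF P d]) (use s in auto)
  also have "aff_act n (1 / ?s) (- Q 1 / ?s) (restrict Q {1..n}) = ?q"
    unfolding aff_act_def by (rule restrict_ext) (simp add: diff_divide_distrib)
  finally have "?q \<in> conf_portrait n P d" .
  moreover have "?q 1 = 0" "?q 2 = 1" using n12 s by (simp_all del: atLeastAtMost_iff)
  ultimately show ?thesis unfolding portrait_moduli_def by (intro CollectI conjI)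
qed

text \<open>A nonempty open subset of the slice, on which the remaining points are independent.\<close>
lemma krull_dim_moduli_ge_few_points:
  fixes n d P
  assumes n: "n \<ge> 2" "n \<le> d" and ne: "(portrait_moduli n P d :: (nat \<Rightarrow> 'k::{alg_closed_field,
      field_char_0}) set) \<noteq> {}"
  shows "enat (n - 2) \<le> krull_dim (subtopology (zariski n) (portrait_moduli n P d :: (nat \<Rightarrow> 'k) set))"
proof (rule krull_dim_ge[where \<phi> = "\<lambda>i q. q (i + 2)", OF portrait_moduli_few_points])
  let ?M = "portrait_moduli n P d :: (nat \<Rightarrow> 'k) set"
  have n12: "1 \<in> {1..n}" "2 \<in> {1..n}" using n by auto
  show "{\<lambda>q. q 1, \<lambda>q. q 2 - 1} \<subseteq> poly_funs n"
    by (intro insert_subsetI empty_subsetI poly_funs_diff poly_funs.coord poly_funs.const n12)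
  show "(\<lambda>q. q (i + 2)) \<in> regular_funs n (points_discriminant n)" if "i \<in> {1..n - 2}" for i
    using that by (intro regular_funs_poly poly_funs.coord) auto
  fix F and y :: "nat \<Rightarrow> 'k" assume F: "F \<in> poly_funs (n - 2)" and van: "\<And>q. q \<in> ?M \<Longrightarrow> F (\<lambda>i. q (i +
      2)) = 0"
  define glue where "glue = (\<lambda>(y :: nat \<Rightarrow> 'k) i. if i = 1 then 0 else if i = 2 then 1 else y (i - 2))"
  have U: "(\<lambda>y. points_discriminant n (\<lambda>i. glue y i)) \<in> poly_funs (n - 2)"
  proof (rule poly_funs_subst[OF points_discriminant_poly_funs])
    fix i assume "i \<in> {1..n}"
    then show "(\<lambda>y. glue y i) \<in> poly_funs (n - 2)"
      unfolding glue_def by (cases "i = 1"; cases "i = 2") (auto intro!: poly_funs.intros)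
  qed
  obtain q0 where q0: "q0 \<in> ?M" using ne by blast
  have "points_discriminant n (glue (\<lambda>i. q0 (i + 2))) = points_discriminant n q0"
  proof (rule poly_funs_cong[OF points_discriminant_poly_funs])
    fix i assume "i \<in> {1..n}"
    then have "i = 1 \<or> i = 2 \<or> i \<noteq> 1 \<and> i \<noteq> 2 \<and> i - 2 + 2 = i" by auto
    then show "glue (\<lambda>i. q0 (i + 2)) i = q0 i"
      using portrait_moduliD(3,4)[OF q0] unfolding glue_def by (elim disjE conjE) simp_all
  qed
  then have U0: "points_discriminant n (glue (\<lambda>i. q0 (i + 2))) \<noteq> 0"
    using portrait_moduliD(2)[OF q0] by (simp add: points_discriminant_eq_0_iff)
  have "F y = 0" if "points_discriminant n (glue y) \<noteq> 0" for y
  proof -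
    let ?q = "restrict (glue y) {1..n}"
    have "points_discriminant n ?q = points_discriminant n (glue y)"
      by (rule poly_funs_cong[OF points_discriminant_poly_funs]) auto
    then have "?q \<in> ?M" using that n12
      by (subst portrait_moduli_few_points) (use n in \<open>auto simp: affine_space_def glue_def\<close>)
    then have "F (\<lambda>i. ?q (i + 2)) = 0" by (rule van)
    also have "F (\<lambda>i. ?q (i + 2)) = F y"
      by (rule poly_funs_cong[OF F]) (auto simp: glue_def)
    finally show ?thesis .
  qed
  then show "F y = 0" using poly_funs_zero_of_mult[OF F U _ U0] by blast
qed (use n points_discriminant_poly_funs in auto)

text \<open>
  The coefficients \<open>c\<^sub>j\<close> of the recentered interpolation polynomial are regular functions on the
  moduli space; rescaling multiplies \<open>c\<^sub>j\<close> by the \<open>(j - 1)\<close>-st power of the scale, so that the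
  products \<open>c\<^sub>j c\<^sub>0 ^ (j - 1)\<close> only depend on the conjugacy class. On the class of a monic
  centered polynomial they are monomials in its coefficients, and together they take generic values.
\<close>
lemma krull_dim_moduli_ge_many_points:
  fixes n d P
  assumes n: "n > d" and d: "d \<ge> 2" and P: "P \<in> {1..n} \<rightarrow> {1..n}"
    and D: "D \<in> poly_funs (d - 1)" "D a0 \<noteq> 0"
    and realize: "\<And>a :: nat \<Rightarrow> 'k::{alg_closed_field, field_char_0}. D a \<noteq> 0 \<Longrightarrow>
      \<exists>Q. inj_on Q {1..n} \<and> (\<forall>i\<in>{1..n}. poly (centered_poly d a) (Q i) = Q (P i))"
  shows "enat (d - 1) \<le> krull_dim (subtopology (zariski n) (portrait_moduli n P d :: (nat \<Rightarrow> 'k) set))"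
proof -
  let ?M = "portrait_moduli n P d :: (nat \<Rightarrow> 'k) set"
  have n12: "1 \<in> {1..n}" "2 \<in> {1..n}" using n d by auto
  define B where "B = (\<lambda>j (q :: nat \<Rightarrow> 'k). coeff (interpolant n P q) j)"
  have B: "B j \<in> poly_funs n" for j unfolding B_def
      by (rule poly_fams_coeff[OF interpolant_poly_fams[OF P]])
  define u where "u = (\<lambda>q. points_discriminant n q * B d q)"
  have u: "u \<in> poly_funs n" unfolding u_def by (intro poly_funs.mult points_discriminant_poly_funs B)
  define b where "b = (\<lambda>j q. B j q * inverse (points_discriminant n q))"
  have b: "b j \<in> regular_funs n u" for j
    unfolding b_def by (intro regular_funs_mult regular_funs_poly B regular_funs_inverse[OF B[of
        d]]) (simp add: u_def)
  define z where "z = (\<lambda>q. - inverse (of_nat d) * B (d - 1) q * inverse (B d q))"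
  have z: "z \<in> regular_funs n u"
    unfolding z_def by (intro regular_funs_mult regular_funs_poly B poly_funs.const
        regular_funs_inverse[OF points_discriminant_poly_funs]) (simp add: u_def mult.commute)
  \<comment> \<open>\<open>b j\<close>, \<open>z\<close> and \<open>c j\<close>: coefficients and center of the polynomial, and its recentered coefficients\<close>
  define c where "c = (\<lambda>j q. (\<Sum>i\<le>d. b i q * of_nat (i choose j) * z q ^ (i - j)) + (if j =
      0 then - 1 else 0) * z q)"
  have c: "c j \<in> regular_funs n u" for j
    unfolding c_def
    by (intro regular_funs_add[OF u] regular_funs_sum[OF u] regular_funs_mult regular_funs_power b z
        regular_funs_poly poly_funs.const)
  \<comment> \<open>\<open>c (d - 1)\<close> vanishes, hence the invariant that belongs to \<open>c d\<close> takes the index \<open>1\<close>\<close>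
  define \<phi> where "\<phi> = (\<lambda>i q. if i = 1 then c d q * c 0 q ^ (d - 1) else c (i - 1) q * c 0 q ^ (i - 2))"
  define \<psi> where "\<psi> = (\<lambda>(a :: nat \<Rightarrow> 'k) i. if i = 1 then a 1 ^ (d - 1) else a i * a 1 ^ (i - 2))"
  have c_eq: "c j q = coeff (recenter (center d f) f) j"
    if q: "q \<in> ?M" and f: "degree f = d" "\<And>i. i \<in> {1..n} \<Longrightarrow> poly f (q i) = q (P i)" for q f j
  proof -
    have v: "points_discriminant n q \<noteq> 0" using portrait_moduliD(2)[OF q]
        by (simp add: points_discriminant_eq_0_iff)
    have "interpolant n P q = smult (points_discriminant n q) f"
      by (rule interpolant_unique[OF portrait_moduliD(2)[OF q] f(2)]) (use f(1) n in auto)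
    then have Bq: "B i q = points_discriminant n q * coeff f i" for i by (simp add: B_def)
    have "b i q = coeff f i" for i unfolding b_def Bq using v by simp
    moreover have "z q = center d f" unfolding z_def Bq center_def using v by (simp add: field_simps)
    ultimately show ?thesis
      unfolding c_def recenter_def coeff_diff using coeff_pcompose_shift[of f d "center d f" j] f(1)
      by (cases j) auto
  qed
  have attained: "\<exists>q\<in>?M. \<forall>i\<in>{1..d - 1}. \<phi> i q = \<psi> a i" if a: "D a \<noteq> 0" for a
  proof -
    obtain Q where Q: "inj_on Q {1..n}" "\<And>i. i \<in> {1..n} \<Longrightarrow> poly (centered_poly d a) (Q i) = Q (P i)"
      using realize[OF a] by blast
    define s where "s = Q 2 - Q 1"
    have s: "s \<noteq> 0" using inj_onD[OF Q(1), of 2 1] n12 unfolding s_def by auto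
    define q where "q = (\<lambda>i\<in>{1..n}. (Q i - Q 1) / s)"
    have deg: "degree (centered_poly d a) = d" by (rule degree_centered_poly) (use d in simp)
    have q: "q \<in> ?M"
      unfolding q_def s_def by (rule normalize_realization[OF _ _ P Q(1) deg Q(2)]) (use n d in auto)
    define h where "h = smult (1 / s) (pcompose (centered_poly d a) [:Q 1, s:] - [:Q 1:])"
    have qi: "q i = (Q i - Q 1) / s" if "i \<in> {1..n}" for i using that by (simp add: q_def)
    have hq: "poly h (q i) = q (P i)" if i: "i \<in> {1..n}" for i
    proof -
      have "Q 1 + s * q i = Q i" using s by (simp add: qi[OF i])
      then have "poly h (q i) = (poly (centered_poly d a) (Q i) - Q 1) / s"
        unfolding h_def by (simp add: poly_pcompose mult.commute[of _ s])
      then show ?thesis using Q(2)[OF i] qi[OF funcset_mem[OF P i]] by simp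
    qed
    have rec: "recenter (- Q 1 / s) h = smult (1 / s) (pcompose (centered_poly d a) [:0, s:])"
    proof -
      have "pcompose [:Q 1, s:] [:- Q 1 / s, 1:] = [:0, s:]" using s by (simp add: pcompose_pCons)
      then have "pcompose (pcompose (centered_poly d a) [:Q 1, s:]) [:- Q 1 / s, 1:] =
          pcompose (centered_poly d a) [:0, s:]"
        by (simp only: pcompose_assoc[symmetric])
      then show ?thesis unfolding recenter_def h_def
        by (simp add: pcompose_smult pcompose_diff smult_diff_right)
    qed
    have degh: "degree h = d"
    proof -
      have "degree (pcompose (centered_poly d a) [:Q 1, s:]) = d" using deg s
          by (simp add: degree_pcompose)
      then have "degree (pcompose (centered_poly d a) [:Q 1, s:] + - [:Q 1:]) = d"
        using d by (subst degree_add_eq_left) auto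
      then show ?thesis unfolding h_def using s by (simp only: degree_smult_eq diff_conv_add_uminus) simp
    qed
    have co: "coeff (recenter (- Q 1 / s) h) j = s ^ j * coeff (centered_poly d a) j / s" for j
      unfolding rec by (simp add: coeff_pcompose_scale)
    have "coeff (recenter (- Q 1 / s) h) (d - 1) = 0"
      unfolding co using d by (simp add: coeff_centered_poly)
    then have "- Q 1 / s = center d h" using coeff_recenter_subleading[OF degh d] by blast
    then have cq: "c j q = s ^ j * coeff (centered_poly d a) j / s" for j
      using c_eq[OF q degh hq] co by simp
    have c0: "c 0 q = a 1 / s" using d by (simp add: cq coeff_centered_poly)
    have "\<phi> i q = \<psi> a i" if i: "i \<in> {1..d - 1}" for i
    proof (cases "i = 1")
      case True
      have "c d q = s ^ (d - 1)" using d s power_minus_mult[of d s]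
          by (simp add: cq coeff_centered_poly field_simps)
      then show ?thesis using True s unfolding \<phi>_def \<psi>_def c0 by (simp add: power_divide)
    next
      case False
      then obtain k where k: "i = Suc (Suc k)" using i
          by (metis atLeastAtMost_iff le0 not0_implies_Suc not_one_le_zero One_nat_def)
      have "c (i - 1) q = s ^ k * a i" using i s by (simp add: k cq coeff_centered_poly)
      then show ?thesis using False s unfolding \<phi>_def \<psi>_def c0 by (simp add: k power_divide)
    qed
    then show ?thesis using q by blast
  qed
  have \<phi>: "\<phi> i \<in> regular_funs n u" for i
    unfolding \<phi>_def by (cases "i = 1") (simp_all add: regular_funs_mult regular_funs_power c)
  show ?thesis
  proof (rule krull_dim_ge[where \<phi> = \<phi> and u = u])
    show "?M = {q \<in> affine_space n. (\<forall>f\<in>{\<lambda>q. q 1, \<lambda>q. q 2 - 1} \<union> B ` {d<..}. f q = 0) \<and> u q \<noteq> 0}"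
      unfolding B_def u_def by (rule portrait_moduli_many_points) (use n d in auto)
    show "{\<lambda>q. q 1, \<lambda>q. q 2 - 1} \<union> B ` {d<..} \<subseteq> poly_funs n"
      by (intro Un_least image_subsetI B insert_subsetI empty_subsetI poly_funs_diff poly_funs.coord
          poly_funs.const n12)
    fix F and y :: "nat \<Rightarrow> 'k" assume F: "F \<in> poly_funs (d - 1)" and van: "\<And>q. q \<in> ?M \<Longrightarrow> F (\<lambda>i. \<phi> i q) = 0"
    have "(\<lambda>a. F (\<lambda>i. (\<lambda>a. \<psi> a i) a)) \<in> poly_funs (d - 1)"
    proof (rule poly_funs_subst[OF F])
      fix i assume "i \<in> {1..d - 1}"
      then show "(\<lambda>a. \<psi> a i) \<in> poly_funs (d - 1)" unfolding \<psi>_def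
        by (cases "i = 1") (auto intro!: poly_funs.mult poly_funs_power poly_funs.coord)
    qed
    then have F\<psi>: "(\<lambda>a. F (\<psi> a)) \<in> poly_funs (d - 1)" by simp
    have "F (\<psi> a) = 0" if a: "D a \<noteq> 0" for a
    proof -
      obtain q where q: "q \<in> ?M" "\<forall>i\<in>{1..d - 1}. \<phi> i q = \<psi> a i" using attained[OF a] by blast
      have "F (\<lambda>i. \<phi> i q) = F (\<psi> a)" by (rule poly_funs_cong[OF F]) (use q(2) in blast)
      then show ?thesis using van[OF q(1)] by simp
    qed
    then have all: "F (\<psi> a) = 0" for a using poly_funs_zero_of_mult[OF F\<psi> D(1) _ D(2)] by blast
    have "F y = 0" if y: "y 1 \<noteq> 0" for y
    proof -
      obtain r where r: "r ^ (d - 1) = y 1" using nth_root_exists[of "d - 1" "y 1"] d by auto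
      have r0: "r \<noteq> 0" using r y d by (auto simp: power_0_left)
      let ?a = "\<lambda>i. if i = 1 then r else y i / r ^ (i - 2)"
      have "F (\<psi> ?a) = F y"
        by (rule poly_funs_cong[OF F]) (use r r0 in \<open>auto simp: \<psi>_def\<close>)
      then show ?thesis using all by metis
    qed
    moreover have "(\<lambda>y. y 1) \<in> poly_funs (d - 1)" by (rule poly_funs.coord) (use d in auto)
    ultimately show "F y = 0" using poly_funs_zero_of_mult[OF F, of "\<lambda>y. y 1" "\<lambda>i. 1" y] by simp
  qed (use \<phi> u in auto)
qed

lemma generic_realization:
  fixes P :: "nat \<Rightarrow> nat" and n d :: nat
  assumes d: "d \<ge> 2" and P: "P \<in> {1..n} \<rightarrow> {1..n}"
    and fibres: "\<And>i. i \<in> {1..n} \<Longrightarrow> card {j \<in> {1..n}. P j = i} \<le> d"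
    and cycles: "\<And>k. k > 0 \<Longrightarrow> int (card {i \<in> {1..n}. exact_period P k i}) \<le>
      (\<Sum>j | j dvd k. moebius_mu (k div j) * int (d ^ j))"
  shows "\<exists>D\<in>poly_funs (d - 1). (\<exists>a. D a \<noteq> 0) \<and> (\<forall>a :: nat \<Rightarrow> 'k::{alg_closed_field, field_char_0}. D
      a \<noteq> 0 \<longrightarrow>
    (\<exists>Q. inj_on Q {1..n} \<and> (\<forall>i\<in>{1..n}. poly (centered_poly d a) (Q i) = Q (P i))))"
proof -
  obtain D :: "(nat \<Rightarrow> 'k) \<Rightarrow> 'k" where D: "D \<in> poly_funs (d - 1)" "\<exists>a. D a \<noteq> 0"
    and good: "\<And>a. D a \<noteq> 0 \<Longrightarrow>
      (\<forall>x. (poly (centered_poly d a) ^^ fact n) x = x \<longrightarrow> poly (pderiv (poly_iter (centered_poly d a)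
          (fact n))) x \<noteq> 1) \<and>
      (\<forall>c. poly (pderiv (centered_poly d a)) c = 0 \<longrightarrow>
        (poly (centered_poly d a) ^^ (Suc n + fact n)) c \<noteq> (poly (centered_poly d a) ^^ Suc n) c)"
    using generic_centered_poly[OF d, of "fact n" "Suc n"] by auto
  have "\<exists>Q. inj_on Q {1..n} \<and> (\<forall>i\<in>{1..n}. poly (centered_poly d a) (Q i) = Q (P i))" if a: "D a \<noteq> 0"
      for a
  proof (rule realize_portrait[OF P degree_centered_poly d fibres cycles])
    show "(poly (centered_poly d a) ^^ Suc (n + fact n)) c \<noteq> (poly (centered_poly d a) ^^ Suc n) c"
      if "poly (pderiv (centered_poly d a)) c = 0" for c
      using good[OF a] that by (metis add_Suc)
  qed (use good[OF a] d in auto)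
  then show ?thesis using D by (intro bexI[of _ D] conjI allI impI)
qed

theorem theorem1p4:
  fixes P :: "nat \<Rightarrow> nat" and n d :: nat
  assumes "n \<ge> 2" and "d \<ge> 2" and "P \<in> {1..n} \<rightarrow> {1..n}"
  shows "((portrait_moduli n P d :: (nat \<Rightarrow> 'k::{alg_closed_field, field_char_0}) set) \<noteq> {} \<longleftrightarrow>
      (\<forall>i\<in>{1..n}. card {j \<in> {1..n}. P j = i} \<le> d) \<and>
      (\<forall>k\<ge>1. real (card (portrait_cycles n P k)) \<le>
          1 / real k * (\<Sum>j | j dvd k. of_int (moebius_mu (k div j)) * real d ^ j)))
    \<and> ((portrait_moduli n P d :: (nat \<Rightarrow> 'k) set) \<noteq> {} \<longrightarrow>
      krull_dim (subtopology (zariski n) (portrait_moduli n P d :: (nat \<Rightarrow> 'k) set)) =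
        enat (min (d - 1) (n - 2)))"
proof -
  let ?M = "portrait_moduli n P d :: (nat \<Rightarrow> 'k) set"
  let ?fibres = "\<forall>i\<in>{1..n}. card {j \<in> {1..n}. P j = i} \<le> d"
  let ?cycles = "\<forall>k>0. int (card {i \<in> {1..n}. exact_period P k i}) \<le>
      (\<Sum>j | j dvd k. moebius_mu (k div j) * int (d ^ j))"
  note n = assms(1) and d = assms(2) and P = assms(3)
  have cycles: "(\<forall>k\<ge>1. real (card (portrait_cycles n P k)) \<le>
      1 / real k * (\<Sum>j | j dvd k. of_int (moebius_mu (k div j)) * real d ^ j)) \<longleftrightarrow> ?cycles"
    using cycle_bound_iff[OF P] by (simp add: Suc_le_eq)
  have nec: "?fibres \<and> ?cycles" if ne: "?M \<noteq> {}"
  proof -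
    obtain q where q: "q \<in> ?M" using ne by blast
    obtain f where f: "degree f = d" "\<And>i. i \<in> {1..n} \<Longrightarrow> poly f (q i) = q (P i)"
      using portrait_moduliD(5)[OF q] by blast
    show ?thesis
      using portrait_conditions_necessary[OF P portrait_moduliD(2)[OF q] f(1) d f(2)] by blast
  qed
  have gen: "\<exists>D\<in>poly_funs (d - 1). (\<exists>a. D a \<noteq> 0) \<and> (\<forall>a :: nat \<Rightarrow> 'k. D a \<noteq> 0 \<longrightarrow>
      (\<exists>Q. inj_on Q {1..n} \<and> (\<forall>i\<in>{1..n}. poly (centered_poly d a) (Q i) = Q (P i))))"
    if "?fibres \<and> ?cycles"
    using that by (intro generic_realization[OF d P]) auto
  have suf: "?M \<noteq> {}" if cond: "?fibres \<and> ?cycles"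
  proof -
    obtain a :: "nat \<Rightarrow> 'k" and Q where "inj_on Q {1..n}"
        "\<forall>i\<in>{1..n}. poly (centered_poly d a) (Q i) = Q (P i)"
      using gen[OF cond] by blast
    then show ?thesis
      using normalize_realization[OF n _ P, of d Q
          "centered_poly d a"] degree_centered_poly[of d a] d by auto
  qed
  have "krull_dim (subtopology (zariski n) ?M) = enat (min (d - 1) (n - 2))" if ne: "?M \<noteq> {}"
  proof (rule antisym)
    show "krull_dim (subtopology (zariski n) ?M) \<le> enat (min (d - 1) (n - 2))"
    proof (cases "d - 1 \<le> n - 2")
      case True
      then show ?thesis unfolding min_absorb1[OF True] by (intro krull_dim_moduli_le_coeffs n d P)
    next
      case False
      then have "min (d - 1) (n - 2) = n - 2" by simp
      then show ?thesis by (simp only:) (rule krull_dim_moduli_le_points[OF n])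
    qed
    show "enat (min (d - 1) (n - 2)) \<le> krull_dim (subtopology (zariski n) ?M)"
    proof (cases "n \<le> d")
      case True
      then have "min (d - 1) (n - 2) = n - 2" by simp
      then show ?thesis using krull_dim_moduli_ge_few_points[OF n True ne] by simp
    next
      case False
      obtain D :: "(nat \<Rightarrow> 'k) \<Rightarrow> 'k" and a0 where D: "D \<in> poly_funs (d - 1)" "D a0 \<noteq> 0"
        "\<And>a. D a \<noteq> 0 \<Longrightarrow> \<exists>Q. inj_on Q {1..n} \<and> (\<forall>i\<in>{1..n}. poly (centered_poly d a) (Q i) = Q (P i))"
        using gen[OF nec[OF ne]] by blast
      have "min (d - 1) (n - 2) = d - 1" using False by simp
      then show ?thesis using krull_dim_moduli_ge_many_points[OF _ d P D] False by simp
    qed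
  qed
  then show ?thesis unfolding cycles using nec suf by blast
qed

end
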